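(* Let $R$ be an explicitly given finite $\mathbb{Z}$-algebra with generators $\mathcal{G}=(g_0,\dots,g_n)$. Let $f_1,\dots,f_p\in R$ be given by $f_k=b_{k0}g_0+\cdots+b_{kn}g_n$ with $b_{kj}\in\mathbb{Z}$. Then generators of the solution space in $R^p$ of the linear equation $f_1y_1+\cdots+f_py_p=0$ over $R$ can be computed in polynomial time in the bit complexity of the input, which is given by $\gamma$ (for $R$) and by $p(n+1)\log_2(M)$ with $M=\max\{|b_{kj}|\}$ (for the elements $f_1,\dots,f_p$).
   Context: All rings are commutative with $1$. A finite $\mathbb{Z}$-algebra is a $\mathbb{Z}$-algebra $R$ which is a finitely generated $\mathbb{Z}$-module; $R^+$ denotes its additive group. $R$ is called explicitly given if it is given by (a) generators $\mathcal{G}=(g_0,\dots,g_n)$ of the $\mathbb{Z}$-module $R^+$ with $g_0=1$, together with a matrix $A=(a_{\ell k})\in\mathrm{Mat}_{m,n+1}(\mathbb{Z})$ whose rows generate the syzygy module $\mathrm{Syz}_{\mathbb{Z}}(\mathcal{G})=\{(c_0,\dots,c_n)\in\mathbb{Z}^{n+1}\mid \sum_k c_kg_k=0\}$, and (b) structure constants $c_{ijk}\in\mathbb{Z}$ such that $g_ig_j=\sum_{k=0}^n c_{ijk}g_k$ for $i,j=0,\dots,n$. The bit complexity of this input defining $R$ is given by $\gamma=((n+1)^3+(n+1)m)\log_2(M')$ with $M'=\max\{|a_{\ell k}|,|c_{ijk}|\}$. Polynomial time means that the running time is bounded by a polynomial expression in the bit complexity of the input.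
   Formalization: The maxima M' and M in the bit complexities are replaced by max(2, M') and max(2, M), since entries in {-1,0,1} would give complexity 0 whatever the size; R ranges over rings with carrier in one arbitrary type (the natural numbers cover all up to isomorphism). *)

theory Defs
  imports
    "HOL-Algebra.Ring"
    "HOL-Computational_Algebra.Polynomial"
    "HOL-Library.Log_Nat"
begin

section \<open>Explicitly given finite algebras over the integers\<close>

definition int_comb :: "('a, 'b) ring_scheme \<Rightarrow> nat \<Rightarrow> (nat \<Rightarrow> 'a) \<Rightarrow> (nat \<Rightarrow> int) \<Rightarrow> 'a" where
  "int_comb R n g v = (\<Oplus>\<^bsub>R\<^esub>k\<in>{..n}. [v k] \<cdot>\<^bsub>R\<^esub> g k)"

text \<open>Tuples indexed by a finite set are extensional functions on that set.\<close>

definition syzygies :: "('a, 'b) ring_scheme \<Rightarrow> nat \<Rightarrow> (nat \<Rightarrow> 'a) \<Rightarrow> (nat \<Rightarrow> int) set" where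
  "syzygies R n g = {v \<in> {..n} \<rightarrow>\<^sub>E UNIV. int_comb R n g v = \<zero>\<^bsub>R\<^esub>}"

definition row_lattice :: "nat \<Rightarrow> nat \<Rightarrow> (nat \<Rightarrow> nat \<Rightarrow> int) \<Rightarrow> (nat \<Rightarrow> int) set" where
  "row_lattice n m A = {(\<lambda>k\<in>{..n}. \<Sum>l<m. x l * A l k) | x. True}"

text \<open>Commutative rings are the same as commutative algebras over the integers. Only the entries
  \<open>A l k\<close> with \<open>l < m\<close>, \<open>k \<le> n\<close> and \<open>c i j k\<close> with \<open>i, j, k \<le> n\<close> carry information.\<close>

locale explicitly_given_algebra = cring R for R (structure) +
  fixes n :: nat and g :: "nat \<Rightarrow> 'a"
    and m :: nat and A :: "nat \<Rightarrow> nat \<Rightarrow> int"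
    and c :: "nat \<Rightarrow> nat \<Rightarrow> nat \<Rightarrow> int"
  assumes gens_closed: "g \<in> {..n} \<rightarrow> carrier R"
    and gen_0: "g 0 = \<one>"
    and gens_generate: "carrier R = range (int_comb R n g)"
    and syzygies_eq: "syzygies R n g = row_lattice n m A"
    and structure_constants: "\<lbrakk>i \<le> n; j \<le> n\<rbrakk> \<Longrightarrow> g i \<otimes> g j = int_comb R n g (c i j)"

text \<open>The maxima are taken to be at least 2: with \<open>log 2 1 = 0\<close>, inputs with all entries in
  \<open>{-1, 0, 1}\<close> would otherwise have bit complexity 0, whatever their dimensions.\<close>

definition algebra_bits :: "nat \<Rightarrow> nat \<Rightarrow> (nat \<Rightarrow> nat \<Rightarrow> int) \<Rightarrow> (nat \<Rightarrow> nat \<Rightarrow> nat \<Rightarrow> int) \<Rightarrow> real" where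
  "algebra_bits n m A c =
     (let M' = Max ({2} \<union> {\<bar>A l k\<bar> | l k. l < m \<and> k \<le> n}
                        \<union> {\<bar>c i j k\<bar> | i j k. i \<le> n \<and> j \<le> n \<and> k \<le> n})
      in real ((n + 1) ^ 3 + (n + 1) * m) * log 2 (real_of_int M'))"

definition elements_bits :: "nat \<Rightarrow> nat \<Rightarrow> (nat \<Rightarrow> nat \<Rightarrow> int) \<Rightarrow> real" where
  "elements_bits n p b =
     (let M = Max ({2} \<union> {\<bar>b k j\<bar> | k j. k < p \<and> j \<le> n})
      in real (p * (n + 1)) * log 2 (real_of_int M))"


section \<open>Linear equations\<close>

definition solution_space :: "('a, 'b) ring_scheme \<Rightarrow> nat \<Rightarrow> (nat \<Rightarrow> 'a) \<Rightarrow> (nat \<Rightarrow> 'a) set" where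
  "solution_space R p f =
     {y \<in> {..<p} \<rightarrow>\<^sub>E carrier R. (\<Oplus>\<^bsub>R\<^esub>k\<in>{..<p}. f k \<otimes>\<^bsub>R\<^esub> y k) = \<zero>\<^bsub>R\<^esub>}"

text \<open>The \<open>R\<close>-submodule of \<open>R\<close> to the power \<open>p\<close> generated by \<open>Y 0, \<dots>, Y (q - 1)\<close>.\<close>

definition module_span :: "('a, 'b) ring_scheme \<Rightarrow> nat \<Rightarrow> nat \<Rightarrow> (nat \<Rightarrow> nat \<Rightarrow> 'a) \<Rightarrow> (nat \<Rightarrow> 'a) set" where
  "module_span R p q Y =
     {(\<lambda>k\<in>{..<p}. \<Oplus>\<^bsub>R\<^esub>s\<in>{..<q}. r s \<otimes>\<^bsub>R\<^esub> Y s k) | r. r \<in> {..<q} \<rightarrow> carrier R}"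


section \<open>Random access machines with logarithmic cost\<close>

text \<open>
  Time is measured on a random access machine in the sense of Aho, Hopcroft and Ullman, programmed
  with structured control flow: integer registers, indirectly addressed integer memory, a read-only
  input tape and a write-only output tape of integers. The memory is divided into arrays; a program
  mentions only finitely many of them. Each operation is charged by the bit lengths of the integers
  involved (products of bit lengths for multiplication and division), so that polynomial time is
  the same as on Turing machines working with binary representations.
\<close>

datatype exp =
    Const int
  | Reg nat
  | Load nat exp
  | Add exp exp
  | Sub exp exp
  | Mul exp exp
  | Div exp exp

datatype com =
    Skip
  | Assign nat exp
  | Store nat exp exp
  | Read nat
  | Write exp
  | Seq com com
  | Cond exp com com
  | While exp com

record ram_state =
  reg :: "nat \<Rightarrow> int"
  mem :: "nat \<Rightarrow> nat \<Rightarrow> int"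
  inp :: "int list"
  outp :: "int list"

text \<open>The binary digits of the absolute value, and a sign.\<close>

definition len :: "int \<Rightarrow> nat" where
  "len z = 1 + floorlog 2 (nat \<bar>z\<bar>)"

text \<open>Negative addresses are read as 0. Division rounds down; division by 0 gives 0.\<close>

primrec exp_val :: "exp \<Rightarrow> ram_state \<Rightarrow> int" where
  "exp_val (Const z) s = z"
| "exp_val (Reg x) s = reg s x"
| "exp_val (Load a e) s = mem s a (nat (exp_val e s))"
| "exp_val (Add e1 e2) s = exp_val e1 s + exp_val e2 s"
| "exp_val (Sub e1 e2) s = exp_val e1 s - exp_val e2 s"
| "exp_val (Mul e1 e2) s = exp_val e1 s * exp_val e2 s"
| "exp_val (Div e1 e2) s = exp_val e1 s div exp_val e2 s"

primrec exp_cost :: "exp \<Rightarrow> ram_state \<Rightarrow> nat" where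
  "exp_cost (Const z) s = len z"
| "exp_cost (Reg x) s = len (reg s x)"
| "exp_cost (Load a e) s =
     exp_cost e s + len (exp_val e s) + len (mem s a (nat (exp_val e s)))"
| "exp_cost (Add e1 e2) s =
     exp_cost e1 s + exp_cost e2 s + len (exp_val e1 s) + len (exp_val e2 s)"
| "exp_cost (Sub e1 e2) s =
     exp_cost e1 s + exp_cost e2 s + len (exp_val e1 s) + len (exp_val e2 s)"
| "exp_cost (Mul e1 e2) s =
     exp_cost e1 s + exp_cost e2 s + len (exp_val e1 s) * len (exp_val e2 s)"
| "exp_cost (Div e1 e2) s =
     exp_cost e1 s + exp_cost e2 s + len (exp_val e1 s) * len (exp_val e2 s)"

text \<open>\<open>exec c s t s'\<close>: started in \<open>s\<close>, program \<open>c\<close> halts after time \<open>t\<close> in \<open>s'\<close>. Conditions hold if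
  the value is positive. Reading past the end of the input yields 0.\<close>

inductive exec :: "com \<Rightarrow> ram_state \<Rightarrow> nat \<Rightarrow> ram_state \<Rightarrow> bool" where
  Skip: "exec Skip s 1 s"
| Assign: "exec (Assign x e) s (exp_cost e s + len (exp_val e s))
     (s\<lparr>reg := (reg s)(x := exp_val e s)\<rparr>)"
| Store: "exec (Store a e1 e2) s
     (exp_cost e1 s + exp_cost e2 s + len (exp_val e1 s) + len (exp_val e2 s))
     (s\<lparr>mem := (mem s)(a := (mem s a)(nat (exp_val e1 s) := exp_val e2 s))\<rparr>)"
| ReadNil: "inp s = [] \<Longrightarrow> exec (Read x) s 1 (s\<lparr>reg := (reg s)(x := 0)\<rparr>)"
| ReadCons: "inp s = z # zs \<Longrightarrow>
     exec (Read x) s (len z) (s\<lparr>reg := (reg s)(x := z), inp := zs\<rparr>)"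
| Write: "exec (Write e) s (exp_cost e s + len (exp_val e s))
     (s\<lparr>outp := outp s @ [exp_val e s]\<rparr>)"
| Seq: "\<lbrakk>exec c1 s t1 s'; exec c2 s' t2 s''\<rbrakk> \<Longrightarrow> exec (Seq c1 c2) s (t1 + t2) s''"
| CondTrue: "\<lbrakk>exp_val e s > 0; exec c1 s t s'\<rbrakk> \<Longrightarrow> exec (Cond e c1 c2) s (exp_cost e s + t) s'"
| CondFalse: "\<lbrakk>exp_val e s \<le> 0; exec c2 s t s'\<rbrakk> \<Longrightarrow> exec (Cond e c1 c2) s (exp_cost e s + t) s'"
| WhileFalse: "exp_val e s \<le> 0 \<Longrightarrow> exec (While e c) s (exp_cost e s) s"
| WhileTrue: "\<lbrakk>exp_val e s > 0; exec c s t1 s'; exec (While e c) s' t2 s''\<rbrakk> \<Longrightarrow>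
     exec (While e c) s (exp_cost e s + t1 + t2) s''"

inductive_cases exec_cases:
  "exec Skip s t s'" "exec (Assign x e) s t s'" "exec (Store a e1 e2) s t s'"
  "exec (Read x) s t s'" "exec (Write e) s t s'" "exec (Seq c1 c2) s t s'"
  "exec (Cond e c1 c2) s t s'" "exec (While e c) s t s'"

lemma exec_deterministic:
  "exec c s t s' \<Longrightarrow> exec c s u s'' \<Longrightarrow> u = t \<and> s'' = s'"
proof (induction arbitrary: u s'' rule: exec.induct)
  case (Seq c1 s t1 s' c2 t2 s2)
  from Seq.prems obtain u1 u2 r where "u = u1 + u2" "exec c1 s u1 r" "exec c2 r u2 s''"
    by (rule exec_cases(6))
  with Seq.IH show ?case by metis
next
  case (WhileTrue e s c t1 s' t2 s2)
  from WhileTrue.prems WhileTrue.hyps(1) obtain u1 u2 r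
    where "u = exp_cost e s + u1 + u2" "exec c s u1 r" "exec (While e c) r u2 s''"
    by (auto elim: exec_cases(8))
  with WhileTrue.IH show ?case by metis
next
  case (CondTrue e s c1 t s' c2)
  from CondTrue.prems CondTrue.hyps(1) obtain u1 where "u = exp_cost e s + u1" "exec c1 s u1 s''"
    by (auto elim: exec_cases(7))
  with CondTrue.IH show ?case by metis
next
  case (CondFalse e s c2 t s' c1)
  from CondFalse.prems CondFalse.hyps(1) obtain u1 where "u = exp_cost e s + u1" "exec c2 s u1 s''"
    by (auto elim: exec_cases(7))
  with CondFalse.IH show ?case by metis
next
  case (WhileFalse e s c)
  from WhileFalse.prems WhileFalse.hyps show ?case by (auto elim: exec_cases(8))
qed (erule exec_cases; simp)+

definition initial :: "int list \<Rightarrow> ram_state" where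
  "initial xs = \<lparr>reg = (\<lambda>_. 0), mem = (\<lambda>_ _. 0), inp = xs, outp = []\<rparr>"

definition computes_in :: "com \<Rightarrow> int list \<Rightarrow> nat \<Rightarrow> int list \<Rightarrow> bool" where
  "computes_in prog xs t ys \<longleftrightarrow> (\<exists>s. exec prog (initial xs) t s \<and> outp s = ys)"


section \<open>Encoding of inputs and outputs\<close>

definition encode_input ::
    "nat \<Rightarrow> nat \<Rightarrow> (nat \<Rightarrow> nat \<Rightarrow> int) \<Rightarrow> (nat \<Rightarrow> nat \<Rightarrow> nat \<Rightarrow> int) \<Rightarrow> nat \<Rightarrow> (nat \<Rightarrow> nat \<Rightarrow> int) \<Rightarrow> int list"
where
  "encode_input n m A c p b =
     [int n, int m, int p]
     @ [A l k. l \<leftarrow> [0..<m], k \<leftarrow> [0..<n + 1]]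
     @ [c i j k. i \<leftarrow> [0..<n + 1], j \<leftarrow> [0..<n + 1], k \<leftarrow> [0..<n + 1]]
     @ [b k j. k \<leftarrow> [0..<p], j \<leftarrow> [0..<n + 1]]"

text \<open>\<open>h s k\<close> is the coefficient vector of the \<open>k\<close>-th component of the \<open>s\<close>-th generator.\<close>

definition encode_output :: "nat \<Rightarrow> nat \<Rightarrow> nat \<Rightarrow> (nat \<Rightarrow> nat \<Rightarrow> nat \<Rightarrow> int) \<Rightarrow> int list" where
  "encode_output n p q h =
     int q # [h s k j. s \<leftarrow> [0..<q], k \<leftarrow> [0..<p], j \<leftarrow> [0..<n + 1]]"

end

theory Submission
  imports Defs "Jordan_Normal_Form.Determinant"
begin

text \<open>
  Put \<open>d = n + 1\<close>. An element of \<open>R\<^sup>p\<close> is given by \<open>p * d\<close> integer coefficients. By the structure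
  constants, \<open>f\<^sub>1 y\<^sub>1 + \<dots> + f\<^sub>p y\<^sub>p\<close> is the combination of the generators \<open>g\<close> whose coefficient vector
  depends linearly on the coefficients of \<open>y\<close>, and it vanishes iff that vector lies in the lattice
  spanned by the rows of \<open>A\<close>. Hence the solutions are the images of the vectors in the left kernel
  of an integer matrix \<open>B\<close> with \<open>N = m + p * d\<close> rows and \<open>d\<close> columns (\<open>equation_iff\<close>), and
  generators of the group \<open>{x. x B = 0}\<close> give generators of the solution space, first over the
  integers and a fortiori over \<open>R\<close> (\<open>span_eq_solution_space\<close>). It remains to compute generators of
  an integer kernel without letting the coefficients explode.

  This is done in two stages. Fraction-free Gauss-Jordan elimination on the columns replaces \<open>B\<close> by a
  matrix \<open>T\<close> with the same left kernel, in which each nonzero column has a pivot row that is zero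
  except for the entry \<open>\<delta>\<close> in that column. After each step the matrix is determined by the
  positions of the pivots chosen so far and has integer entries that the adjugate of a square
  submatrix of \<open>B\<close> expresses; this yields both the exactness of the divisions (\<open>reduced_step\<close>) and
  the size bound (\<open>reduced_bound\<close>). In the second stage, kernel vectors are first sought modulo \<open>\<delta>\<close>.
  A vector \<open>v\<close> with \<open>v T \<equiv> 0\<close> modulo \<open>\<delta>\<close> becomes a kernel vector after changing only its
  coordinates at the pivot rows, this correction is linear on such vectors, and it fixes the kernel;
  so it maps generators of \<open>{v. v T \<equiv> 0 mod \<delta>}\<close> to generators of the kernel (\<open>kernel_generators\<close>).
  Generators of the former group are the vectors \<open>\<delta> e\<^sub>j\<close> and \<open>N\<close> further vectors whose coefficients
  may be reduced modulo \<open>\<delta>\<close> all the time; the congruences are imposed one column after the other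
  by Euclid's algorithm (\<open>pair_lattice_start\<close>, \<open>pair_lattice_euclid\<close>, \<open>pair_lattice_end\<close>).

  The running time needs no separate analysis: if all integers stored during a run have absolute
  value at most \<open>2\<^sup>K\<close> and each loop is iterated at most \<open>X\<close> times whenever it is entered, then the
  time is at most \<open>K\<^sup>2\<close> times a polynomial in \<open>X\<close> that can be read off from the program text
  (\<open>time_bound_poly\<close>). The weakest preconditions \<open>wp\<close> used below therefore speak only about effects,
  sizes of stored values and numbers of iterations. With \<open>Z\<close> an upper bound for the bit complexity,
  \<open>K\<close> and \<open>X\<close> can be taken as multiples of \<open>Z\<^sup>2\<close> (\<open>program_correct\<close>, \<open>bits_bound\<close>).
\<close>

section \<open>Running time from the shape of a program\<close>

text \<open>
  If \<open>K\<close> bits suffice for everything stored, then \<open>K * esize e\<close> bits suffice for the value of \<open>e\<close>,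
  because \<open>x + y \<le> x * y\<close> for \<open>x, y \<ge> 2\<close>; hence the value of no subexpression needs a bound of its own.
  Evaluating \<open>e\<close> then costs at most \<open>eweight e * K\<^sup>2\<close>.
\<close>

fun esize :: "exp \<Rightarrow> nat" where
  "esize (Const z) = nat \<bar>z\<bar> + 1"
| "esize (Reg x) = 1"
| "esize (Load a e) = 1"
| "esize (Add e1 e2) = esize e1 + esize e2"
| "esize (Sub e1 e2) = esize e1 + esize e2"
| "esize (Mul e1 e2) = esize e1 + esize e2"
| "esize (Div e1 e2) = esize e1 + esize e2"

fun eweight :: "exp \<Rightarrow> nat" where
  "eweight (Const z) = 3 * esize (Const z)"
| "eweight (Reg x) = 3"
| "eweight (Load a e) = eweight e + 3 * esize e + 3"
| "eweight (Add e1 e2) = eweight e1 + eweight e2 + 3 * esize e1 + 3 * esize e2"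
| "eweight (Sub e1 e2) = eweight e1 + eweight e2 + 3 * esize e1 + 3 * esize e2"
| "eweight (Mul e1 e2) = eweight e1 + eweight e2 + 9 * esize e1 * esize e2"
| "eweight (Div e1 e2) = eweight e1 + eweight e2 + 9 * esize e1 * esize e2"

definition bounded_by :: "nat \<Rightarrow> ram_state \<Rightarrow> bool" where
  "bounded_by K s \<longleftrightarrow> (\<forall>x. \<bar>reg s x\<bar> \<le> 2 ^ K) \<and> (\<forall>a i. \<bar>mem s a i\<bar> \<le> 2 ^ K) \<and> (\<forall>z\<in>set (inp s). \<bar>z\<bar> \<le> 2 ^ K)"

text \<open>
  Also for the division that rounds down: a negative quotient of small absolute value is rounded to
  \<open>-1\<close>, but only if the dividend is nonzero.
\<close>

lemma abs_div_le: "\<bar>a div b\<bar> \<le> \<bar>a :: int\<bar>"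
proof -
  have pos: "\<bar>a div b\<bar> \<le> \<bar>a\<bar>" if "b > 0" for a b :: int
  proof (cases "a \<ge> 0")
    case True
    have "a div b \<ge> 0" using True that by (simp add: pos_imp_zdiv_nonneg_iff)
    moreover have "a div b \<le> a div 1" using True that by (intro zdiv_mono2) auto
    ultimately show ?thesis by simp
  next
    case False
    have "a div b \<le> 0" using False that by (simp add: div_nonpos_pos_le0)
    moreover have "a div 1 \<le> a div b" using False that by (intro zdiv_mono2_neg) auto
    ultimately show ?thesis by simp
  qed
  show ?thesis using pos[of b a] pos[of "-b" "-a"] by (cases "b = 0"; cases "b > 0") auto
qed

lemma esize_pos: "esize e \<ge> 1"
  by (induction e) auto

lemma abs_val_le:
  assumes "bounded_by K s" "K \<ge> 1"
  shows "\<bar>exp_val e s\<bar> \<le> 2 ^ (K * esize e)"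
proof (induction e)
  case (Const z)
  have "\<bar>z\<bar> = int (nat \<bar>z\<bar>)" by simp
  also have "\<dots> \<le> int (2 ^ nat \<bar>z\<bar>)" using less_exp[of "nat \<bar>z\<bar>"] by linarith
  also have "\<dots> \<le> 2 ^ (K * (nat \<bar>z\<bar> + 1))"
  proof -
    have "1 * nat \<bar>z\<bar> \<le> K * (nat \<bar>z\<bar> + 1)" using assms(2) by (intro mult_mono) auto
    then show ?thesis by (simp add: power_increasing del: mult_Suc_right)
  qed
  finally show ?case by simp
next
  case (Load a e)
  then show ?case using assms by (simp add: bounded_by_def)
next
  case (Reg x)
  then show ?case using assms by (simp add: bounded_by_def)
next
  case (Add e1 e2)
  have *: "(2::int) \<le> 2 ^ (K * esize e)" for e
    using power_increasing[of 1 "K * esize e" "2::int"] assms(2) esize_pos[of e] by simp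
  have "x + y \<le> x * y" if "2 \<le> x" "2 \<le> y" for x y :: int
    using mult_mono[of 1 "x - 1" 1 "y - 1"] that by (simp add: algebra_simps)
  from this[OF *[of e1] *[of e2]] Add show ?case by (simp add: distrib_left power_add)
next
  case (Sub e1 e2)
  have *: "(2::int) \<le> 2 ^ (K * esize e)" for e
    using power_increasing[of 1 "K * esize e" "2::int"] assms(2) esize_pos[of e] by simp
  have "x + y \<le> x * y" if "2 \<le> x" "2 \<le> y" for x y :: int
    using mult_mono[of 1 "x - 1" 1 "y - 1"] that by (simp add: algebra_simps)
  from this[OF *[of e1] *[of e2]] Sub show ?case by (simp add: distrib_left power_add)
next
  case (Mul e1 e2)
  then show ?case by (simp add: distrib_left power_add abs_mult mult_mono)
next
  case (Div e1 e2)
  have "\<bar>exp_val e1 s div exp_val e2 s\<bar> \<le> \<bar>exp_val e1 s\<bar>" by (rule abs_div_le)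
  also have "\<dots> \<le> 2 ^ (K * esize e1)" by (rule Div)
  also have "\<dots> \<le> 2 ^ (K * (esize e1 + esize e2))" by (intro power_increasing) auto
  finally show ?case by simp
qed

lemma len_le:
  assumes "\<bar>z\<bar> \<le> 2 ^ k"
  shows "len z \<le> k + 2"
proof -
  have "nat \<bar>z\<bar> \<le> 2 ^ k" using assms by (simp add: nat_le_iff)
  then have "floorlog 2 (nat \<bar>z\<bar>) \<le> floorlog 2 (2 ^ k)" by (rule floorlog_mono)
  also have "\<dots> \<le> k + 1" by (subst floorlog_le_iff) auto
  finally show ?thesis by (simp add: len_def)
qed

lemma len_val_le:
  assumes "bounded_by K s" "K \<ge> 1"
  shows "len (exp_val e s) \<le> 3 * esize e * K"
proof -
  have "len (exp_val e s) \<le> K * esize e + 2" by (rule len_le[OF abs_val_le[OF assms]])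
  moreover have "1 \<le> K * esize e" using esize_pos[of e] assms by (simp add: Suc_le_eq)
  moreover have "3 * esize e * K = 3 * (K * esize e)" by simp
  ultimately show ?thesis by linarith
qed

lemma len_val_le2:
  assumes "bounded_by K s" "K \<ge> 1"
  shows "len (exp_val e s) \<le> 3 * esize e * K\<^sup>2"
  by (rule order_trans[OF len_val_le[OF assms, of e]]) (use assms(2) in \<open>simp add: power2_eq_square\<close>)

lemma exp_cost_le:
  assumes "bounded_by K s" "K \<ge> 1"
  shows "exp_cost e s \<le> eweight e * K\<^sup>2"
proof -
  have m: "\<bar>mem s a i\<bar> \<le> 2 ^ K" and r: "\<bar>reg s x\<bar> \<le> 2 ^ K" for a i x
    using assms(1) by (auto simp: bounded_by_def)
  have mm: "len (mem s a i) \<le> 3 * K\<^sup>2" and rr: "len (reg s x) \<le> 3 * K\<^sup>2" for a i x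
  proof -
    have "K * 1 \<le> K * K" using assms(2) by (intro mult_mono) auto
    then show "len (mem s a i) \<le> 3 * K\<^sup>2" "len (reg s x) \<le> 3 * K\<^sup>2"
      using len_le[OF m[of a i]] len_le[OF r[of x]] assms(2) unfolding power2_eq_square by linarith+
  qed
  note l = len_val_le2[OF assms]
  have mul: "len (exp_val e1 s) * len (exp_val e2 s) \<le> 9 * esize e1 * esize e2 * K\<^sup>2" for e1 e2
    using mult_mono[OF len_val_le[OF assms, of e1] len_val_le[OF assms, of e2]]
    by (simp add: power2_eq_square algebra_simps)
  show ?thesis
  proof (induction e)
    case (Const z)
    then show ?case using l[of "Const z"] by simp
  next
    case (Load a e)
    then show ?case using l[of e] mm[of a "nat (exp_val e s)"] by (simp add: algebra_simps)
  next
    case (Add e1 e2)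
    then show ?case using l[of e1] l[of e2] by (simp add: algebra_simps)
  next
    case (Sub e1 e2)
    then show ?case using l[of e1] l[of e2] by (simp add: algebra_simps)
  next
    case (Mul e1 e2)
    then show ?case using mul[of e1 e2] by (simp add: algebra_simps)
  next
    case (Div e1 e2)
    then show ?case using mul[of e1 e2] by (simp add: algebra_simps)
  qed (simp add: rr)
qed

text \<open>
  The number of elementary steps of a program whose loops run at most \<open>X\<close> times each, in units of
  \<open>K\<^sup>2\<close>. As both branches of a conditional are counted, it is a polynomial in \<open>X\<close> of degree at most
  the nesting depth of loops.
\<close>

fun time_bound :: "nat \<Rightarrow> com \<Rightarrow> nat" where
  "time_bound X Skip = 1"
| "time_bound X (Assign x e) = eweight e + 3 * esize e"
| "time_bound X (Store a e1 e2) = eweight e1 + eweight e2 + 3 * esize e1 + 3 * esize e2"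
| "time_bound X (Read x) = 3"
| "time_bound X (Write e) = eweight e + 3 * esize e"
| "time_bound X (Seq c1 c2) = time_bound X c1 + time_bound X c2"
| "time_bound X (Cond e c1 c2) = eweight e + time_bound X c1 + time_bound X c2"
| "time_bound X (While e c) = eweight e + X * (eweight e + time_bound X c)"

lemma time_bound_poly: "\<exists>C k. \<forall>X. time_bound X c \<le> C * (X + 1) ^ k"
proof (induction c)
  case (Seq c1 c2)
  then obtain C1 k1 C2 k2 where *: "\<And>X. time_bound X c1 \<le> C1 * (X + 1) ^ k1" "\<And>X. time_bound X c2 \<le> C2 * (X + 1) ^ k2"
    by metis
  have "time_bound X (Seq c1 c2) \<le> (C1 + C2) * (X + 1) ^ (k1 + k2)" for X
  proof -
    have "time_bound X c1 \<le> C1 * (X + 1) ^ (k1 + k2)" "time_bound X c2 \<le> C2 * (X + 1) ^ (k1 + k2)"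
      by (rule order_trans[OF *(1)], simp add: power_increasing)
        (rule order_trans[OF *(2)], simp add: power_increasing)
    then show ?thesis by (simp add: algebra_simps)
  qed
  then show ?case by blast
next
  case (Cond e c1 c2)
  then obtain C1 k1 C2 k2 where *: "\<And>X. time_bound X c1 \<le> C1 * (X + 1) ^ k1" "\<And>X. time_bound X c2 \<le> C2 * (X + 1) ^ k2"
    by metis
  have "time_bound X (Cond e c1 c2) \<le> (eweight e + C1 + C2) * (X + 1) ^ (k1 + k2)" for X
  proof -
    have "time_bound X c1 \<le> C1 * (X + 1) ^ (k1 + k2)" "time_bound X c2 \<le> C2 * (X + 1) ^ (k1 + k2)"
      by (rule order_trans[OF *(1)], simp add: power_increasing)
        (rule order_trans[OF *(2)], simp add: power_increasing)
    moreover have "eweight e * 1 \<le> eweight e * (X + 1) ^ (k1 + k2)" by (intro mult_mono one_le_power) auto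
    ultimately show ?thesis unfolding time_bound.simps distrib_right by linarith
  qed
  then show ?case by blast
next
  case (While e c)
  then obtain C k where *: "\<And>X. time_bound X c \<le> C * (X + 1) ^ k" by metis
  have "time_bound X (While e c) \<le> (2 * eweight e + C) * (X + 1) ^ (k + 1)" for X
  proof -
    have "X * time_bound X c \<le> (X + 1) * (C * (X + 1) ^ k)" using * by (intro mult_mono) auto
    moreover have "eweight e * 1 \<le> eweight e * (X + 1) ^ (k + 1)" by (intro mult_mono one_le_power) auto
    moreover have "X * eweight e \<le> eweight e * (X + 1) ^ (k + 1)"
    proof -
      have "(X + 1) ^ 1 \<le> (X + 1) ^ (k + 1)" by (intro power_increasing) auto
      then have "X * eweight e \<le> (X + 1) ^ (k + 1) * eweight e" by (intro mult_mono) auto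
      then show ?thesis by (simp only: mult.commute)
    qed
    ultimately show ?thesis by (simp add: algebra_simps)
  qed
  then show ?case by blast
next
  case Skip show ?case by (rule exI[of _ 1], rule exI[of _ 0]) simp
next
  case (Assign x e) show ?case by (rule exI[of _ "time_bound 0 (Assign x e)"], rule exI[of _ 0]) simp
next
  case (Store a e1 e2) show ?case by (rule exI[of _ "time_bound 0 (Store a e1 e2)"], rule exI[of _ 0]) simp
next
  case (Read x) show ?case by (rule exI[of _ 3], rule exI[of _ 0]) simp
next
  case (Write e) show ?case by (rule exI[of _ "time_bound 0 (Write e)"], rule exI[of _ 0]) simp
qed

section \<open>Weakest preconditions\<close>

fun wregs :: "com \<Rightarrow> nat set" where
  "wregs (Assign x e) = {x}"
| "wregs (Read x) = {x}"
| "wregs (Seq c1 c2) = wregs c1 \<union> wregs c2"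
| "wregs (Cond e c1 c2) = wregs c1 \<union> wregs c2"
| "wregs (While e c) = wregs c"
| "wregs _ = {}"

fun warrs :: "com \<Rightarrow> nat set" where
  "warrs (Store a e1 e2) = {a}"
| "warrs (Seq c1 c2) = warrs c1 \<union> warrs c2"
| "warrs (Cond e c1 c2) = warrs c1 \<union> warrs c2"
| "warrs (While e c) = warrs c"
| "warrs _ = {}"

fun writes :: "com \<Rightarrow> bool" where
  "writes (Write e) = True"
| "writes (Seq c1 c2) = (writes c1 \<or> writes c2)"
| "writes (Cond e c1 c2) = (writes c1 \<or> writes c2)"
| "writes (While e c) = writes c"
| "writes _ = False"

fun reads :: "com \<Rightarrow> bool" where
  "reads (Read x) = True"
| "reads (Seq c1 c2) = (reads c1 \<or> reads c2)"
| "reads (Cond e c1 c2) = (reads c1 \<or> reads c2)"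
| "reads (While e c) = reads c"
| "reads _ = False"

text \<open>
  What a program cannot change is visible in its text. This lets the specifications below mention
  only what changes.
\<close>

definition frame :: "com \<Rightarrow> ram_state \<Rightarrow> ram_state \<Rightarrow> bool" where
  "frame c s s' \<longleftrightarrow> (\<forall>x. x \<notin> wregs c \<longrightarrow> reg s' x = reg s x) \<and> (\<forall>a. a \<notin> warrs c \<longrightarrow> mem s' a = mem s a)
     \<and> (\<not> reads c \<longrightarrow> inp s' = inp s) \<and> (\<not> writes c \<longrightarrow> outp s' = outp s)"

lemma frame_refl [simp]: "frame c s s"
  by (simp add: frame_def)

lemma frame_trans: "frame c s s' \<Longrightarrow> frame c s' s'' \<Longrightarrow> frame c s s''"
  by (simp add: frame_def)

lemma exec_frame: "exec c s t s' \<Longrightarrow> frame c s s'"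
  by (induction rule: exec.induct) (auto simp: frame_def)

locale run =
  fixes X K :: nat
  assumes K: "K \<ge> 1"
begin

text \<open>
  Total correctness, restricted to runs in which all stored integers keep at most \<open>K\<close> bits. The time
  bound is part of the meaning of \<open>wp\<close>, but it is a fixed function of the program, so it never
  appears in a proof obligation: only the bound on assigned values and the numbers of iterations do.
\<close>

definition wp :: "com \<Rightarrow> (ram_state \<Rightarrow> bool) \<Rightarrow> ram_state \<Rightarrow> bool" where
  "wp c Q s \<longleftrightarrow> (bounded_by K s \<longrightarrow> (\<exists>t s'. exec c s t s' \<and> t \<le> time_bound X c * K\<^sup>2 \<and> bounded_by K s' \<and> Q s'))"

lemma wp_bounded: "(bounded_by K s \<Longrightarrow> wp c Q s) \<Longrightarrow> wp c Q s"
  by (auto simp: wp_def)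

lemma wp_mono: "wp c Q s \<Longrightarrow> (\<And>s'. bounded_by K s' \<Longrightarrow> frame c s s' \<Longrightarrow> Q s' \<Longrightarrow> Q' s') \<Longrightarrow> wp c Q' s"
  unfolding wp_def using exec_frame by blast

lemma wp_Skip: "Q s \<Longrightarrow> wp Skip Q s"
proof -
  assume "Q s"
  moreover have "1 \<le> K\<^sup>2" using K by (simp add: Suc_le_eq)
  ultimately show "wp Skip Q s"
    unfolding wp_def by (auto intro!: exI[of _ "1::nat"] exI[of _ s] exec.Skip)
qed

lemma bounded_by_reg: "bounded_by K s \<Longrightarrow> \<bar>v\<bar> \<le> 2 ^ K \<Longrightarrow> bounded_by K (s\<lparr>reg := (reg s)(x := v)\<rparr>)"
  by (simp add: bounded_by_def)

lemma bounded_by_mem: "bounded_by K s \<Longrightarrow> \<bar>v\<bar> \<le> 2 ^ K \<Longrightarrow> bounded_by K (s\<lparr>mem := (mem s)(a := (mem s a)(i := v))\<rparr>)"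
  by (auto simp: bounded_by_def)

lemma wp_Assign:
  assumes "\<lbrakk>bounded_by K s\<rbrakk> \<Longrightarrow> \<bar>exp_val e s\<bar> \<le> 2 ^ K"
    and "Q (s\<lparr>reg := (reg s)(x := exp_val e s)\<rparr>)"
  shows "wp (Assign x e) Q s"
  unfolding wp_def
proof
  assume b: "bounded_by K s"
  show "\<exists>t s'. exec (Assign x e) s t s' \<and> t \<le> time_bound X (Assign x e) * K\<^sup>2 \<and> bounded_by K s' \<and> Q s'"
    using exp_cost_le[OF b K, of e] len_val_le2[OF b K, of e] assms b
    by (intro exI conjI) (rule exec.Assign, simp_all add: algebra_simps bounded_by_reg)
qed

lemma wp_Store:
  assumes "\<lbrakk>bounded_by K s\<rbrakk> \<Longrightarrow> \<bar>exp_val e2 s\<bar> \<le> 2 ^ K"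
    and "Q (s\<lparr>mem := (mem s)(a := (mem s a)(nat (exp_val e1 s) := exp_val e2 s))\<rparr>)"
  shows "wp (Store a e1 e2) Q s"
  unfolding wp_def
proof
  assume b: "bounded_by K s"
  show "\<exists>t s'. exec (Store a e1 e2) s t s' \<and> t \<le> time_bound X (Store a e1 e2) * K\<^sup>2 \<and> bounded_by K s' \<and> Q s'"
    using exp_cost_le[OF b K, of e1] len_val_le2[OF b K, of e1]
      exp_cost_le[OF b K, of e2] len_val_le2[OF b K, of e2] assms b
    by (intro exI conjI) (rule exec.Store, simp_all add: algebra_simps bounded_by_mem)
qed

lemma wp_Write:
  assumes "Q (s\<lparr>outp := outp s @ [exp_val e s]\<rparr>)"
  shows "wp (Write e) Q s"
  unfolding wp_def
proof
  assume b: "bounded_by K s"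
  show "\<exists>t s'. exec (Write e) s t s' \<and> t \<le> time_bound X (Write e) * K\<^sup>2 \<and> bounded_by K s' \<and> Q s'"
    using exp_cost_le[OF b K, of e] len_val_le2[OF b K, of e] assms b
    by (intro exI conjI) (rule exec.Write, simp_all add: algebra_simps bounded_by_def)
qed

lemma wp_Read:
  assumes i: "inp s = z # zs" and Q: "Q (s\<lparr>reg := (reg s)(x := z), inp := zs\<rparr>)"
  shows "wp (Read x) Q s"
  unfolding wp_def
proof
  assume b: "bounded_by K s"
  then have "\<bar>z\<bar> \<le> 2 ^ K" using i by (auto simp: bounded_by_def)
  from len_le[OF this] have "len z \<le> 3 * K" using K by simp
  also have "\<dots> \<le> 3 * K\<^sup>2" using K by (simp add: power2_eq_square)
  finally show "\<exists>t s'. exec (Read x) s t s' \<and> t \<le> time_bound X (Read x) * K\<^sup>2 \<and> bounded_by K s' \<and> Q s'"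
    using assms b
    by (intro exI conjI) (rule exec.ReadCons, simp_all add: algebra_simps bounded_by_def)
qed

lemma wp_Seq: "wp c1 (wp c2 Q) s \<Longrightarrow> wp (Seq c1 c2) Q s"
proof -
  assume w: "wp c1 (wp c2 Q) s"
  show "wp (Seq c1 c2) Q s"
    unfolding wp_def
  proof
    assume "bounded_by K s"
    with w obtain t1 s1 where 1: "exec c1 s t1 s1" "t1 \<le> time_bound X c1 * K\<^sup>2" "bounded_by K s1" "wp c2 Q s1"
      by (auto simp: wp_def)
    then obtain t2 s2 where 2: "exec c2 s1 t2 s2" "t2 \<le> time_bound X c2 * K\<^sup>2" "bounded_by K s2" "Q s2"
      by (auto simp: wp_def)
    show "\<exists>t s'. exec (Seq c1 c2) s t s' \<and> t \<le> time_bound X (Seq c1 c2) * K\<^sup>2 \<and> bounded_by K s' \<and> Q s'"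
      using 1 2 by (intro exI[of _ "t1 + t2"] exI[of _ s2] conjI) (auto intro: exec.Seq simp: algebra_simps)
  qed
qed

lemma wp_Cond:
  assumes "exp_val e s > 0 \<Longrightarrow> wp c1 Q s" "exp_val e s \<le> 0 \<Longrightarrow> wp c2 Q s"
  shows "wp (Cond e c1 c2) Q s"
  unfolding wp_def
proof
  assume b: "bounded_by K s"
  show "\<exists>t s'. exec (Cond e c1 c2) s t s' \<and> t \<le> time_bound X (Cond e c1 c2) * K\<^sup>2 \<and> bounded_by K s' \<and> Q s'"
  proof (cases "exp_val e s > 0")
    case True
    with assms b obtain t s' where "exec c1 s t s'" "t \<le> time_bound X c1 * K\<^sup>2" "bounded_by K s'" "Q s'"
      by (auto simp: wp_def)
    then show ?thesis using exp_cost_le[OF b K, of e] True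
      by (intro exI[of _ "exp_cost e s + t"] exI[of _ s'] conjI)
        (rule exec.CondTrue, auto simp: algebra_simps)
  next
    case False
    with assms b obtain t s' where "exec c2 s t s'" "t \<le> time_bound X c2 * K\<^sup>2" "bounded_by K s'" "Q s'"
      by (auto simp: wp_def)
    then show ?thesis using exp_cost_le[OF b K, of e] False
      by (intro exI[of _ "exp_cost e s + t"] exI[of _ s'] conjI)
        (rule exec.CondFalse, auto simp: algebra_simps)
  qed
qed

text \<open>The index \<open>i\<close> of the invariant is a budget for the remaining iterations: each iteration must
  be paid for, and the initial budget is at most \<open>X\<close>.\<close>

lemma wp_While:
  assumes "i \<le> X" "J i s"
    and step: "\<And>i s'. frame c s s' \<Longrightarrow> J i s' \<Longrightarrow> exp_val e s' > 0 \<Longrightarrow> \<exists>i'. i = Suc i' \<and> wp c (J i') s'"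
    and post: "\<And>i s'. frame c s s' \<Longrightarrow> J i s' \<Longrightarrow> exp_val e s' \<le> 0 \<Longrightarrow> Q s'"
  shows "wp (While e c) Q s"
proof -
  have main: "\<exists>t s'. exec (While e c) s1 t s' \<and> t \<le> (eweight e + i * (eweight e + time_bound X c)) * K\<^sup>2 \<and> bounded_by K s' \<and> Q s'"
    if "J i s1" "bounded_by K s1" "frame c s s1" for i s1
    using that
  proof (induction i arbitrary: s1 rule: less_induct)
    case (less i)
    note b = exp_cost_le[OF less.prems(2) K, of e]
    show ?case
    proof (cases "exp_val e s1 > 0")
      case False
      then show ?thesis using post[OF less.prems(3,1)] b less.prems
        by (intro exI[of _ "exp_cost e s1"] exI[of _ s1] conjI)
          (auto intro: exec.WhileFalse simp: algebra_simps)
    next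
      case True
      from step[OF less.prems(3,1) this] obtain i' where i: "i = Suc i'" and w: "wp c (J i') s1" by blast
      from w less.prems(2) obtain t s' where 1: "exec c s1 t s'" "t \<le> time_bound X c * K\<^sup>2" "bounded_by K s'" "J i' s'"
        by (auto simp: wp_def)
      have "frame c s s'" using frame_trans[OF less.prems(3) exec_frame[OF 1(1)]] .
      from less.IH[OF _ 1(4,3) this] i obtain t2 s2 where 2: "exec (While e c) s' t2 s2"
          "t2 \<le> (eweight e + i' * (eweight e + time_bound X c)) * K\<^sup>2" "bounded_by K s2" "Q s2" by auto
      then show ?thesis using b 1 True i
        by (intro exI[of _ "exp_cost e s1 + t + t2"] exI[of _ s2] conjI)
          (rule exec.WhileTrue, auto simp: algebra_simps)
    qed
  qed
  show ?thesis unfolding wp_def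
  proof
    assume b: "bounded_by K s"
    from main[OF assms(2) b] obtain t s' where *: "exec (While e c) s t s'"
      "t \<le> (eweight e + i * (eweight e + time_bound X c)) * K\<^sup>2" "bounded_by K s'" "Q s'" by auto
    note *(2)
    also have "(eweight e + i * (eweight e + time_bound X c)) * K\<^sup>2 \<le> time_bound X (While e c) * K\<^sup>2"
      using assms(1) by (simp add: mult_le_mono)
    finally show "\<exists>t s'. exec (While e c) s t s' \<and> t \<le> time_bound X (While e c) * K\<^sup>2 \<and> bounded_by K s' \<and> Q s'"
      using * by blast
  qed
qed

end

definition For :: "nat \<Rightarrow> nat \<Rightarrow> com \<Rightarrow> com" where
  "For x y c = Seq (Assign x (Const 0))
     (While (Sub (Reg y) (Reg x)) (Seq c (Assign x (Add (Reg x) (Const 1)))))"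

lemma For_simps [simp]:
  "wregs (For x y c) = insert x (wregs c)" "warrs (For x y c) = warrs c"
  "reads (For x y c) = reads c" "writes (For x y c) = writes c"
  by (auto simp: For_def)

context run begin

text \<open>
  The counter fits into \<open>K\<close> bits because it never exceeds the register \<open>y\<close>, which does. The body may rely on everything that neither it nor the counter overwrites, and
  the invariant at \<open>Suc i\<close> is required after the increment of the counter.
\<close>

lemma wp_For:
  assumes cnt: "reg s y = int cnt" "cnt \<le> X" and xy: "x \<noteq> y" "x \<notin> wregs c" "y \<notin> wregs c"
    and init: "J 0 (s\<lparr>reg := (reg s)(x := 0)\<rparr>)"
    and step: "\<And>i s'. i < cnt \<Longrightarrow> frame (For x y c) s s' \<Longrightarrow> reg s' x = int i \<Longrightarrow> J i s' \<Longrightarrow>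
       wp c (\<lambda>s''. J (Suc i) (s''\<lparr>reg := (reg s'')(x := int (Suc i))\<rparr>)) s'"
    and post: "\<And>s'. frame (For x y c) s s' \<Longrightarrow> reg s' x = int cnt \<Longrightarrow> J cnt s' \<Longrightarrow> Q s'"
  shows "wp (For x y c) Q s"
proof -
  let ?s = "s\<lparr>reg := (reg s)(x := exp_val (Const 0) s)\<rparr>"
  let ?c = "Seq c (Assign x (Add (Reg x) (Const 1)))"
  have fr: "frame (For x y c) s s'" if "frame ?c ?s s'" for s'
    using that by (auto simp: frame_def)
  show ?thesis
    unfolding For_def
  proof (intro wp_Seq wp_Assign, goal_cases)
    case 2
    show ?case
    proof (rule wp_While[where i = cnt and J = "\<lambda>i s'. i \<le> cnt \<and> reg s' x = int (cnt - i) \<and> J (cnt - i) s'"], goal_cases)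
      case (3 i s')
      have y: "reg s' y = int cnt" using fr[OF 3(1)] xy cnt by (auto simp: frame_def)
      from 3 y obtain i' where i: "i = Suc i'" "i \<le> cnt" by (cases i) auto
      have lt: "cnt - i < cnt" and sc: "Suc (cnt - i) = cnt - i'" using i by auto
      have w: "wp c (\<lambda>s''. J (cnt - i') (s''\<lparr>reg := (reg s'')(x := int (cnt - i'))\<rparr>)) s'"
        using step[OF lt fr[OF 3(1)]] 3(2) sc by simp
      have "wp ?c (\<lambda>s''. i' \<le> cnt \<and> reg s'' x = int (cnt - i') \<and> J (cnt - i') s'') s'"
      proof (rule wp_Seq, rule wp_mono[OF w], goal_cases)
        case (1 s'')
        have x: "reg s'' x = int (cnt - i)" using 1(2) xy(2) 3(2) by (simp add: frame_def)
        have y: "reg s'' y = int cnt" using 1(2) xy(3) y by (simp add: frame_def)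
        have e: "exp_val (Add (Reg x) (Const 1)) s'' = int (cnt - i')" using x i by simp
        have "int cnt \<le> 2 ^ K" using 1(1) y by (auto simp: bounded_by_def dest: spec[of _ y])
        then have "\<bar>int (cnt - i')\<bar> \<le> 2 ^ K" by linarith
        then show ?case using 1(3) i by (intro wp_Assign) (simp_all only: e, simp)
      qed
      then show ?case using i by blast
    next
      case (4 i s')
      have y: "reg s' y = int cnt" using fr[OF 4(1)] xy cnt by (auto simp: frame_def)
      with 4 have "i = 0" by simp
      with 4 post[OF fr[OF 4(1)]] show ?case by simp
    qed (use cnt init in auto)
  qed simp
qed

end

section \<open>Fraction-free elimination\<close>

text \<open>
  A crude estimate from the Leibniz formula; its logarithm is polynomial in \<open>r\<close> and \<open>log E\<close>.
\<close>

lemma abs_det_le: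
  fixes A :: "int mat"
  assumes A: "A \<in> carrier_mat r r" and le: "\<And>i j. i < r \<Longrightarrow> j < r \<Longrightarrow> \<bar>A $$ (i, j)\<bar> \<le> E"
  shows "\<bar>det A\<bar> \<le> fact r * E ^ r"
proof -
  have "\<bar>det A\<bar> \<le> (\<Sum>p | p permutes {0..<r}. \<bar>signof p * (\<Prod>i = 0..<r. A $$ (i, p i))\<bar>)"
    unfolding det_def'[OF A] by (rule sum_abs)
  also have "\<dots> \<le> (\<Sum>p | p permutes {0..<r}. E ^ r)"
  proof (rule sum_mono)
    fix p assume p: "p \<in> {p. p permutes {0..<r}}"
    have "\<bar>signof p * (\<Prod>i = 0..<r. A $$ (i, p i))\<bar> = (\<Prod>i = 0..<r. \<bar>A $$ (i, p i)\<bar>)"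
      by (simp add: abs_mult abs_prod sign_def)
    also have "\<dots> \<le> (\<Prod>i = 0..<r. E)"
      using p by (intro prod_mono) (auto intro!: le simp: permutes_in_image dest: permutes_in_image)
    finally show "\<bar>signof p * (\<Prod>i = 0..<r. A $$ (i, p i))\<bar> \<le> E ^ r" by simp
  qed
  also have "\<dots> = fact r * E ^ r" by (simp add: card_permutations)
  finally show ?thesis .
qed

lemma fact_power_mono:
  assumes "(E :: int) \<ge> 1" "q \<le> r"
  shows "fact q * E ^ q \<le> fact r * E ^ r"
  using assms by (intro mult_mono fact_mono power_increasing) auto

lemma abs_cofactor_le:
  fixes A :: "int mat"
  assumes A: "A \<in> carrier_mat r r" and le: "\<And>i j. i < r \<Longrightarrow> j < r \<Longrightarrow> \<bar>A $$ (i, j)\<bar> \<le> E"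
    and E: "E \<ge> 1" and ij: "i < r" "j < r"
  shows "\<bar>cofactor A i j\<bar> \<le> fact r * E ^ r"
proof -
  have "\<bar>cofactor A i j\<bar> = \<bar>det (mat_delete A i j)\<bar>"
    by (simp add: cofactor_def abs_mult power_abs)
  also have "\<dots> \<le> fact (r - 1) * E ^ (r - 1)"
    using A by (intro abs_det_le mat_delete_carrier) (auto simp: mat_delete_def intro!: le)
  also have "\<dots> \<le> fact r * E ^ r" by (rule fact_power_mono) (use E in auto)
  finally show ?thesis .
qed

definition minor_mat :: "(nat \<Rightarrow> nat \<Rightarrow> int) \<Rightarrow> nat list \<Rightarrow> nat list \<Rightarrow> int mat" where
  "minor_mat B I J = mat (length J) (length J) (\<lambda>(a, b). B (I ! a) (J ! b))"

lemma minor_mat_carrier [simp]: "minor_mat B I J \<in> carrier_mat (length J) (length J)"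
  by (simp add: minor_mat_def)

definition col_span :: "(nat \<Rightarrow> nat \<Rightarrow> int) \<Rightarrow> nat \<Rightarrow> nat list \<Rightarrow> (nat \<Rightarrow> int) \<Rightarrow> bool" where
  "col_span B N J y \<longleftrightarrow> (\<exists>z. \<forall>j<N. y j = (\<Sum>b<length J. B j (J ! b) * z b))"

lemma col_span_add: "col_span B N J y \<Longrightarrow> col_span B N J y' \<Longrightarrow> col_span B N J (\<lambda>j. y j + y' j)"
  unfolding col_span_def
proof (elim exE)
  fix z z' assume "\<forall>j<N. y j = (\<Sum>b<length J. B j (J ! b) * z b)" "\<forall>j<N. y' j = (\<Sum>b<length J. B j (J ! b) * z' b)"
  then show "\<exists>z. \<forall>j<N. y j + y' j = (\<Sum>b<length J. B j (J ! b) * z b)"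
    by (intro exI[of _ "\<lambda>b. z b + z' b"]) (simp add: distrib_left sum.distrib)
qed

lemma col_span_scale: "col_span B N J y \<Longrightarrow> col_span B N J (\<lambda>j. c * y j)"
  unfolding col_span_def
proof (elim exE)
  fix z assume "\<forall>j<N. y j = (\<Sum>b<length J. B j (J ! b) * z b)"
  then show "\<exists>z. \<forall>j<N. c * y j = (\<Sum>b<length J. B j (J ! b) * z b)"
    by (intro exI[of _ "\<lambda>b. c * z b"]) (simp add: sum_distrib_left mult.left_commute)
qed

lemma col_span_zero: "col_span B N J (\<lambda>j. 0)"
  unfolding col_span_def by (rule exI[of _ "\<lambda>_. 0"]) simp

lemma col_span_sum:
  "(\<And>i. i \<in> S \<Longrightarrow> col_span B N J (y i)) \<Longrightarrow> col_span B N J (\<lambda>j. \<Sum>i\<in>S. y i j)"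
  by (induction S rule: infinite_finite_induct) (auto simp: col_span_zero intro!: col_span_add)

lemma col_span_cong: "col_span B N J y \<Longrightarrow> (\<And>j. j < N \<Longrightarrow> y' j = y j) \<Longrightarrow> col_span B N J y'"
  unfolding col_span_def by simp

lemma col_span_col:
  assumes "k \<in> set J"
  shows "col_span B N J (\<lambda>j. B j k)"
proof -
  from assms obtain b where b: "b < length J" "J ! b = k" by (auto simp: in_set_conv_nth)
  then show ?thesis
    unfolding col_span_def
    by (intro exI[of _ "\<lambda>b'. if b' = b then 1 else 0"]) (simp add: if_distrib[of "\<lambda>x. _ * x"] sum.delta cong: if_cong)
qed

lemma col_span_append: "col_span B N J y \<Longrightarrow> col_span B N (J @ [k]) y"
  unfolding col_span_def
proof (elim exE)
  fix z assume "\<forall>j<N. y j = (\<Sum>b<length J. B j (J ! b) * z b)"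
  then show "\<exists>z. \<forall>j<N. y j = (\<Sum>b<length (J @ [k]). B j ((J @ [k]) ! b) * z b)"
    by (intro exI[of _ "\<lambda>b. if b < length J then z b else 0"]) (simp add: nth_append)
qed

text \<open>
  The adjugate is an integer matrix that inverts the submatrix up to the factor \<open>det\<close> and has small
  entries. It will express the eliminated matrix explicitly.
\<close>

lemma minor_adjugate:
  assumes J: "length I = length J"
  shows "\<exists>Y. (\<forall>a<length J. \<forall>c<length J.
       (\<Sum>b<length J. B (I ! a) (J ! b) * Y b c) = (if a = c then det (minor_mat B I J) else 0))
     \<and> (\<forall>a<length J. \<forall>c<length J.
       (\<Sum>b<length J. Y a b * B (I ! b) (J ! c)) = (if a = c then det (minor_mat B I J) else 0))
     \<and> (\<forall>E\<ge>1. (\<forall>a<length J. \<forall>b<length J. \<bar>B (I ! a) (J ! b)\<bar> \<le> E) \<longrightarrow>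
       (\<forall>b<length J. \<forall>c<length J. \<bar>Y b c\<bar> \<le> fact (length J) * E ^ length J))"
proof -
  let ?r = "length J" and ?M = "minor_mat B I J"
  have ind: "?M $$ (a, b) = B (I ! a) (J ! b)" if "a < ?r" "b < ?r" for a b
    using that by (simp add: minor_mat_def)
  note adj = adj_mat[OF minor_mat_carrier[of B I J]]
  have dims: "dim_row ?M = ?r" "dim_col ?M = ?r" "dim_row (adj_mat ?M) = ?r" "dim_col (adj_mat ?M) = ?r"
    using adj(1) by (auto simp: minor_mat_def)
  show ?thesis
  proof (rule exI[of _ "\<lambda>b c. adj_mat ?M $$ (b, c)"], intro conjI allI impI)
    fix a c assume ac: "a < ?r" "c < ?r"
    have "(?M * adj_mat ?M) $$ (a, c) = (\<Sum>b<?r. B (I ! a) (J ! b) * adj_mat ?M $$ (b, c))"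
      using ac by (simp add: dims scalar_prod_def ind lessThan_atLeast0)
    then show "(\<Sum>b<?r. B (I ! a) (J ! b) * adj_mat ?M $$ (b, c)) = (if a = c then det ?M else 0)"
      using ac unfolding adj(2) by (cases "a = c") simp_all
  next
    fix a c assume ac: "a < ?r" "c < ?r"
    have "(adj_mat ?M * ?M) $$ (a, c) = (\<Sum>b<?r. adj_mat ?M $$ (a, b) * B (I ! b) (J ! c))"
      using ac by (simp add: dims scalar_prod_def ind lessThan_atLeast0)
    then show "(\<Sum>b<?r. adj_mat ?M $$ (a, b) * B (I ! b) (J ! c)) = (if a = c then det ?M else 0)"
      using ac unfolding adj(3) by (cases "a = c") simp_all
  next
    fix E :: int and b c
    assume *: "E \<ge> 1" "\<forall>a<?r. \<forall>b<?r. \<bar>B (I ! a) (J ! b)\<bar> \<le> E" "b < ?r" "c < ?r"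
    have "\<bar>cofactor ?M c b\<bar> \<le> fact ?r * E ^ ?r"
      by (rule abs_cofactor_le[OF minor_mat_carrier]) (use * in \<open>auto simp: ind\<close>)
    then show "\<bar>adj_mat ?M $$ (b, c)\<bar> \<le> fact ?r * E ^ ?r"
      using * by (simp add: adj_mat_def minor_mat_def)
  qed
qed

lemma nth_less: "set I \<subseteq> {..<N} \<Longrightarrow> a < length I \<Longrightarrow> I ! a < N"
  by (meson lessThan_iff nth_mem subsetD)

text \<open>
  A combination of the columns \<open>J\<close> is determined by its entries in the rows \<open>I\<close>, since the square
  submatrix in these rows and columns is invertible over the rationals. The identities between
  the matrices before and after a pivot step follow from this uniqueness.
\<close>

lemma col_span_unique:
  assumes len: "length I = length J" and I: "set I \<subseteq> {..<N}" and det: "det (minor_mat B I J) \<noteq> 0"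
    and y: "col_span B N J y" and van: "\<And>i. i \<in> set I \<Longrightarrow> y i = 0" and j: "j < N"
  shows "y j = 0"
proof -
  from y obtain z where z: "\<forall>j<N. y j = (\<Sum>b<length J. B j (J ! b) * z b)"
    unfolding col_span_def by blast
  from minor_adjugate[OF len, of B] obtain Y where Y: "\<forall>a<length J. \<forall>c<length J.
       (\<Sum>b<length J. Y a b * B (I ! b) (J ! c)) = (if a = c then det (minor_mat B I J) else 0)"
    by blast
  have "z a = 0" if a: "a < length J" for a
  proof -
    have "det (minor_mat B I J) * z a = (\<Sum>c<length J. (if a = c then det (minor_mat B I J) else 0) * z c)"
      using a by (simp add: if_distrib[of "\<lambda>x. x * _"] sum.delta cong: if_cong)
    also have "\<dots> = (\<Sum>c<length J. (\<Sum>b<length J. Y a b * B (I ! b) (J ! c)) * z c)"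
      using a by (intro sum.cong refl) (simp add: Y)
    also have "\<dots> = (\<Sum>b<length J. \<Sum>c<length J. Y a b * (B (I ! b) (J ! c) * z c))"
      by (subst sum.swap) (simp add: sum_distrib_right mult.assoc)
    also have "\<dots> = (\<Sum>b<length J. Y a b * y (I ! b))"
    proof (rule sum.cong[OF refl])
      fix b assume "b \<in> {..<length J}"
      then have "I ! b < N" using nth_less[OF I] len by simp
      then show "(\<Sum>c<length J. Y a b * (B (I ! b) (J ! c) * z c)) = Y a b * y (I ! b)"
        by (simp add: z sum_distrib_left)
    qed
    also have "\<dots> = 0" using van len by simp
    finally show ?thesis using det by simp
  qed
  then show ?thesis using z j by simp
qed

text \<open>
  The matrix reached after pivoting at the positions \<open>(I ! a, J ! a)\<close>. The columns in \<open>J\<close> are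
  combinations of the old columns in \<open>J\<close>, the other ones are \<open>\<delta>\<close> times the old column up to such a
  combination, and the pivot rows are \<open>\<delta>\<close> times unit vectors. These conditions determine \<open>T\<close>.
\<close>

definition reduced ::
    "(nat \<Rightarrow> nat \<Rightarrow> int) \<Rightarrow> nat \<Rightarrow> nat \<Rightarrow> nat list \<Rightarrow> nat list \<Rightarrow> (nat \<Rightarrow> nat \<Rightarrow> int) \<Rightarrow> int \<Rightarrow> bool" where
  "reduced B N d I J T \<delta> \<longleftrightarrow>
     length I = length J \<and> set I \<subseteq> {..<N} \<and> set J \<subseteq> {..<d} \<and> distinct J
     \<and> \<delta> = det (minor_mat B I J) \<and> \<delta> \<noteq> 0
     \<and> (\<forall>k<d. col_span B N J (\<lambda>j. T j k - (if k \<in> set J then 0 else \<delta> * B j k)))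
     \<and> (\<forall>a<length J. \<forall>k<d. T (I ! a) k = (if k = J ! a then \<delta> else 0))"

text \<open>
  The coefficients of the combinations are read off from the adjugate; therefore they are integers,
  and their size is that of a minor.
\<close>

lemma reduced_exists:
  assumes len: "length I = length J" and I: "set I \<subseteq> {..<N}" and J: "set J \<subseteq> {..<d}" "distinct J"
    and det: "det (minor_mat B I J) \<noteq> 0"
    and E: "E \<ge> 1" "\<And>j k. j < N \<Longrightarrow> k < d \<Longrightarrow> \<bar>B j k\<bar> \<le> E"
  shows "\<exists>T. reduced B N d I J T (det (minor_mat B I J))
    \<and> (\<forall>j<N. \<forall>k<d. \<bar>T j k\<bar> \<le> (int (length J * length J) + 1) * E * E * (fact (length J) * E ^ length J))
    \<and> \<bar>det (minor_mat B I J)\<bar> \<le> fact (length J) * E ^ length J"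
proof -
  let ?r = "length J" and ?\<delta> = "det (minor_mat B I J)"
  let ?G = "fact ?r * E ^ ?r"
  from minor_adjugate[OF len, of B] obtain Y where Y: "\<forall>a<?r. \<forall>c<?r.
       (\<Sum>b<?r. B (I ! a) (J ! b) * Y b c) = (if a = c then ?\<delta> else 0)"
    and "\<forall>a<?r. \<forall>c<?r. (\<Sum>b<?r. Y a b * B (I ! b) (J ! c)) = (if a = c then ?\<delta> else 0)"
    and Yb: "\<forall>E\<ge>1. (\<forall>a<?r. \<forall>b<?r. \<bar>B (I ! a) (J ! b)\<bar> \<le> E) \<longrightarrow>
       (\<forall>b<?r. \<forall>c<?r. \<bar>Y b c\<bar> \<le> fact ?r * E ^ ?r)"
    by (elim exE conjE) (rule that)
  have II: "I ! a < N" if "a < ?r" for a using nth_less[OF I] that len by simp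
  have JJ: "J ! a < d" if "a < ?r" for a using nth_less[OF J(1)] that by simp
  have YG: "\<bar>Y b c\<bar> \<le> ?G" if "b < ?r" "c < ?r" for b c
    using that E II JJ Yb[rule_format, of E b c] by simp
  have G: "?G \<ge> 1" using E mult_mono[of 1 "fact ?r" 1 "E ^ ?r"] by (simp add: fact_ge_1)
  have \<delta>G: "\<bar>?\<delta>\<bar> \<le> ?G"
    by (rule abs_det_le[OF minor_mat_carrier]) (simp add: minor_mat_def E II JJ)
  \<comment> \<open>the required values in the pivot rows, up to the factor \<open>\<delta>\<close>\<close>
  define e where "e k c = (if k \<in> set J then (if k = J ! c then 1 else 0) else - B (I ! c) k)" for k c
  define z where "z k b = (\<Sum>c<?r. Y b c * e k c)" for k b
  define T where "T j k = (\<Sum>b<?r. B j (J ! b) * z k b) + (if k \<in> set J then 0 else ?\<delta> * B j k)" for j k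
  have Mz: "(\<Sum>b<?r. B (I ! a) (J ! b) * z k b) = ?\<delta> * e k a" if a: "a < ?r" for a k
  proof -
    have "(\<Sum>b<?r. B (I ! a) (J ! b) * z k b) = (\<Sum>b<?r. \<Sum>c<?r. B (I ! a) (J ! b) * Y b c * e k c)"
      by (simp add: z_def sum_distrib_left mult.assoc)
    also have "\<dots> = (\<Sum>c<?r. (\<Sum>b<?r. B (I ! a) (J ! b) * Y b c) * e k c)"
      by (subst sum.swap) (simp add: sum_distrib_right)
    also have "\<dots> = (\<Sum>c<?r. (if a = c then ?\<delta> else 0) * e k c)"
      using a by (intro sum.cong refl) (simp add: Y)
    also have "\<dots> = ?\<delta> * e k a"
      using a by (simp add: if_distrib[of "\<lambda>x. x * _"] sum.delta cong: if_cong)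
    finally show ?thesis .
  qed
  show ?thesis
  proof (rule exI[of _ T], intro conjI allI impI)
    show "reduced B N d I J T ?\<delta>"
      unfolding reduced_def
    proof (intro conjI allI impI)
      fix k assume "k < d"
      show "col_span B N J (\<lambda>j. T j k - (if k \<in> set J then 0 else ?\<delta> * B j k))"
        unfolding col_span_def by (rule exI[of _ "z k"]) (simp add: T_def)
    next
      fix a k assume a: "a < ?r" and k: "k < d"
      show "T (I ! a) k = (if k = J ! a then ?\<delta> else 0)"
        using a nth_mem[of a J] by (auto simp: T_def Mz e_def)
    qed (use assms in auto)
    show "\<bar>?\<delta>\<bar> \<le> ?G" by fact
    fix j k assume jk: "j < N" "k < d"
    have eE: "\<bar>e k c\<bar> \<le> E" if "c < ?r" for c
      using that jk E II by (auto simp: e_def)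
    have zb: "\<bar>z k b\<bar> \<le> int ?r * (?G * E)" if b: "b < ?r" for b
    proof -
      have "\<bar>z k b\<bar> \<le> (\<Sum>c<?r. \<bar>Y b c * e k c\<bar>)" unfolding z_def by (rule sum_abs)
      also have "\<dots> \<le> (\<Sum>c<?r. ?G * E)"
        using b G E by (intro sum_mono) (auto simp: abs_mult intro!: mult_mono YG eE)
      finally show ?thesis by simp
    qed
    have 1: "\<bar>T j k\<bar> \<le> \<bar>\<Sum>b<?r. B j (J ! b) * z k b\<bar> + \<bar>?\<delta>\<bar> * \<bar>B j k\<bar>"
      by (auto simp: T_def abs_mult intro: order_trans[OF abs_triangle_ineq])
    have "\<bar>\<Sum>b<?r. B j (J ! b) * z k b\<bar> \<le> (\<Sum>b<?r. \<bar>B j (J ! b) * z k b\<bar>)" by (rule sum_abs)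
    also have "\<dots> \<le> (\<Sum>b<?r. E * (int ?r * (?G * E)))"
      using E jk G by (intro sum_mono) (auto simp: abs_mult intro!: mult_mono zb JJ)
    finally have 2: "\<bar>\<Sum>b<?r. B j (J ! b) * z k b\<bar> \<le> int (?r * ?r) * E * E * ?G"
      by (simp add: algebra_simps)
    have 3: "\<bar>?\<delta>\<bar> * \<bar>B j k\<bar> \<le> ?G * E" using \<delta>G E jk G by (intro mult_mono) auto
    have 4: "?G * E * 1 \<le> ?G * E * E" using G E by (intro mult_left_mono) auto
    have "\<bar>T j k\<bar> \<le> int (?r * ?r) * E * E * ?G + ?G * E * E" using 1 2 3 4 by linarith
    also have "\<dots> = (int (?r * ?r) + 1) * E * E * ?G" by (simp add: algebra_simps)
    finally show "\<bar>T j k\<bar> \<le> (int (?r * ?r) + 1) * E * E * ?G" .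
  qed
qed

lemma reduced_lenD: "reduced B N d I J T \<delta> \<Longrightarrow> length J \<le> d"
  unfolding reduced_def using card_mono[of "{..<d}" "set J"] by (simp add: distinct_card)

lemma reduced_unique:
  assumes "reduced B N d I J T \<delta>" "reduced B N d I J T' \<delta>'" "j < N" "k < d"
  shows "T j k = T' j k"
proof -
  have "col_span B N J (\<lambda>j. (T j k - (if k \<in> set J then 0 else \<delta> * B j k)) + (-1) * (T' j k - (if k \<in> set J then 0 else \<delta>' * B j k)))"
    using assms by (intro col_span_add col_span_scale) (auto simp: reduced_def)
  then have s: "col_span B N J (\<lambda>j. T j k - T' j k)"
    by (rule col_span_cong) (use assms in \<open>auto simp: reduced_def\<close>)
  have "T j k - T' j k = 0"
  proof (rule col_span_unique[OF _ _ _ s _ assms(3)])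
    fix i assume "i \<in> set I"
    then obtain a where "a < length J" "i = I ! a"
      using assms(1) unfolding reduced_def by (metis in_set_conv_nth)
    then show "T i k - T' i k = 0" using assms by (auto simp: reduced_def)
  qed (use assms in \<open>auto simp: reduced_def\<close>)
  then show ?thesis by simp
qed

text \<open>
  The matrix is unique, so it shares the bounds of the one constructed from the adjugate, no matter
  by which sequence of operations it was obtained.
\<close>

lemma reduced_bound:
  assumes red: "reduced B N d I J T \<delta>"
    and E: "E \<ge> 1" "\<And>j k. j < N \<Longrightarrow> k < d \<Longrightarrow> \<bar>B j k\<bar> \<le> E"
  defines "b \<equiv> (int (d * d) + 1) * E * E * (fact d * E ^ d)"
  shows "\<bar>\<delta>\<bar> \<le> b" "\<And>j k. j < N \<Longrightarrow> k < d \<Longrightarrow> \<bar>T j k\<bar> \<le> b"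
proof -
  have r: "length J \<le> d" by (rule reduced_lenD[OF red])
  have f: "fact (length J) * E ^ length J \<le> fact d * E ^ d" by (rule fact_power_mono) (use r E in auto)
  have G: "fact q * E ^ q \<ge> 1" for q using E mult_mono[of 1 "fact q" 1 "E ^ q"] by (simp add: fact_ge_1)
  have EE: "E * E \<ge> 1" using E mult_mono[of 1 E 1 E] by simp
  have "\<exists>T. reduced B N d I J T (det (minor_mat B I J))
    \<and> (\<forall>j<N. \<forall>k<d. \<bar>T j k\<bar> \<le> (int (length J * length J) + 1) * E * E * (fact (length J) * E ^ length J))
    \<and> \<bar>det (minor_mat B I J)\<bar> \<le> fact (length J) * E ^ length J"
    by (rule reduced_exists) (use red E in \<open>auto simp: reduced_def\<close>)
  then obtain T' where T': "reduced B N d I J T' (det (minor_mat B I J))"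
    "\<forall>j<N. \<forall>k<d. \<bar>T' j k\<bar> \<le> (int (length J * length J) + 1) * E * E * (fact (length J) * E ^ length J)"
    "\<bar>det (minor_mat B I J)\<bar> \<le> fact (length J) * E ^ length J"
    by blast
  have le: "(int (length J * length J) + 1) * E * E * (fact (length J) * E ^ length J) \<le> b"
  proof -
    have "int (length J * length J) \<le> int (d * d)" using r by (simp only: of_nat_le_iff mult_le_mono)
    then have "(int (length J * length J) + 1) * (E * E) \<le> (int (d * d) + 1) * (E * E)"
      using EE by (intro mult_right_mono) auto
    then have "(int (length J * length J) + 1) * (E * E) * (fact (length J) * E ^ length J)
        \<le> (int (d * d) + 1) * (E * E) * (fact d * E ^ d)"
      by (rule mult_mono[OF _ f]) (use G[of "length J"] EE in auto)
    then show ?thesis by (simp only: b_def mult.assoc)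
  qed
  show "\<bar>T j k\<bar> \<le> b" if "j < N" "k < d" for j k
    using T'(2)[rule_format, OF that] le reduced_unique[OF red T'(1) that] by simp
  have "1 * 1 \<le> (int (d * d) + 1) * (E * E)" using EE by (intro mult_mono) auto
  then have "1 * (fact d * E ^ d) \<le> (int (d * d) + 1) * (E * E) * (fact d * E ^ d)"
    using G[of d] by (intro mult_right_mono) auto
  then have "1 * (fact d * E ^ d) \<le> b" by (simp only: b_def mult.assoc)
  then show "\<bar>\<delta>\<bar> \<le> b" using T'(3) f red by (simp add: reduced_def)
qed

lemma reduced_cong:
  assumes "reduced B N d I J T \<delta>" "\<And>j k. j < N \<Longrightarrow> k < d \<Longrightarrow> T' j k = T j k"
  shows "reduced B N d I J T' \<delta>"
proof -
  have "I ! a < N" if "a < length J" for a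
    using assms(1) that nth_less[of I N a] by (auto simp: reduced_def)
  then show ?thesis
    using assms unfolding reduced_def by (auto intro: col_span_cong)
qed

lemma reduced_init: "reduced B N d [] [] B 1"
  by (simp add: reduced_def minor_mat_def det_dim_zero col_span_zero)

text \<open>Let \<open>M'\<close> be the enlarged square submatrix. In its rows, the column \<open>T\<^sub>k\<close> is \<open>M'\<close> applied to a
  vector with last coordinate \<open>\<delta>\<close>, and it vanishes there except for the pivot. By Cramer's
  rule \<open>\<delta> det M'\<close> is the determinant of \<open>M'\<close> with the last column replaced by this one, which is \<open>T i k * \<delta>\<close> by
  expansion.\<close>

lemma pivot_is_minor:
  assumes red: "reduced B N d I J T \<delta>" and i: "i < N" and k: "k < d" "k \<notin> set J"
  shows "det (minor_mat B (I @ [i]) (J @ [k])) = T i k"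
proof -
  let ?r = "length J" and ?A = "minor_mat B (I @ [i]) (J @ [k])"
  have len: "length I = ?r" and \<delta>: "\<delta> = det (minor_mat B I J)" "\<delta> \<noteq> 0"
    using red by (auto simp: reduced_def)
  have II: "I ! a < N" if "a < ?r" for a
    using red that nth_less[of I N a] by (auto simp: reduced_def)
  from red k have "col_span B N J (\<lambda>j. T j k - \<delta> * B j k)"
    by (auto simp: reduced_def dest!: spec[of _ k])
  then obtain z where z: "\<forall>j<N. T j k - \<delta> * B j k = (\<Sum>b<?r. B j (J ! b) * z b)"
    unfolding col_span_def by blast
  \<comment> \<open>the coefficients of \<open>T\<^sub>k\<close> with respect to the columns \<open>J @ [k]\<close>\<close>
  define x where "x = vec (Suc ?r) (\<lambda>b. if b < ?r then z b else \<delta>)"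
  have A: "?A \<in> carrier_mat (Suc ?r) (Suc ?r)" using minor_mat_carrier[of B "I @ [i]" "J @ [k]"] by simp
  have T0: "T (I ! a) k = 0" if "a < ?r" for a
    using red that k nth_mem[of a J] by (auto simp: reduced_def)
  have Ax: "(?A *\<^sub>v x) $ a = (if a < ?r then 0 else T i k)" if a: "a < Suc ?r" for a
  proof -
    let ?i = "(I @ [i]) ! a"
    have iN: "?i < N" using a i II len by (auto simp: nth_append)
    have "(?A *\<^sub>v x) $ a = (\<Sum>b<Suc ?r. ?A $$ (a, b) * x $ b)"
      using a A by (auto simp: scalar_prod_def lessThan_atLeast0 x_def intro!: sum.cong)
    also have "\<dots> = (\<Sum>b<?r. B ?i (J ! b) * z b) + B ?i k * \<delta>"
      using a by (simp add: minor_mat_def x_def nth_append)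
    also have "\<dots> = T ?i k" unfolding z[rule_format, OF iN, symmetric] by (simp add: mult.commute)
    also have "\<dots> = (if a < ?r then 0 else T i k)" using a len T0 by (auto simp: nth_append)
    finally show ?thesis .
  qed
  let ?A' = "replace_col ?A (?A *\<^sub>v x) ?r"
  have A': "?A' \<in> carrier_mat (Suc ?r) (Suc ?r)" using A by (auto simp: replace_col_def)
  have "det ?A' = x $ ?r * det ?A"
    by (rule cramer_lemma_mat[OF A]) (auto simp: x_def)
  then have 1: "det ?A' = \<delta> * det ?A" by (simp add: x_def)
  have "det ?A' = (\<Sum>a<Suc ?r. ?A' $$ (a, ?r) * cofactor ?A' a ?r)"
    by (rule laplace_expansion_column[OF A']) simp
  also have "\<dots> = T i k * cofactor ?A' ?r ?r"
    using A by (simp add: replace_col_def Ax del: index_mult_mat_vec)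
  also have "mat_delete ?A' ?r ?r = minor_mat B I J"
    by (rule eq_matI) (use A len in \<open>auto simp: mat_delete_def replace_col_def minor_mat_def nth_append\<close>)
  then have "cofactor ?A' ?r ?r = \<delta>" by (simp add: cofactor_def \<delta>)
  finally show ?thesis using 1 \<delta> by simp
qed

text \<open>
  The division by the previous pivot is exact: the reduced matrix \<open>U\<close> for the enlarged pivot set
  exists over the integers, and \<open>\<delta> U\<close> agrees with the numerators because both are combinations of
  the same columns and take the same values in the pivot rows.
\<close>

lemma reduced_step:
  assumes red: "reduced B N d I J T \<delta>" and i: "i < N" and k: "k < d" "k \<notin> set J" and t: "T i k \<noteq> 0"
  shows "reduced B N d (I @ [i]) (J @ [k])
    (\<lambda>j l. if l = k then T j k else (T i k * T j l - T i l * T j k) div \<delta>) (T i k)"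
proof -
  let ?I = "I @ [i]" and ?J = "J @ [k]" and ?t = "T i k"
  note det = pivot_is_minor[OF red i k]
  have len: "length I = length J" and \<delta>: "\<delta> \<noteq> 0" and I: "set I \<subseteq> {..<N}" and J: "set J \<subseteq> {..<d}" "distinct J"
    using red by (auto simp: reduced_def)
  \<comment> \<open>Any bound will do here: only the existence of \<open>U\<close> is used.\<close>
  define E where "E = Max ({1} \<union> (\<lambda>(j, k). \<bar>B j k\<bar>) ` ({..<N} \<times> {..<d}))"
  have E: "E \<ge> 1" "\<And>j k. j < N \<Longrightarrow> k < d \<Longrightarrow> \<bar>B j k\<bar> \<le> E"
    unfolding E_def by (rule Max_ge; force)+
  have "\<exists>U. reduced B N d ?I ?J U (det (minor_mat B ?I ?J)) \<and> (\<forall>j<N. \<forall>k<d.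
      \<bar>U j k\<bar> \<le> (int (length ?J * length ?J) + 1) * E * E * (fact (length ?J) * E ^ length ?J))
      \<and> \<bar>det (minor_mat B ?I ?J)\<bar> \<le> fact (length ?J) * E ^ length ?J"
    by (rule reduced_exists[OF _ _ _ _ _ E]) (use len I J i k t det in \<open>auto simp: set_eq_iff\<close>)
  then obtain U where U: "reduced B N d ?I ?J U ?t" using det by auto
  have T_piv: "T (I ! a) l = (if l = J ! a then \<delta> else 0)" if "a < length J" "l < d" for a l
    using red that by (auto simp: reduced_def)
  have U_piv: "U (?I ! a) l = (if l = ?J ! a then ?t else 0)" if "a < Suc (length J)" "l < d" for a l
    using U that by (auto simp: reduced_def)
  have U_old: "U (I ! a) l = (if l = J ! a then ?t else 0)" if "a < length J" "l < d" for a l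
    using U_piv[of a l] that len by (simp add: nth_append)
  have U_i: "U i l = (if l = k then ?t else 0)" if "l < d" for l
    using U_piv[of "length J" l] that len by (simp add: nth_append)
  have k_ne: "J ! a \<noteq> k" if "a < length J" for a using that k nth_mem[of a J] by auto
  have spT: "col_span B N ?J (\<lambda>j. T j l - (if l \<in> set J then 0 else \<delta> * B j l))" if "l < d" for l
    using red that by (intro col_span_append) (auto simp: reduced_def)
  have spU: "col_span B N ?J (\<lambda>j. U j l - (if l \<in> set ?J then 0 else ?t * B j l))" if "l < d" for l
    using U that by (auto simp: reduced_def)
  have spTk: "col_span B N ?J (\<lambda>j. T j k)"
  proof -
    have "col_span B N ?J (\<lambda>j. (T j k - (if k \<in> set J then 0 else \<delta> * B j k)) + \<delta> * B j k)"
      by (intro col_span_add col_span_scale col_span_col spT k) simp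
    then show ?thesis using k by simp
  qed
  have main: "\<delta> * U j l = ?t * T j l - T i l * T j k" if l: "l < d" "l \<noteq> k" and j: "j < N" for j l
  proof -
    have "col_span B N ?J (\<lambda>j. \<delta> * (U j l - (if l \<in> set ?J then 0 else ?t * B j l))
        + ((- ?t) * (T j l - (if l \<in> set J then 0 else \<delta> * B j l)) + T i l * T j k))"
      by (intro col_span_add col_span_scale spU spT spTk l)
    then have s: "col_span B N ?J (\<lambda>j. \<delta> * U j l - ?t * T j l + T i l * T j k)"
      by (rule col_span_cong) (use l in \<open>auto simp: algebra_simps\<close>)
    have "\<delta> * U j l - ?t * T j l + T i l * T j k = 0"
    proof (rule col_span_unique[OF _ _ _ s _ j])
      fix q assume "q \<in> set ?I"
      then consider a where "a < length J" "q = I ! a" | "q = i" using len by (auto simp: in_set_conv_nth)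
      then show "\<delta> * U q l - ?t * T q l + T i l * T q k = 0"
      proof cases
        case 1
        have "k \<noteq> J ! a" using k_ne[OF 1(1)] by simp
        with 1 l k show ?thesis by (simp add: T_piv U_old)
      qed (use l in \<open>simp add: U_i\<close>)
    qed (use len I i det t in auto)
    then show ?thesis by simp
  qed
  have maink: "U j k = T j k" if j: "j < N" for j
  proof -
    have "col_span B N ?J (\<lambda>j. (U j k - (if k \<in> set ?J then 0 else ?t * B j k)) + (-1) * T j k)"
      by (intro col_span_add col_span_scale spU spTk k)
    then have s: "col_span B N ?J (\<lambda>j. U j k - T j k)" by simp
    have "U j k - T j k = 0"
    proof (rule col_span_unique[OF _ _ _ s _ j])
      fix q assume "q \<in> set ?I"
      then consider a where "a < length J" "q = I ! a" | "q = i" using len by (auto simp: in_set_conv_nth)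
      then show "U q k - T q k = 0"
      proof cases
        case 1
        have "k \<noteq> J ! a" using k_ne[OF 1(1)] by simp
        with 1 k show ?thesis by (simp add: T_piv U_old)
      qed (use k in \<open>simp add: U_i\<close>)
    qed (use len I i det t in auto)
    then show ?thesis by simp
  qed
  show ?thesis
  proof (rule reduced_cong[OF U], goal_cases)
    case (1 j l)
    show ?case
    proof (cases "l = k")
      case False
      with main[of l j] 1 have "(?t * T j l - T i l * T j k) div \<delta> = U j l"
        using \<delta> by (metis nonzero_mult_div_cancel_left)
      then show ?thesis using False by simp
    qed (use 1 maink in simp)
  qed
qed

text \<open>
  The columns of \<open>T\<close> are combinations of those of \<open>B\<close>. Conversely, once no further pivot can be
  found, \<open>\<delta>\<close> times each column of \<open>B\<close> is a combination of columns of \<open>T\<close>, with the entries of \<open>B\<close> in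
  the pivot rows as coefficients.
\<close>

lemma reduced_kernel:
  assumes red: "reduced B N d I J T \<delta>" and zero: "\<And>k j. k < d \<Longrightarrow> k \<notin> set J \<Longrightarrow> j < N \<Longrightarrow> T j k = 0"
  shows "(\<forall>k<d. (\<Sum>j<N. x j * B j k) = 0) \<longleftrightarrow> (\<forall>k<d. (\<Sum>j<N. x j * T j k) = 0)"
proof
  assume B: "\<forall>k<d. (\<Sum>j<N. x j * B j k) = 0"
  show "\<forall>k<d. (\<Sum>j<N. x j * T j k) = 0"
  proof (intro allI impI)
    fix k assume k: "k < d"
    show "(\<Sum>j<N. x j * T j k) = 0"
    proof (cases "k \<in> set J")
      case True
      with red k have "col_span B N J (\<lambda>j. T j k)" by (auto simp: reduced_def dest!: spec[of _ k])
      then obtain z where z: "\<forall>j<N. T j k = (\<Sum>b<length J. B j (J ! b) * z b)"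
        unfolding col_span_def by blast
      have "(\<Sum>j<N. x j * T j k) = (\<Sum>j<N. \<Sum>b<length J. x j * B j (J ! b) * z b)"
        by (simp add: z sum_distrib_left mult.assoc)
      also have "\<dots> = (\<Sum>b<length J. (\<Sum>j<N. x j * B j (J ! b)) * z b)"
        by (subst sum.swap) (simp add: sum_distrib_right)
      also have "\<dots> = 0"
      proof (rule sum.neutral, rule ballI)
        fix b assume "b \<in> {..<length J}"
        then have "J ! b < d" using red nth_less[of J d b] by (auto simp: reduced_def)
        then show "(\<Sum>j<N. x j * B j (J ! b)) * z b = 0" using B by simp
      qed
      finally show ?thesis .
    qed (use zero k in simp)
  qed
next
  assume T: "\<forall>k<d. (\<Sum>j<N. x j * T j k) = 0"
  have len: "length I = length J" and \<delta>: "\<delta> \<noteq> 0" and I: "set I \<subseteq> {..<N}" and J: "set J \<subseteq> {..<d}" "distinct J"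
    using red by (auto simp: reduced_def)
  have JJ: "J ! a < d" if "a < length J" for a using nth_less[OF J(1)] that by simp
  have T_piv: "T (I ! a) l = (if l = J ! a then \<delta> else 0)" if "a < length J" "l < d" for a l
    using red that by (auto simp: reduced_def)
  show "\<forall>k<d. (\<Sum>j<N. x j * B j k) = 0"
  proof (intro allI impI)
    fix k assume k: "k < d"
    have spT: "col_span B N J (\<lambda>j. T j (J ! c))" if "c < length J" for c
      using red JJ[OF that] nth_mem[OF that] unfolding reduced_def by (auto dest!: spec[of _ "J ! c"])
    have spB: "col_span B N J (\<lambda>j. \<delta> * B j k)"
    proof (cases "k \<in> set J")
      case False
      with red k have "col_span B N J (\<lambda>j. (-1) * (T j k - \<delta> * B j k))"
        by (intro col_span_scale) (auto simp: reduced_def dest!: spec[of _ k])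
      then show ?thesis by (rule col_span_cong) (use zero k False in auto)
    qed (intro col_span_scale col_span_col)
    have s: "col_span B N J (\<lambda>j. \<delta> * B j k + (\<Sum>c<length J. - B (I ! c) k * T j (J ! c)))"
      by (intro col_span_add col_span_sum col_span_scale spB spT) simp
    have eq: "\<delta> * B j k = (\<Sum>c<length J. B (I ! c) k * T j (J ! c))" if j: "j < N" for j
    proof -
      have "\<delta> * B j k + (\<Sum>c<length J. - B (I ! c) k * T j (J ! c)) = 0"
      proof (rule col_span_unique[OF _ _ _ s _ j])
        fix q assume "q \<in> set I"
        then obtain a where a: "a < length J" "q = I ! a" using len by (auto simp: in_set_conv_nth)
        have "(\<Sum>c<length J. - B (I ! c) k * T q (J ! c)) = (\<Sum>c<length J. if c = a then - B q k * \<delta> else 0)"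
          using a J by (intro sum.cong) (auto simp: T_piv JJ nth_eq_iff_index_eq)
        then show "\<delta> * B q k + (\<Sum>c<length J. - B (I ! c) k * T q (J ! c)) = 0"
          using a by (simp add: sum.delta)
      qed (use red in \<open>auto simp: reduced_def\<close>)
      then show ?thesis by (simp add: sum_negf)
    qed
    have "\<delta> * (\<Sum>j<N. x j * B j k) = (\<Sum>j<N. x j * (\<delta> * B j k))"
      by (simp add: sum_distrib_left mult.left_commute)
    also have "\<dots> = (\<Sum>j<N. \<Sum>c<length J. B (I ! c) k * (x j * T j (J ! c)))"
      by (simp add: eq sum_distrib_left mult.left_commute)
    also have "\<dots> = (\<Sum>c<length J. B (I ! c) k * (\<Sum>j<N. x j * T j (J ! c)))"
      by (subst sum.swap) (simp add: sum_distrib_left)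
    also have "\<dots> = 0" using T JJ by simp
    finally show "(\<Sum>j<N. x j * B j k) = 0" using \<delta> by simp
  qed
qed

section \<open>Elimination on the machine\<close>

text \<open>
  Registers and arrays. The matrix under elimination is kept in \<open>aT\<close>, the structure constants and the
  coefficients of the \<open>f\<^sub>k\<close> in \<open>aC\<close> and \<open>aB\<close>. In \<open>aP\<close>, a column without pivot has the entry 0 and a
  column with pivot row \<open>i\<close> the entry \<open>i + 1\<close>. The generators modulo the pivot are the rows
  \<open>1, \<dots>, 2 N\<close> of \<open>aV\<close>, whose row 0 is the working row of Euclid's algorithm; \<open>aU\<close> receives
  one corrected generator at a time. The register \<open>rW\<close> holds the row length \<open>N + 1\<close> of \<open>aV\<close>.
\<close>

abbreviation "rD \<equiv> (2 :: nat)"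
abbreviation "rM \<equiv> (3 :: nat)"
abbreviation "rP \<equiv> (4 :: nat)"
abbreviation "rN \<equiv> (5 :: nat)"
abbreviation "rdelta \<equiv> (6 :: nat)"
abbreviation "rmod \<equiv> (7 :: nat)"
abbreviation "rW \<equiv> (8 :: nat)"
abbreviation "rNN \<equiv> (9 :: nat)"
abbreviation "rMD \<equiv> (10 :: nat)"
abbreviation "rDDD \<equiv> (11 :: nat)"
abbreviation "rPD \<equiv> (12 :: nat)"
abbreviation "rk \<equiv> (13 :: nat)"
abbreviation "rs \<equiv> (14 :: nat)"
abbreviation "rj \<equiv> (15 :: nat)"
abbreviation "racc \<equiv> (16 :: nat)"
abbreviation "rtmp \<equiv> (17 :: nat)"
abbreviation "rpiv \<equiv> (18 :: nat)"
abbreviation "rt \<equiv> (19 :: nat)"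
abbreviation "rf \<equiv> (20 :: nat)"
abbreviation "rq \<equiv> (21 :: nat)"

abbreviation "aT \<equiv> (2 :: nat)"
abbreviation "aC \<equiv> (3 :: nat)"
abbreviation "aB \<equiv> (4 :: nat)"
abbreviation "aP \<equiv> (5 :: nat)"
abbreviation "aV \<equiv> (6 :: nat)"
abbreviation "aU \<equiv> (7 :: nat)"

lemma reg_bound: "bounded_by K s \<Longrightarrow> \<bar>reg s x\<bar> \<le> 2 ^ K"
  by (simp add: bounded_by_def)

lemma mem_bound: "bounded_by K s \<Longrightarrow> \<bar>mem s a i\<bar> \<le> 2 ^ K"
  by (simp add: bounded_by_def)

definition tab :: "nat \<Rightarrow> (nat \<Rightarrow> int) \<Rightarrow> nat \<Rightarrow> nat \<Rightarrow> int" where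
  "tab w M j k = M (j * w + k)"

text \<open>
  Two-dimensional arrays are stored row by row, so distinct cells have distinct addresses only within
  the range of the column index.
\<close>

lemma cell_eq_iff: "k < w \<Longrightarrow> k' < w \<Longrightarrow> j * w + k = j' * w + k' \<longleftrightarrow> j = j' \<and> k = (k' :: nat)"
  by (metis add.commute div_mult_self3 div_less mod_less mod_mult_self3 add_0_right less_nat_zero_code)

lemma tab_upd: "k < w \<Longrightarrow> k' < w \<Longrightarrow> tab w (M(j' * w + k' := v)) j k = (if j = j' \<and> k = k' then v else tab w M j k)"
  by (simp add: tab_def cell_eq_iff)

lemma nat_cell [simp]:
  "nat (int a * int b + int c) = a * b + c"
  "nat ((int a + 1) * int b + int c) = Suc a * b + c"
  "nat ((1 + int a) * int b + int c) = Suc a * b + c"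
proof -
  show 1: "nat (int a * int b + int c) = a * b + c" for a
    by (metis nat_int of_nat_add of_nat_mult)
  show "nat ((int a + 1) * int b + int c) = Suc a * b + c" "nat ((1 + int a) * int b + int c) = Suc a * b + c"
    using 1[of "Suc a"] by (simp_all only: of_nat_Suc add.commute)
qed

abbreviation Cell :: "exp \<Rightarrow> nat \<Rightarrow> exp \<Rightarrow> exp" where
  "Cell i w j \<equiv> Add (Mul i (Reg w)) j"

definition Sum :: "nat \<Rightarrow> nat \<Rightarrow> nat \<Rightarrow> exp \<Rightarrow> com" where
  "Sum x y a e = Seq (Assign a (Const 0)) (For x y (Assign a (Add (Reg a) e)))"

lemma Sum_simps [simp]:
  "wregs (Sum x y a e) = {x, a}" "warrs (Sum x y a e) = {}"
  "reads (Sum x y a e) = False" "writes (Sum x y a e) = False"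
  by (auto simp: Sum_def)

context run begin

lemma wp_Sum:
  assumes cnt: "reg s y = int cnt" "cnt \<le> X" and ne: "x \<noteq> y" "x \<noteq> a" "y \<noteq> a"
    and val: "\<And>i s'. i < cnt \<Longrightarrow> frame (Sum x y a e) s s' \<Longrightarrow> reg s' x = int i \<Longrightarrow> exp_val e s' = v i"
    and bound: "(\<Sum>i<cnt. \<bar>v i\<bar>) \<le> 2 ^ K"
    and post: "\<And>s'. frame (Sum x y a e) s s' \<Longrightarrow> reg s' a = (\<Sum>i<cnt. v i) \<Longrightarrow> Q s'"
  shows "wp (Sum x y a e) Q s"
proof -
  let ?s = "s\<lparr>reg := (reg s)(a := 0)\<rparr>"
  have fr: "frame (Sum x y a e) s s'" if "frame (For x y (Assign a (Add (Reg a) e))) ?s s'" for s'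
    using that by (auto simp: frame_def)
  have part: "\<bar>\<Sum>i<i'. v i\<bar> \<le> 2 ^ K" if "i' \<le> cnt" for i'
  proof -
    have "\<bar>\<Sum>i<i'. v i\<bar> \<le> (\<Sum>i<i'. \<bar>v i\<bar>)" by (rule sum_abs)
    also have "\<dots> \<le> (\<Sum>i<cnt. \<bar>v i\<bar>)" using that by (intro sum_mono2) auto
    finally show ?thesis using bound by simp
  qed
  have "wp (For x y (Assign a (Add (Reg a) e))) Q ?s"
  proof (rule wp_For[where cnt = cnt and J = "\<lambda>i s'. reg s' a = (\<Sum>i<i. v i)"], goal_cases)
    case (7 i s')
    have "exp_val (Add (Reg a) e) s' = (\<Sum>i<Suc i. v i)"
      using val[OF 7(1) fr[OF 7(2)] 7(3)] 7(4) by simp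
    then show ?case using part[of "Suc i"] 7(1) ne by (intro wp_Assign) (simp_all del: exp_val.simps sum.lessThan_Suc)
  next
    case (8 s')
    then show ?case using post fr by simp
  qed (use cnt ne in auto)
  then show ?thesis unfolding Sum_def by (intro wp_Seq wp_Assign) simp_all
qed

end

definition ReadArray :: "nat \<Rightarrow> nat \<Rightarrow> com" where
  "ReadArray a y = For rj y (Seq (Read rtmp) (Store a (Reg rj) (Reg rtmp)))"

lemma ReadArray_simps [simp]:
  "wregs (ReadArray a y) = {rj, rtmp}" "warrs (ReadArray a y) = {a}"
  "reads (ReadArray a y)" "\<not> writes (ReadArray a y)"
  by (auto simp: ReadArray_def)

lemma (in run) wp_ReadArray:
  assumes cnt: "reg s y = int cnt" "cnt \<le> X" and y: "y \<notin> {rj, rtmp}"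
    and inp: "inp s = map f [0..<cnt] @ rest"
    and post: "\<And>s'. frame (ReadArray a y) s s' \<Longrightarrow> inp s' = rest \<Longrightarrow> (\<And>i. i < cnt \<Longrightarrow> mem s' a i = f i) \<Longrightarrow> Q s'"
  shows "wp (ReadArray a y) Q s"
  unfolding ReadArray_def
proof (rule wp_For[where cnt = cnt and J = "\<lambda>i s'. inp s' = map f [i..<cnt] @ rest \<and> (\<forall>i'<i. mem s' a i' = f i')"], goal_cases)
  case (7 i s')
  have i: "inp s' = f i # (map f [Suc i..<cnt] @ rest)" using 7 by (simp add: upt_conv_Cons)
  show ?case using 7(3,4)
    by (intro wp_Seq wp_Read[OF i] wp_Store) (auto simp: less_Suc_eq dest: reg_bound[where x = rtmp])
next
  case (8 s')
  then show ?case by (intro post) (auto simp: ReadArray_def)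
qed (use cnt y inp in auto)

text \<open>
  The row that belongs to \<open>(k, j)\<close> has the number \<open>m + (k * d + j)\<close>. A single counter \<open>k * d + j\<close> runs over
  these rows, and \<open>rq\<close> holds its multiple \<open>k * d\<close> of \<open>d\<close>.
\<close>

definition MakeRows :: com where
  "MakeRows = For rs rPD (Seq (Assign rq (Mul (Div (Reg rs) (Reg rD)) (Reg rD)))
     (For rk rD (Seq
        (Sum rj rD racc (Mul (Load aB (Add (Reg rq) (Reg rj)))
           (Load aC (Cell (Cell (Reg rj) rD (Sub (Reg rs) (Reg rq))) rD (Reg rk)))))
        (Store aT (Cell (Add (Reg rM) (Reg rs)) rD (Reg rk)) (Reg racc)))))"

lemma MakeRows_simps [simp]:
  "wregs MakeRows = {rs, rq, rk, rj, racc}" "warrs MakeRows = {aT}" "\<not> reads MakeRows" "\<not> writes MakeRows"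
  by (auto simp: MakeRows_def)

lemma (in run) wp_MakeRows:
  fixes s d m pd
  defines "v \<equiv> \<lambda>u l i. mem s aB (u div d * d + i) * mem s aC ((i * d + u mod d) * d + l)"
  assumes regs: "reg s rD = int d" "reg s rPD = int pd" "reg s rM = int m" and X: "d \<le> X" "pd \<le> X"
    and bound: "\<And>u l. u < pd \<Longrightarrow> l < d \<Longrightarrow> (\<Sum>i<d. \<bar>v u l i\<bar>) \<le> 2 ^ K"
    and post: "\<And>s'. frame MakeRows s s' \<Longrightarrow>
      (\<And>j k. j < m + pd \<Longrightarrow> k < d \<Longrightarrow>
        tab d (mem s' aT) j k = (if j < m then tab d (mem s aT) j k else (\<Sum>i<d. v (j - m) k i))) \<Longrightarrow> Q s'"
  shows "wp MakeRows Q s"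
proof -
  \<comment> \<open>the matrix when \<open>u\<close> rows and the first \<open>l\<close> entries of the next one have been written\<close>
  define T where "T u l j k = (if (m \<le> j \<and> (j < m + u \<or> (j = m + u \<and> k < l))) then (\<Sum>i<d. v (j - m) k i) else tab d (mem s aT) j k)" for u l j k
  show ?thesis
  unfolding MakeRows_def
  proof (rule wp_For[where cnt = pd and J = "\<lambda>u s'. \<forall>j. \<forall>k<d. tab d (mem s' aT) j k = T u 0 j k"], goal_cases)
    case (7 u s')
    then have r': "reg s' rD = int d" "reg s' rM = int m" "reg s' rs = int u" "mem s' aB = mem s aB" "mem s' aC = mem s aC"
      using regs by (simp_all add: frame_def)
    have q: "int u div int d * int d = int (u div d * d)" by (simp add: zdiv_int)
    let ?s = "s'\<lparr>reg := (reg s')(rq := int (u div d * d))\<rparr>"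
    have "\<bar>int (u div d * d)\<bar> \<le> 2 ^ K" if "bounded_by K s'"
    proof -
      have "\<bar>int u\<bar> \<le> 2 ^ K" using that r'(3) unfolding bounded_by_def by metis
      moreover have "u div d * d \<le> u" by simp
      ultimately show ?thesis by linarith
    qed
    moreover have "wp (For rk rD (Seq
        (Sum rj rD racc (Mul (Load aB (Add (Reg rq) (Reg rj)))
           (Load aC (Cell (Cell (Reg rj) rD (Sub (Reg rs) (Reg rq))) rD (Reg rk)))))
        (Store aT (Cell (Add (Reg rM) (Reg rs)) rD (Reg rk)) (Reg racc))))
        (\<lambda>s''. \<forall>j. \<forall>k<d. tab d (mem (s''\<lparr>reg := (reg s'')(rs := int (Suc u))\<rparr>) aT) j k = T (Suc u) 0 j k) ?s" (is "wp _ ?Q _")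
    proof (rule wp_For[where cnt = d and J = "\<lambda>l s'. \<forall>j. \<forall>k<d. tab d (mem s' aT) j k = T u l j k"], goal_cases)
      case (7 l s'')
      then have r'': "reg s'' rD = int d" "reg s'' rM = int m" "reg s'' rs = int u" "reg s'' rk = int l"
         "reg s'' rq = int (u div d * d)" "mem s'' aB = mem s aB" "mem s'' aC = mem s aC"
        using r' by (simp_all add: frame_def)
      have md: "int u - int (u div d * d) = int (u mod d)" 
        by (metis add_diff_cancel_left' div_mult_mod_eq of_nat_add)
      show ?case
      proof (rule wp_Seq, rule wp_Sum[where cnt = d and v = "v u l"], goal_cases)
        case (6 i s3)
        then have r3: "reg s3 rD = int d" "reg s3 rs = int u" "reg s3 rk = int l"
         "reg s3 rq = int (u div d * d)" "mem s3 aB = mem s aB" "mem s3 aC = mem s aC"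
          using r'' by (simp_all add: frame_def)
        have n1: "nat (int (u div d * d) + int i) = u div d * d + i" by (metis nat_int of_nat_add)
        have n2: "nat ((int i * int d + int (u mod d)) * int d + int l) = (i * d + u mod d) * d + l"
          by (metis nat_int of_nat_add of_nat_mult)
        show ?case using 6(3) by (simp add: r3 v_def md n1 n2 del: of_nat_mult)
      next
        case 7 then show ?case using bound \<open>u < pd\<close> \<open>l < d\<close> by simp
      next
        case (8 s3)
        then have r3: "reg s3 rD = int d" "reg s3 rM = int m" "reg s3 rs = int u" "reg s3 rk = int l" "mem s3 aT = mem s'' aT"
          using r'' by (simp_all add: frame_def)
        have n: "nat ((int m + int u) * int d + int l) = (m + u) * d + l" by (metis nat_int of_nat_add of_nat_mult)
        show ?case using \<open>l < d\<close> 8(2) 7(4)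
          by (intro wp_Store) (auto simp: r3 n tab_upd T_def dest: reg_bound[where x = racc])
      qed (use r'' X in auto)
    next
      case (8 s')
      then show ?case by (auto simp: T_def)
    qed (use r' X 7 in auto)
    ultimately show ?case by (intro wp_Seq wp_Assign) (simp_all add: r' q del: of_nat_mult)
  next
    case (8 s')
    then show ?case by (intro post) (auto simp: T_def MakeRows_def)
  next
    case 6 show ?case by (simp add: T_def)
  qed (use regs X in auto)
qed

text \<open>
  Conditions test for positive values, so being nonzero is tested on the square.
\<close>

definition FindPivot :: com where
  "FindPivot = Seq (Assign rpiv (Const 0)) (For rj rN
     (Cond (Mul (Load aT (Cell (Reg rj) rD (Reg rk))) (Load aT (Cell (Reg rj) rD (Reg rk))))
       (Assign rpiv (Add (Reg rj) (Const 1))) Skip))"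

lemma FindPivot_simps [simp]:
  "wregs FindPivot = {rpiv, rj}" "warrs FindPivot = {}" "\<not> reads FindPivot" "\<not> writes FindPivot"
  by (auto simp: FindPivot_def)

lemma (in run) wp_FindPivot:
  assumes regs: "reg s rD = int d" "reg s rN = int N" "reg s rk = int k" and X: "N \<le> X" "int N \<le> 2 ^ K"
    and post: "\<And>s' r. frame FindPivot s s' \<Longrightarrow> reg s' rpiv = int r \<Longrightarrow>
      (case r of 0 \<Rightarrow> \<forall>j<N. tab d (mem s aT) j k = 0 | Suc i \<Rightarrow> i < N \<and> tab d (mem s aT) i k \<noteq> 0) \<Longrightarrow> Q s'"
  shows "wp FindPivot Q s"
  unfolding FindPivot_def
proof (intro wp_Seq wp_Assign, simp, rule wp_For[where cnt = N and J = "\<lambda>n s'. \<exists>r. reg s' rpiv = int r \<and>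
    (case r of 0 \<Rightarrow> \<forall>j<n. tab d (mem s aT) j k = 0 | Suc i \<Rightarrow> i < n \<and> tab d (mem s aT) i k \<noteq> 0)"], goal_cases)
  case (7 n s')
  then have r': "reg s' rD = int d" "reg s' rk = int k" "reg s' rj = int n" "mem s' aT = mem s aT"
    using regs by (simp_all add: frame_def)
  show ?case
  proof (rule wp_Cond, goal_cases)
    case 1
    then have "tab d (mem s aT) n k \<noteq> 0" by (auto simp: r' tab_def)
    then have "\<exists>r. int n + 1 = int r \<and> (case r of 0 \<Rightarrow> \<forall>j<Suc n. tab d (mem s aT) j k = 0
        | Suc i \<Rightarrow> i < Suc n \<and> tab d (mem s aT) i k \<noteq> 0)"
      by (intro exI[of _ "Suc n"]) simp
    moreover have "\<bar>int n + 1\<bar> \<le> 2 ^ K" using 7(1) X(2) by linarith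
    ultimately show ?case by (intro wp_Assign) (simp_all only: exp_val.simps r', simp)
  next
    case 2
    then have "tab d (mem s aT) n k = 0" by (auto simp: r' tab_def mult_le_0_iff)
    moreover from 7(4) obtain r where "reg s' rpiv = int r"
      "(case r of 0 \<Rightarrow> \<forall>j<n. tab d (mem s aT) j k = 0 | Suc i \<Rightarrow> i < n \<and> tab d (mem s aT) i k \<noteq> 0)" by blast
    ultimately show ?case by (intro wp_Skip exI[of _ r]) (auto simp: less_Suc_eq split: nat.splits)
  qed
next
  case 6 show ?case by (rule exI[of _ 0]) simp
next
  case (8 s')
  then obtain r where "reg s' rpiv = int r" "(case r of 0 \<Rightarrow> \<forall>j<N. tab d (mem s aT) j k = 0 | Suc i \<Rightarrow> i < N \<and> tab d (mem s aT) i k \<noteq> 0)"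
    by blast
  then show ?case using 8(1) by (intro post) (auto simp: frame_def)
qed (use regs X in auto)

text \<open>
  The entry of the pivot row is saved in \<open>rf\<close> because the inner loop overwrites it with 0.
\<close>

definition Eliminate :: com where
  "Eliminate = For rs rD (Cond (Mul (Sub (Reg rs) (Reg rk)) (Sub (Reg rs) (Reg rk)))
     (Seq (Assign rf (Load aT (Cell (Sub (Reg rpiv) (Const 1)) rD (Reg rs))))
       (For rj rN (Store aT (Cell (Reg rj) rD (Reg rs))
         (Div (Sub (Mul (Reg rt) (Load aT (Cell (Reg rj) rD (Reg rs))))
                   (Mul (Reg rf) (Load aT (Cell (Reg rj) rD (Reg rk)))))
              (Reg rdelta)))))
     Skip)"

lemma Eliminate_simps [simp]:
  "wregs Eliminate = {rs, rf, rj}" "warrs Eliminate = {aT}" "\<not> reads Eliminate" "\<not> writes Eliminate"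
  by (auto simp: Eliminate_def)

lemma (in run) wp_Eliminate:
  fixes s d k i
  defines "T \<equiv> tab d (mem s aT)"
  defines "T' \<equiv> \<lambda>j l. if l = k then T j k else (T i k * T j l - T i l * T j k) div reg s rdelta"
  assumes regs: "reg s rD = int d" "reg s rN = int N" "reg s rk = int k" "reg s rpiv = int (Suc i)" "reg s rt = T i k"
    and i: "i < N" and k: "k < d" and X: "N \<le> X" "d \<le> X"
    and bound: "\<And>j l. j < N \<Longrightarrow> l < d \<Longrightarrow> \<bar>T' j l\<bar> \<le> 2 ^ K"
    and post: "\<And>s'. frame Eliminate s s' \<Longrightarrow> (\<And>j l. j < N \<Longrightarrow> l < d \<Longrightarrow> tab d (mem s' aT) j l = T' j l) \<Longrightarrow> Q s'"
  shows "wp Eliminate Q s"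
proof -
  \<comment> \<open>the matrix when columns before \<open>l\<close> and the first \<open>n\<close> entries of column \<open>l\<close> have been treated\<close>
  define U where "U l n j l' = (if j < N \<and> (l' < l \<or> (l' = l \<and> j < n)) then T' j l' else T j l')" for l n j l'
  show ?thesis
    unfolding Eliminate_def
  proof (rule wp_For[where cnt = d and J = "\<lambda>l s'. \<forall>j. \<forall>l'<d. tab d (mem s' aT) j l' = U l 0 j l'"], goal_cases)
    case (7 l s')
    then have r': "reg s' rD = int d" "reg s' rN = int N" "reg s' rk = int k" "reg s' rpiv = int (Suc i)" "reg s' rt = T i k"
        "reg s' rs = int l" "reg s' rdelta = reg s rdelta"
      using regs by (simp_all add: frame_def)
    note inv = 7(4)
    show ?case
    proof (rule wp_Cond, goal_cases)
      case 1
      then have lk: "l \<noteq> k" by (auto simp: r')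
      have Til: "mem s' aT (i * d + l) = T i l"
        using inv 7(1) i by (simp add: U_def tab_def T_def)
      show ?case
      proof (intro wp_Seq wp_Assign, goal_cases)
        case 1 then show ?case by (simp add: mem_bound)
      next
        case 2
        show ?case
        proof (rule wp_For[where cnt = N and J = "\<lambda>n s'. \<forall>j. \<forall>l'<d. tab d (mem s' aT) j l' = U l n j l'"], goal_cases)
          case (7 n s'')
          then have r'': "reg s'' rD = int d" "reg s'' rk = int k" "reg s'' rt = T i k" "reg s'' rf = T i l" "reg s'' rj = int n"
            "reg s'' rs = int l" "reg s'' rdelta = reg s rdelta"
            using r' Til by (simp_all add: frame_def)
          have T'nl: "T' n l = (T i k * T n l - T i l * T n k) div reg s rdelta" using lk by (simp add: T'_def)
          have Tn: "mem s'' aT (n * d + l) = T n l" using 7(4) \<open>l < d\<close> by (simp add: tab_def U_def)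
          have Tk: "mem s'' aT (n * d + k) = T n k" using 7(4) k lk by (simp add: tab_def U_def T'_def)
          show ?case using bound[OF 7(1) \<open>l < d\<close>] 7(1,4) \<open>l < d\<close>
            by (intro wp_Store) (auto simp: r'' Tn Tk T'nl[symmetric] tab_upd U_def)
        next
          case 6
          then show ?case using inv by simp
        next
          case (8 s')
          then show ?case by (auto simp: U_def)
        qed (use r' X in auto)
      qed
    next
      case 2
      then have lk: "l = k" by (auto simp: r' mult_le_0_iff)
      then show ?case using inv by (intro wp_Skip) (auto simp: U_def T'_def)
    qed
  next
    case 6 show ?case by (simp add: U_def T_def)
  next
    case (8 s')
    then show ?case by (intro post) (auto simp: U_def Eliminate_def)
  qed (use regs X in auto)
qed

definition Gauss :: com where
  "Gauss = Seq (Assign rdelta (Const 1)) (For rk rD (Seq FindPivot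
     (Seq (Store aP (Reg rk) (Reg rpiv))
       (Cond (Reg rpiv)
         (Seq (Assign rt (Load aT (Cell (Sub (Reg rpiv) (Const 1)) rD (Reg rk))))
           (Seq Eliminate (Assign rdelta (Reg rt))))
         Skip))))"

lemma Gauss_simps [simp]:
  "wregs Gauss = {rdelta, rk, rpiv, rj, rt, rs, rf}" "warrs Gauss = {aT, aP}" "\<not> reads Gauss" "\<not> writes Gauss"
  by (auto simp: Gauss_def)

text \<open>The only properties of the eliminated matrix that matter afterwards. As in memory, \<open>piv k = 0\<close> means
  that column \<open>k\<close> has no pivot, and \<open>piv k = Suc i\<close> that its pivot is in row \<open>i\<close>.\<close>

definition echelon :: "(nat \<Rightarrow> nat \<Rightarrow> int) \<Rightarrow> nat \<Rightarrow> nat \<Rightarrow> (nat \<Rightarrow> nat \<Rightarrow> int) \<Rightarrow> int \<Rightarrow> (nat \<Rightarrow> nat) \<Rightarrow> bool" where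
  "echelon B N d T \<delta> piv \<longleftrightarrow> \<delta> \<noteq> 0
     \<and> (\<forall>k<d. case piv k of 0 \<Rightarrow> \<forall>j<N. T j k = 0
           | Suc i \<Rightarrow> i < N \<and> (\<forall>l<d. T i l = (if l = k then \<delta> else 0)))
     \<and> (\<forall>x. (\<forall>k<d. (\<Sum>j<N. x j * B j k) = 0) \<longleftrightarrow> (\<forall>k<d. (\<Sum>j<N. x j * T j k) = 0))"

definition gauss_inv where
  "gauss_inv B N d k T \<delta> piv \<longleftrightarrow> (\<exists>I J. reduced B N d I J T \<delta> \<and> set J \<subseteq> {..<k}
     \<and> (\<forall>a<length J. piv (J ! a) = int (Suc (I ! a)))
     \<and> (\<forall>k'<k. k' \<notin> set J \<longrightarrow> piv k' = 0 \<and> (\<forall>j<N. T j k' = 0)))"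

lemma gauss_inv_init: "gauss_inv B N d 0 B 1 piv"
  unfolding gauss_inv_def by (intro exI[of _ "[]"]) (simp add: reduced_init)

lemma gauss_inv_skip:
  assumes "gauss_inv B N d k T \<delta> piv" "k < d" "\<forall>j<N. T j k = 0"
  shows "gauss_inv B N d (Suc k) T \<delta> (piv(k := 0))"
proof -
  from assms(1) obtain I J where IJ: "reduced B N d I J T \<delta>" "set J \<subseteq> {..<k}"
     "\<forall>a<length J. piv (J ! a) = int (Suc (I ! a))" "\<forall>k'<k. k' \<notin> set J \<longrightarrow> piv k' = 0 \<and> (\<forall>j<N. T j k' = 0)"
    unfolding gauss_inv_def by blast
  have "J ! a \<noteq> k" if "a < length J" for a using nth_less[OF IJ(2) that] by simp
  then show ?thesis using IJ assms(2,3) unfolding gauss_inv_def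
    by (intro exI[of _ I] exI[of _ J]) (auto simp: less_Suc_eq)
qed

text \<open>
  Columns passed over earlier are zero and stay zero, since both products in the numerator vanish.
\<close>

lemma gauss_inv_step:
  assumes "gauss_inv B N d k T \<delta> piv" "k < d" "i < N" "T i k \<noteq> 0"
    and T': "\<And>j l. j < N \<Longrightarrow> l < d \<Longrightarrow> T' j l = (if l = k then T j k else (T i k * T j l - T i l * T j k) div \<delta>)"
  shows "gauss_inv B N d (Suc k) T' (T i k) (piv(k := int (Suc i)))"
proof -
  from assms(1) obtain I J where IJ: "reduced B N d I J T \<delta>" "set J \<subseteq> {..<k}"
     "\<forall>a<length J. piv (J ! a) = int (Suc (I ! a))" "\<forall>k'<k. k' \<notin> set J \<longrightarrow> piv k' = 0 \<and> (\<forall>j<N. T j k' = 0)"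
    unfolding gauss_inv_def by blast
  have kJ: "k \<notin> set J" using IJ(2) by auto
  have ne: "J ! a \<noteq> k" if "a < length J" for a using nth_less[OF IJ(2) that] by simp
  have len: "length I = length J" using IJ(1) by (simp add: reduced_def)
  have red: "reduced B N d (I @ [i]) (J @ [k]) T' (T i k)"
    by (rule reduced_cong[OF reduced_step[OF IJ(1) assms(3,2) kJ assms(4)]]) (rule T')
  show ?thesis unfolding gauss_inv_def
  proof (intro exI conjI)
    show "\<forall>a<length (J @ [k]). (piv(k := int (Suc i))) ((J @ [k]) ! a) = int (Suc ((I @ [i]) ! a))"
      using IJ(3) len ne by (auto simp: nth_append less_Suc_eq)
    show "\<forall>k'<Suc k. k' \<notin> set (J @ [k]) \<longrightarrow> (piv(k := int (Suc i))) k' = 0 \<and> (\<forall>j<N. T' j k' = 0)"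
    proof (intro allI impI)
      fix k' assume "k' < Suc k" "k' \<notin> set (J @ [k])"
      then have k': "k' < k" "k' \<notin> set J" by auto
      then have z: "piv k' = 0" "\<forall>j<N. T j k' = 0" using IJ(4) by auto
      then show "(piv(k := int (Suc i))) k' = 0 \<and> (\<forall>j<N. T' j k' = 0)"
        using k' assms(2,3) by (simp add: T')
    qed
    show "set (J @ [k]) \<subseteq> {..<Suc k}" using IJ(2) by auto
  qed (rule red)
qed

lemma gauss_inv_final:
  assumes "gauss_inv B N d d T \<delta> piv"
  shows "echelon B N d T \<delta> (\<lambda>k. nat (piv k))"
proof -
  from assms(1) obtain I J where IJ: "reduced B N d I J T \<delta>" "set J \<subseteq> {..<d}"
     "\<forall>a<length J. piv (J ! a) = int (Suc (I ! a))" "\<forall>k'<d. k' \<notin> set J \<longrightarrow> piv k' = 0 \<and> (\<forall>j<N. T j k' = 0)"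
    unfolding gauss_inv_def by blast
  show ?thesis unfolding echelon_def
  proof (intro conjI allI impI)
    show "\<delta> \<noteq> 0" using IJ(1) by (simp add: reduced_def)
  next
    fix k assume k: "k < d"
    show "case nat (piv k) of 0 \<Rightarrow> \<forall>j<N. T j k = 0
           | Suc i \<Rightarrow> i < N \<and> (\<forall>l<d. T i l = (if l = k then \<delta> else 0))"
    proof (cases "k \<in> set J")
      case True
      then obtain a where a: "a < length J" "J ! a = k" by (auto simp: in_set_conv_nth)
      then have "nat (piv k) = Suc (I ! a)" using IJ(3) by fastforce
      moreover have "I ! a < N" using IJ(1) nth_less[of I N a] a by (simp add: reduced_def)
      moreover have "\<forall>l<d. T (I ! a) l = (if l = k then \<delta> else 0)" using IJ(1) a by (simp add: reduced_def)
      ultimately show ?thesis by simp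
    qed (use IJ(4) k in simp)
  next
    fix x show "(\<forall>k<d. (\<Sum>j<N. x j * B j k) = 0) = (\<forall>k<d. (\<Sum>j<N. x j * T j k) = 0)"
      by (rule reduced_kernel[OF IJ(1)]) (use IJ(4) in auto)
  qed
qed

lemma (in run) wp_Gauss:
  fixes s d N E
  defines "B \<equiv> tab d (mem s aT)"
  defines "b \<equiv> (int (d * d) + 1) * E * E * (fact d * E ^ d)"
  assumes regs: "reg s rD = int d" "reg s rN = int N" and X: "N \<le> X" "d \<le> X" "int N \<le> 2 ^ K"
    and E: "E \<ge> 1" "\<And>j k. j < N \<Longrightarrow> k < d \<Longrightarrow> \<bar>B j k\<bar> \<le> E" and b: "b \<le> 2 ^ K"
    and post: "\<And>s'. frame Gauss s s' \<Longrightarrow> echelon B N d (tab d (mem s' aT)) (reg s' rdelta) (\<lambda>k. nat (mem s' aP k)) \<Longrightarrow>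
       \<bar>reg s' rdelta\<bar> \<le> b \<Longrightarrow> (\<And>j k. j < N \<Longrightarrow> k < d \<Longrightarrow> \<bar>tab d (mem s' aT) j k\<bar> \<le> b) \<Longrightarrow> Q s'"
  shows "wp Gauss Q s"
proof -
  have bound: "\<bar>\<delta>\<bar> \<le> b" "j < N \<Longrightarrow> k < d \<Longrightarrow> \<bar>T j k\<bar> \<le> b" if "gauss_inv B N d k' T \<delta> piv" for j k k' T \<delta> piv
  proof -
    from that obtain I J where "reduced B N d I J T \<delta>" unfolding gauss_inv_def by blast
    from reduced_bound[where E = E, OF this E] show "\<bar>\<delta>\<bar> \<le> b" "j < N \<Longrightarrow> k < d \<Longrightarrow> \<bar>T j k\<bar> \<le> b"
      unfolding b_def by simp_all
  qed
  let ?J = "\<lambda>k s'. gauss_inv B N d k (tab d (mem s' aT)) (reg s' rdelta) (mem s' aP)"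
  show ?thesis unfolding Gauss_def
  proof (intro wp_Seq wp_Assign, simp, rule wp_For[where cnt = d and J = ?J], goal_cases)
    case (7 k s')
    then have r': "reg s' rD = int d" "reg s' rN = int N" "reg s' rk = int k"
      using regs by (simp_all add: frame_def)
    note inv = 7(4)
    show ?case
    proof (rule wp_Seq, rule wp_FindPivot[where d = d and N = N and k = k], goal_cases)
      case (6 s2 r)
      then have r2: "reg s2 rD = int d" "reg s2 rN = int N" "reg s2 rk = int k" "mem s2 = mem s'" "reg s2 rdelta = reg s' rdelta"
        using r' by (auto simp: frame_def)
      have "r \<le> N" using 6(3) by (cases r) auto
      then have r: "\<bar>int r\<bar> \<le> 2 ^ K" using X(3) by linarith
      show ?case
      proof (intro wp_Seq wp_Store, goal_cases)
        case 1 then show ?case using 6(2) r by simp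
      next
        case 2
        show ?case
        proof (cases r)
          case 0
          then have "\<forall>j<N. tab d (mem s' aT) j k = 0" using 6(3) by simp
          from gauss_inv_skip[OF inv 7(1) this] show ?thesis using 0 6(2)
            by (intro wp_Cond wp_Skip) (simp_all add: r2)
        next
          case (Suc i)
          let ?T = "tab d (mem s' aT)"
          have i: "i < N" "?T i k \<noteq> 0" using 6(3) Suc by auto
          note step = gauss_inv_step[where T = ?T, OF inv 7(1) i]
          have t: "mem s' aT (i * d + k) = ?T i k" by (simp add: tab_def)
          show ?thesis
          proof (rule wp_Cond, goal_cases)
            case 1
            show ?case
            proof (intro wp_Seq wp_Assign, goal_cases)
              case 1 then show ?case using mem_bound[OF 1, of aT] by simp
            next
              case 2
              show ?case
              proof (rule wp_Eliminate[where d = d and N = N and k = k and i = i], goal_cases)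
                case (10 j l)
                from order_trans[OF bound(2)[OF step[OF refl] 10] b] show ?case
                  by (cases "l = k") (simp_all add: r2)
              next
                case (11 s3)
                then have r3: "reg s3 rt = ?T i k" "mem s3 aP = (mem s' aP)(k := int (Suc i))"
                  using r2 6(2) Suc t by (simp_all add: frame_def)
                have inv': "gauss_inv B N d (Suc k) (tab d (mem s3 aT)) (?T i k) ((mem s' aP)(k := int (Suc i)))"
                  by (rule step) (use 11(2) r2 in simp)
                show ?case
                proof (rule wp_Assign, goal_cases)
                  case 1 then show ?case by (simp add: reg_bound)
                next
                  case 2 show ?case using inv' r3 by simp
                qed
              qed (use r2 6(2) Suc t i X 7(1) in auto)
            qed
          next
            case 2 then show ?case using 6(2) Suc by simp
          qed
        qed
      qed
    qed (use r' X in auto)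
  next
    case 6 show ?case using gauss_inv_init by (simp add: B_def)
  next
    case (8 s')
    show ?case
    proof (rule post)
      show "frame Gauss s s'" using 8(1) by (auto simp: frame_def)
      show "echelon B N d (tab d (mem s' aT)) (reg s' rdelta) (\<lambda>k. nat (mem s' aP k))" by (rule gauss_inv_final[OF 8(3)])
    qed (use bound[OF 8(3)] in auto)
  qed (use regs X in auto)
qed

section \<open>Lattices of solutions modulo the pivot\<close>

text \<open>
  The group generated by the rows \<open>0, \<dots>, N\<close> of \<open>V\<close> and the vectors \<open>D e\<^sub>j\<close> with \<open>j < N\<close>. The last
  coordinate, with index \<open>N\<close>, is an exact integer and not a residue: it records the value of the
  current congruence on the vector formed by the other coordinates.
\<close>

definition pair_lattice :: "nat \<Rightarrow> int \<Rightarrow> (nat \<Rightarrow> nat \<Rightarrow> int) \<Rightarrow> (nat \<Rightarrow> int) \<Rightarrow> bool" where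
  "pair_lattice N D V y \<longleftrightarrow> (\<exists>a e. \<forall>j<Suc N. y j = (\<Sum>s<Suc N. a s * V s j) + (if j < N then D * e j else 0))"

text \<open>
  Between two columns, row 0 and the last coordinate are only working space.
\<close>

definition row_span_mod :: "nat \<Rightarrow> int \<Rightarrow> (nat \<Rightarrow> nat \<Rightarrow> int) \<Rightarrow> (nat \<Rightarrow> int) \<Rightarrow> bool" where
  "row_span_mod N D V x \<longleftrightarrow> (\<exists>a e. \<forall>j<N. x j = (\<Sum>s<N. a s * V (Suc s) j) + D * e j)"

lemma row_span_modI: "(\<And>j. j < N \<Longrightarrow> x j = (\<Sum>s<N. a s * V (Suc s) j) + D * e j) \<Longrightarrow> row_span_mod N D V x"
  unfolding row_span_mod_def by (rule exI[of _ a], rule exI[of _ e]) simp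

lemma sum_split_two:
  assumes "r < N"
  shows "(\<Sum>s<Suc N. h s) = h 0 + (h (Suc r) :: int) + (\<Sum>s\<in>{..<Suc N} - {0, Suc r}. h s)"
proof -
  have "(\<Sum>s<Suc N. h s) = h 0 + (\<Sum>s\<in>{..<Suc N} - {0}. h s)"
    by (subst sum.remove[of _ 0]) auto
  also have "(\<Sum>s\<in>{..<Suc N} - {0}. h s) = h (Suc r) + (\<Sum>s\<in>{..<Suc N} - {0} - {Suc r}. h s)"
    by (subst sum.remove[of _ "Suc r"]) (use assms in auto)
  also have "{..<Suc N} - {0} - {Suc r} = {..<Suc N} - {0, Suc r}" by auto
  finally show ?thesis by simp
qed

text \<open>
  One division step: the rows \<open>(v, v')\<close> are replaced by \<open>(v', v - q v')\<close>, which is invertible over the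
  integers, and reduction modulo \<open>D\<close> changes a row by combinations of the \<open>D e\<^sub>j\<close>.
\<close>

lemma pair_lattice_euclid:
  assumes r: "r < N"
    and V0: "\<And>j. j < Suc N \<Longrightarrow> V' 0 j = V (Suc r) j"
    and Vr: "\<And>j. j < Suc N \<Longrightarrow> V' (Suc r) j = V 0 j - q * V (Suc r) j - (if j < N then D * f j else 0)"
    and V: "\<And>s j. s < Suc N \<Longrightarrow> j < Suc N \<Longrightarrow> s \<noteq> 0 \<Longrightarrow> s \<noteq> Suc r \<Longrightarrow> V' s j = V s j"
  shows "pair_lattice N D V' y \<longleftrightarrow> pair_lattice N D V y"
proof -
  have rest: "(\<Sum>s\<in>{..<Suc N} - {0, Suc r}. a s * V' s j) = (\<Sum>s\<in>{..<Suc N} - {0, Suc r}. a s * V s j)" if "j < Suc N" for a j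
    using that by (intro sum.cong) (auto simp: V)
  have upd: "(\<Sum>s\<in>{..<Suc N} - {0, Suc r}. (a(0 := b, Suc r := c)) s * W s j) = (\<Sum>s\<in>{..<Suc N} - {0, Suc r}. a s * W s j)"
    for a :: "nat \<Rightarrow> int" and b c j and W :: "nat \<Rightarrow> nat \<Rightarrow> int"
    by (intro sum.cong) auto
  show ?thesis
  proof
    assume "pair_lattice N D V' y"
    then obtain a e where y: "\<And>j. j < Suc N \<Longrightarrow> y j = (\<Sum>s<Suc N. a s * V' s j) + (if j < N then D * e j else 0)"
      unfolding pair_lattice_def by blast
    show "pair_lattice N D V y"
      unfolding pair_lattice_def
    proof (rule exI[of _ "a(0 := a (Suc r), Suc r := a 0 - q * a (Suc r))"], rule exI[of _ "\<lambda>j. e j - a (Suc r) * f j"], intro allI impI)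
      fix j assume j: "j < Suc N"
      show "y j = (\<Sum>s<Suc N. (a(0 := a (Suc r), Suc r := a 0 - q * a (Suc r))) s * V s j) + (if j < N then D * (e j - a (Suc r) * f j) else 0)"
        unfolding y[OF j] sum_split_two[OF r] rest[OF j] upd using j by (simp add: V0 Vr algebra_simps)
    qed
  next
    assume "pair_lattice N D V y"
    then obtain a e where y: "\<And>j. j < Suc N \<Longrightarrow> y j = (\<Sum>s<Suc N. a s * V s j) + (if j < N then D * e j else 0)"
      unfolding pair_lattice_def by blast
    show "pair_lattice N D V' y"
      unfolding pair_lattice_def
    proof (rule exI[of _ "a(0 := a (Suc r) + q * a 0, Suc r := a 0)"], rule exI[of _ "\<lambda>j. e j + a 0 * f j"], intro allI impI)
      fix j assume j: "j < Suc N"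
      show "y j = (\<Sum>s<Suc N. (a(0 := a (Suc r) + q * a 0, Suc r := a 0)) s * V' s j) + (if j < N then D * (e j + a 0 * f j) else 0)"
        unfolding y[OF j] sum_split_two[OF r] upd rest[OF j] using j by (simp add: V0 Vr algebra_simps)
    qed
  qed
qed

text \<open>
  Adding the row \<open>(0, D)\<close> turns the congruence into an equation: a member \<open>x\<close> of the group satisfies it iff the pair
  \<open>(x, 0)\<close> lies in the lattice, for then the multiple of \<open>D\<close> that remains in the last coordinate
  can be cancelled by that row.
\<close>

lemma pair_lattice_start:
  assumes D: "D \<noteq> 0" and V0: "\<And>j. j < N \<Longrightarrow> V 0 j = 0" "V 0 N = D"
    and VN: "\<And>s. s < N \<Longrightarrow> V (Suc s) N = (\<Sum>j<N. V (Suc s) j * t j) mod D"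
  shows "pair_lattice N D V (\<lambda>j. if j < N then x j else 0) \<longleftrightarrow> row_span_mod N D V x \<and> D dvd (\<Sum>j<N. x j * t j)"
proof -
  have xt: "(\<Sum>j<N. x j * t j) = (\<Sum>s<N. a s * (\<Sum>j<N. V (Suc s) j * t j)) + D * (\<Sum>j<N. e j * t j)"
    if "\<forall>j<N. x j = (\<Sum>s<N. a s * V (Suc s) j) + D * e j" for a e
  proof -
    have "(\<Sum>j<N. x j * t j) = (\<Sum>j<N. \<Sum>s<N. a s * (V (Suc s) j * t j)) + (\<Sum>j<N. D * (e j * t j))"
      by (simp add: that sum.distrib[symmetric] distrib_right sum_distrib_right mult.assoc)
    then show ?thesis by (subst (asm) sum.swap) (simp add: sum_distrib_left)
  qed
  have dvd: "D dvd (\<Sum>s<N. a s * (\<Sum>j<N. V (Suc s) j * t j)) - (\<Sum>s<N. a s * V (Suc s) N)" for a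
  proof -
    have "(\<Sum>s<N. a s * (\<Sum>j<N. V (Suc s) j * t j)) - (\<Sum>s<N. a s * V (Suc s) N)
      = (\<Sum>s<N. a s * ((\<Sum>j<N. V (Suc s) j * t j) - V (Suc s) N))"
      by (simp add: sum_subtractf right_diff_distrib)
    also have "D dvd \<dots>" by (intro dvd_sum dvd_mult) (simp add: VN minus_mod_eq_mult_div)
    finally show ?thesis .
  qed
  show ?thesis
  proof
    assume "pair_lattice N D V (\<lambda>j. if j < N then x j else 0)"
    then obtain a e where y: "\<And>j. j < Suc N \<Longrightarrow>
       (if j < N then x j else 0) = (\<Sum>s<Suc N. a s * V s j) + (if j < N then D * e j else 0)"
      unfolding pair_lattice_def by blast
    have x: "x j = (\<Sum>s<N. a (Suc s) * V (Suc s) j) + D * e j" if "j < N" for j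
      using y[of j] that V0 by (simp add: sum.lessThan_Suc_shift del: sum.lessThan_Suc)
    have "0 = a 0 * D + (\<Sum>s<N. a (Suc s) * V (Suc s) N)"
      using y[of N] V0 by (simp add: sum.lessThan_Suc_shift del: sum.lessThan_Suc)
    then have "(\<Sum>s<N. a (Suc s) * V (Suc s) N) = D * (- a 0)" by (simp add: algebra_simps)
    then have "D dvd (\<Sum>s<N. a (Suc s) * V (Suc s) N)" by simp
    from dvd_add[OF dvd[of "\<lambda>s. a (Suc s)"] this]
    have "D dvd (\<Sum>s<N. a (Suc s) * (\<Sum>j<N. V (Suc s) j * t j))" by simp
    note 1 = this
    have eq: "(\<Sum>j<N. x j * t j) = (\<Sum>s<N. a (Suc s) * (\<Sum>j<N. V (Suc s) j * t j)) + D * (\<Sum>j<N. e j * t j)"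
      by (rule xt) (use x in blast)
    show "row_span_mod N D V x \<and> D dvd (\<Sum>j<N. x j * t j)"
    proof
      show "row_span_mod N D V x"
        by (rule row_span_modI[of N x "\<lambda>s. a (Suc s)" V D e]) (rule x)
      show "D dvd (\<Sum>j<N. x j * t j)"
        unfolding eq by (rule dvd_add[OF 1 dvd_triv_left])
    qed
  next
    assume asm: "row_span_mod N D V x \<and> D dvd (\<Sum>j<N. x j * t j)"
    then have "row_span_mod N D V x" ..
    then obtain a e where x: "\<And>j. j < N \<Longrightarrow> x j = (\<Sum>s<N. a s * V (Suc s) j) + D * e j"
      unfolding row_span_mod_def by blast
    have eq: "(\<Sum>j<N. x j * t j) = (\<Sum>s<N. a s * (\<Sum>j<N. V (Suc s) j * t j)) + D * (\<Sum>j<N. e j * t j)"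
      by (rule xt) (use x in blast)
    from asm have "D dvd (\<Sum>s<N. a s * (\<Sum>j<N. V (Suc s) j * t j)) + D * (\<Sum>j<N. e j * t j)"
      unfolding eq ..
    then have "D dvd (\<Sum>s<N. a s * (\<Sum>j<N. V (Suc s) j * t j))"
      by (subst (asm) dvd_add_left_iff) (rule dvd_triv_left)
    from dvd_diff[OF this dvd[of a]] have "D dvd (\<Sum>s<N. a s * V (Suc s) N)" by simp
    then obtain b where b: "(\<Sum>s<N. a s * V (Suc s) N) = D * b" ..
    show "pair_lattice N D V (\<lambda>j. if j < N then x j else 0)"
      unfolding pair_lattice_def
    proof (rule exI[of _ "case_nat (- b) a"], rule exI[of _ e], intro allI impI)
      fix j assume "j < Suc N"
      then show "(if j < N then x j else 0) = (\<Sum>s<Suc N. case_nat (- b) a s * V s j) + (if j < N then D * e j else 0)"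
        by (cases "j = N") (simp_all add: sum.lessThan_Suc_shift x V0 b del: sum.lessThan_Suc)
    qed
  qed
qed

text \<open>
  When Euclid's algorithm has cleared the last coordinate in all rows but row 0, a combination with
  last coordinate 0 does not involve row 0. So this row can be dropped, and the number of generators
  does not grow from one congruence to the next.
\<close>

lemma pair_lattice_end:
  assumes V0: "V 0 N \<noteq> 0" and V: "\<And>s. s < N \<Longrightarrow> V (Suc s) N = 0"
  shows "pair_lattice N D V (\<lambda>j. if j < N then x j else 0) \<longleftrightarrow> row_span_mod N D V x"
proof
  assume "pair_lattice N D V (\<lambda>j. if j < N then x j else 0)"
  then obtain a e where y: "\<And>j. j < Suc N \<Longrightarrow>
     (if j < N then x j else 0) = (\<Sum>s<Suc N. a s * V s j) + (if j < N then D * e j else 0)"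
    unfolding pair_lattice_def by blast
  have "a 0 = 0"
    using y[of N] V0 V by (simp add: sum.lessThan_Suc_shift del: sum.lessThan_Suc)
  then have "x j = (\<Sum>s<N. a (Suc s) * V (Suc s) j) + D * e j" if "j < N" for j
    using y[of j] that by (simp add: sum.lessThan_Suc_shift del: sum.lessThan_Suc)
  then show "row_span_mod N D V x" by (rule row_span_modI)
next
  assume "row_span_mod N D V x"
  then obtain a e where x: "\<And>j. j < N \<Longrightarrow> x j = (\<Sum>s<N. a s * V (Suc s) j) + D * e j"
    unfolding row_span_mod_def by blast
  show "pair_lattice N D V (\<lambda>j. if j < N then x j else 0)"
    unfolding pair_lattice_def
  proof (rule exI[of _ "case_nat 0 a"], rule exI[of _ e], intro allI impI)
    fix j assume "j < Suc N"
    then show "(if j < N then x j else 0) = (\<Sum>s<Suc N. case_nat 0 a s * V s j) + (if j < N then D * e j else 0)"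
      by (cases "j = N") (simp_all add: sum.lessThan_Suc_shift x V del: sum.lessThan_Suc)
  qed
qed

lemma row_span_mod_id:
  assumes "\<And>s j. s < N \<Longrightarrow> j < N \<Longrightarrow> V (Suc s) j = (if s = j then 1 else 0)"
  shows "row_span_mod N D V x"
  unfolding row_span_mod_def
  by (rule exI[of _ x], rule exI[of _ "\<lambda>_. 0"]) (simp add: assms if_distrib[of "\<lambda>y. _ * y"] sum.delta cong: if_cong)

lemma row_span_mod_row: "s < N \<Longrightarrow> row_span_mod N D V (V (Suc s))"
  unfolding row_span_mod_def
  by (rule exI[of _ "\<lambda>s'. if s' = s then 1 else 0"], rule exI[of _ "\<lambda>_. 0"])
    (simp add: if_distrib[of "\<lambda>y. y * _"] sum.delta cong: if_cong)

section \<open>From solutions modulo the pivot to integer solutions\<close>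

text \<open>
  For a vector \<open>v\<close> with \<open>v T \<equiv> 0\<close> modulo \<open>\<delta>\<close>, the product with column \<open>k\<close> is made zero by subtracting its
  quotient by \<open>\<delta>\<close> in the pivot row of that column, where \<open>T\<close> has the entry \<open>\<delta>\<close> in column \<open>k\<close> and 0 in
  the other columns.
\<close>

definition correct :: "nat \<Rightarrow> nat \<Rightarrow> (nat \<Rightarrow> nat \<Rightarrow> int) \<Rightarrow> int \<Rightarrow> (nat \<Rightarrow> nat) \<Rightarrow> (nat \<Rightarrow> int) \<Rightarrow> nat \<Rightarrow> int" where
  "correct N d T \<delta> piv v i = v i - (\<Sum>k<d. if piv k = Suc i then (\<Sum>j<N. v j * T j k) div \<delta> else 0)"

lemma correct_kernel:
  assumes ech: "echelon B N d T \<delta> piv" and dvd: "\<And>k. k < d \<Longrightarrow> \<delta> dvd (\<Sum>j<N. v j * T j k)" and l: "l < d"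
  shows "(\<Sum>i<N. correct N d T \<delta> piv v i * T i l) = 0"
proof -
  let ?w = "\<lambda>k. \<Sum>j<N. v j * T j k"
  have piv: "case piv k of 0 \<Rightarrow> \<forall>j<N. T j k = 0 | Suc i \<Rightarrow> i < N \<and> (\<forall>l<d. T i l = (if l = k then \<delta> else 0))" if "k < d" for k
    using ech that unfolding echelon_def by blast
  have "(\<Sum>i<N. correct N d T \<delta> piv v i * T i l)
      = ?w l - (\<Sum>i<N. \<Sum>k<d. (if piv k = Suc i then ?w k div \<delta> else 0) * T i l)"
    by (simp add: correct_def left_diff_distrib sum_subtractf sum_distrib_right)
  also have "(\<Sum>i<N. \<Sum>k<d. (if piv k = Suc i then ?w k div \<delta> else 0) * T i l)
      = (\<Sum>k<d. \<Sum>i<N. (if piv k = Suc i then ?w k div \<delta> else 0) * T i l)" by (rule sum.swap)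
  also have "\<dots> = (\<Sum>k<d. if k = l then ?w l else 0)"
  proof (rule sum.cong[OF refl])
    fix k assume "k \<in> {..<d}"
    then have k: "k < d" by simp
    show "(\<Sum>i<N. (if piv k = Suc i then ?w k div \<delta> else 0) * T i l) = (if k = l then ?w l else 0)"
    proof (cases "piv k")
      case 0
      then have "?w k = 0" using piv[OF k] by simp
      then show ?thesis using 0 by auto
    next
      case (Suc i0)
      then have i0: "i0 < N" "T i0 l = (if l = k then \<delta> else 0)" using piv[OF k] l by auto
      have "(\<Sum>i<N. (if piv k = Suc i then ?w k div \<delta> else 0) * T i l) = (\<Sum>i<N. if i = i0 then ?w k div \<delta> * T i0 l else 0)"
        by (intro sum.cong) (auto simp: Suc)
      also have "\<dots> = ?w k div \<delta> * T i0 l" using i0(1) by (simp add: sum.delta)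
      also have "\<dots> = (if k = l then ?w l else 0)" using dvd[OF k] i0(2) by auto
      finally show ?thesis .
    qed
  qed
  also have "\<dots> = ?w l" using l by (simp add: sum.delta)
  finally show ?thesis by simp
qed

lemma correct_id:
  assumes "\<And>k. k < d \<Longrightarrow> (\<Sum>j<N. v j * T j k) = 0"
  shows "correct N d T \<delta> piv v i = v i"
proof -
  have "(\<Sum>k<d. if piv k = Suc i then (\<Sum>j<N. v j * T j k) div \<delta> else 0) = 0"
    by (rule sum.neutral) (simp add: assms)
  then show ?thesis by (simp add: correct_def)
qed

text \<open>
  Rounded quotients are not additive, exact ones are; this is where the congruences enter.
\<close>

lemma correct_sum:
  assumes "\<And>s k. s < n \<Longrightarrow> k < d \<Longrightarrow> \<delta> dvd (\<Sum>j<N. v s j * T j k)" "\<delta> \<noteq> 0"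
    and x: "\<And>j. j < N \<Longrightarrow> x j = (\<Sum>s<n. a s * v s j)" and i: "i < N"
  shows "correct N d T \<delta> piv x i = (\<Sum>s<n. a s * correct N d T \<delta> piv (v s) i)"
proof -
  let ?w = "\<lambda>s k. \<Sum>j<N. v s j * T j k"
  have w: "(\<Sum>j<N. x j * T j k) div \<delta> = (\<Sum>s<n. a s * (?w s k div \<delta>))" if k: "k < d" for k
  proof -
    have "(\<Sum>j<N. x j * T j k) = (\<Sum>j<N. \<Sum>s<n. a s * (v s j * T j k))"
      by (simp add: x sum_distrib_right mult.assoc)
    also have "\<dots> = (\<Sum>s<n. a s * ?w s k)" by (subst sum.swap) (simp add: sum_distrib_left)
    also have "\<dots> = (\<Sum>s<n. a s * (\<delta> * (?w s k div \<delta>)))"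
      using assms(1) k by (intro sum.cong) auto
    also have "\<dots> = \<delta> * (\<Sum>s<n. a s * (?w s k div \<delta>))" by (simp add: sum_distrib_left mult.left_commute)
    finally show ?thesis using assms(2) by simp
  qed
  have "correct N d T \<delta> piv x i = (\<Sum>s<n. a s * v s i) - (\<Sum>k<d. \<Sum>s<n. a s * (if piv k = Suc i then ?w s k div \<delta> else 0))"
    unfolding correct_def x[OF i] by (intro arg_cong2[where f = minus] sum.cong refl) (simp add: w)
  also have "\<dots> = (\<Sum>s<n. a s * correct N d T \<delta> piv (v s) i)"
    by (subst sum.swap) (simp add: correct_def sum_subtractf right_diff_distrib sum_distrib_left)
  finally show ?thesis .
qed

lemma sum_double:
  fixes N :: nat
  shows "(\<Sum>s<2 * N. h s) = (\<Sum>s<N. h s) + (\<Sum>s<N. h (N + s) :: int)"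
proof -
  have "{..<2 * N :: nat} = {..<N} \<union> {N..<N + N}" by auto
  then have "(\<Sum>s<2 * N. h s) = (\<Sum>s<N. h s) + (\<Sum>s\<in>{N..<N + N}. h s)"
    by (simp add: sum.union_disjoint ivl_disj_int)
  also have "(\<Sum>s\<in>{N..<N + N}. h s) = (\<Sum>s<N. h (N + s))"
    using sum.shift_bounds_nat_ivl[of h 0 N N] by (simp add: lessThan_atLeast0 add.commute)
  finally show ?thesis .
qed

text \<open>
  The correction is a linear map from the solutions modulo \<open>\<delta>\<close> onto the kernel: it takes values in
  the kernel and is the identity there. Thus it maps generators to generators.
\<close>

lemma kernel_generators:
  assumes ech: "echelon B N d T \<delta> piv"
    and rows: "\<And>x. row_span_mod N \<bar>\<delta>\<bar> V x \<longleftrightarrow> (\<forall>k<d. \<bar>\<delta>\<bar> dvd (\<Sum>j<N. x j * T j k))"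
    and last: "\<And>s j. s < N \<Longrightarrow> j < N \<Longrightarrow> V (Suc (N + s)) j = (if s = j then \<bar>\<delta>\<bar> else 0)"
  shows "(\<forall>k<d. (\<Sum>j<N. x j * B j k) = 0) \<longleftrightarrow>
    (\<exists>a. \<forall>i<N. x i = (\<Sum>s<2 * N. a s * correct N d T \<delta> piv (V (Suc s)) i))"
proof -
  have \<delta>: "\<delta> \<noteq> 0" and ker: "(\<forall>k<d. (\<Sum>j<N. x j * B j k) = 0) \<longleftrightarrow> (\<forall>k<d. (\<Sum>j<N. x j * T j k) = 0)"
    using ech unfolding echelon_def by blast+
  have dvd: "\<delta> dvd (\<Sum>j<N. V (Suc s) j * T j k)" if s: "s < 2 * N" and k: "k < d" for s k
  proof (cases "s < N")
    case True
    then have "\<bar>\<delta>\<bar> dvd (\<Sum>j<N. V (Suc s) j * T j k)" using rows[of "V (Suc s)"] row_span_mod_row k by blast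
    then show ?thesis by simp
  next
    case False
    then have "V (Suc s) j = (if s - N = j then \<bar>\<delta>\<bar> else 0)" if "j < N" for j
      using last[of "s - N" j] s that by simp
    then show ?thesis by (intro dvd_sum) simp
  qed
  show ?thesis unfolding ker
  proof
    assume x: "\<forall>k<d. (\<Sum>j<N. x j * T j k) = 0"
    then have "row_span_mod N \<bar>\<delta>\<bar> V x" by (simp add: rows)
    then obtain a e where ae: "\<And>j. j < N \<Longrightarrow> x j = (\<Sum>s<N. a s * V (Suc s) j) + \<bar>\<delta>\<bar> * e j"
      unfolding row_span_mod_def by blast
    \<comment> \<open>The rows \<open>N + 1, \<dots>, 2 N\<close> account for the multiples of \<open>\<delta>\<close>.\<close>
    define a' where "a' s = (if s < N then a s else e (s - N))" for s
    have "x j = (\<Sum>s<2 * N. a' s * V (Suc s) j)" if j: "j < N" for j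
    proof -
      have "(\<Sum>s<2 * N. a' s * V (Suc s) j) = (\<Sum>s<N. a' s * V (Suc s) j) + (\<Sum>s<N. a' (N + s) * V (Suc (N + s)) j)"
        by (rule sum_double)
      also have "(\<Sum>s<N. a' s * V (Suc s) j) = (\<Sum>s<N. a s * V (Suc s) j)" by (simp add: a'_def)
      also have "(\<Sum>s<N. a' (N + s) * V (Suc (N + s)) j) = \<bar>\<delta>\<bar> * e j"
        using j by (simp add: a'_def last if_distrib[of "\<lambda>y. _ * y"] sum.delta cong: if_cong)
      finally show ?thesis using ae[OF j] by simp
    qed
    note x' = this
    have "x i = (\<Sum>s<2 * N. a' s * correct N d T \<delta> piv (V (Suc s)) i)" if "i < N" for i
      using correct_sum[where v = "\<lambda>s. V (Suc s)", OF dvd \<delta> x' that, where piv = piv]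
        correct_id[where v = x and T = T and N = N and d = d and \<delta> = \<delta> and piv = piv and i = i] x by simp
    then show "\<exists>a. \<forall>i<N. x i = (\<Sum>s<2 * N. a s * correct N d T \<delta> piv (V (Suc s)) i)" by blast
  next
    assume "\<exists>a. \<forall>i<N. x i = (\<Sum>s<2 * N. a s * correct N d T \<delta> piv (V (Suc s)) i)"
    then obtain a where a: "\<And>i. i < N \<Longrightarrow> x i = (\<Sum>s<2 * N. a s * correct N d T \<delta> piv (V (Suc s)) i)" by blast
    show "\<forall>k<d. (\<Sum>j<N. x j * T j k) = 0"
    proof (intro allI impI)
      fix k assume k: "k < d"
      have "(\<Sum>j<N. x j * T j k) = (\<Sum>j<N. \<Sum>s<2 * N. a s * (correct N d T \<delta> piv (V (Suc s)) j * T j k))"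
        by (simp add: a sum_distrib_right mult.assoc)
      also have "\<dots> = (\<Sum>s<2 * N. a s * (\<Sum>j<N. correct N d T \<delta> piv (V (Suc s)) j * T j k))"
        by (subst sum.swap) (simp add: sum_distrib_left)
      also have "\<dots> = 0" using correct_kernel[OF ech dvd k] by simp
      finally show "(\<Sum>j<N. x j * T j k) = 0" .
    qed
  qed
qed

section \<open>Kernel generators on the machine\<close>

definition Dot :: com where
  "Dot = Sum rj rN racc (Mul (Load aV (Cell (Add (Reg rs) (Const 1)) rW (Reg rj))) (Load aT (Cell (Reg rj) rD (Reg rk))))"

lemma Dot_simps [simp]:
  "wregs Dot = {rj, racc}" "warrs Dot = {}" "\<not> reads Dot" "\<not> writes Dot"
  by (auto simp: Dot_def)

lemma (in run) wp_Dot: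
  assumes regs: "reg s rN = int N" "reg s rW = int W" "reg s rD = int d" "reg s rs = int r" "reg s rk = int k"
    and X: "N \<le> X"
    and bound: "(\<Sum>j<N. \<bar>tab W (mem s aV) (Suc r) j * tab d (mem s aT) j k\<bar>) \<le> 2 ^ K"
    and post: "\<And>s'. frame Dot s s' \<Longrightarrow> reg s' racc = (\<Sum>j<N. tab W (mem s aV) (Suc r) j * tab d (mem s aT) j k) \<Longrightarrow> Q s'"
  shows "wp Dot Q s"
  unfolding Dot_def
proof (rule wp_Sum[where cnt = N and v = "\<lambda>j. tab W (mem s aV) (Suc r) j * tab d (mem s aT) j k"], goal_cases)
  case (6 i s')
  then show ?case using regs by (simp add: frame_def tab_def)
next
  case (8 s')
  then show ?case by (intro post) (simp_all add: Dot_def)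
qed (use regs X bound in auto)

definition SetModulus :: com where
  "SetModulus = Seq (Assign rmod (Reg rdelta))
     (Cond (Sub (Const 0) (Reg rdelta)) (Assign rmod (Sub (Const 0) (Reg rdelta))) Skip)"

lemma SetModulus_simps [simp]:
  "wregs SetModulus = {rmod}" "warrs SetModulus = {}" "\<not> reads SetModulus" "\<not> writes SetModulus"
  by (auto simp: SetModulus_def)

lemma (in run) wp_SetModulus:
  assumes post: "\<And>s'. frame SetModulus s s' \<Longrightarrow> reg s' rmod = \<bar>reg s rdelta\<bar> \<Longrightarrow> Q s'"
  shows "wp SetModulus Q s"
proof (rule wp_mono[where Q = "\<lambda>s'. reg s' rmod = \<bar>reg s rdelta\<bar>"])
  show "wp SetModulus (\<lambda>s'. reg s' rmod = \<bar>reg s rdelta\<bar>) s"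
    unfolding SetModulus_def
  proof (rule wp_bounded, intro wp_Seq wp_Assign, goal_cases)
    case 1
    then show ?case using reg_bound[of K s rdelta] by simp
  next
    case 2
    show ?case
    proof (rule wp_Cond, goal_cases)
      case 1
      show ?case
      proof (rule wp_Assign, goal_cases)
        case 1
        then show ?case using reg_bound[OF 2, of rdelta] by simp
      qed (use 1 in simp)
    qed (rule wp_Skip, simp)
  qed
qed (rule post)

definition InitRows :: com where
  "InitRows = For rs rN (Seq (Store aV (Cell (Add (Reg rs) (Const 1)) rW (Reg rs)) (Const 1))
     (Store aV (Cell (Add (Add (Reg rs) (Const 1)) (Reg rN)) rW (Reg rs)) (Reg rmod)))"

lemma InitRows_simps [simp]:
  "wregs InitRows = {rs}" "warrs InitRows = {aV}" "\<not> reads InitRows" "\<not> writes InitRows"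
  by (auto simp: InitRows_def)

lemma (in run) wp_InitRows:
  assumes regs: "reg s rN = int N" "reg s rW = int W" "reg s rmod = D" and W: "W = Suc N"
    and X: "N \<le> X" and V: "\<And>i. mem s aV i = 0"
    and post: "\<And>s'. frame InitRows s s' \<Longrightarrow>
      (\<And>r j. r < N \<Longrightarrow> j < W \<Longrightarrow> tab W (mem s' aV) (Suc r) j = (if r = j then 1 else 0)) \<Longrightarrow>
      (\<And>r j. r < N \<Longrightarrow> j < W \<Longrightarrow> tab W (mem s' aV) (Suc (N + r)) j = (if r = j then D else 0)) \<Longrightarrow> Q s'"
  shows "wp InitRows Q s"
  unfolding InitRows_def
proof (rule wp_For[where cnt = N and J = "\<lambda>i s'. \<forall>r. \<forall>j<W. tab W (mem s' aV) r j =
    (if r = Suc j \<and> j < i then 1 else if r = Suc (N + j) \<and> j < i then D else 0)"], goal_cases)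
  case (7 i s')
  then have r': "reg s' rN = int N" "reg s' rW = int W" "reg s' rs = int i" "reg s' rmod = D"
    using regs by (simp_all add: frame_def)
  have n: "nat ((int i + 1 + int N) * int W + int i) = Suc (N + i) * W + i"
    using nat_cell(1)[of "Suc (N + i)" W i] by (simp add: add_ac)
  have iW: "i < W" using 7(1) W by simp
  show ?case
  proof (intro wp_Seq wp_Store, goal_cases)
    case 1 then show ?case by simp
  next
    case 2 then show ?case using reg_bound[OF 2, of rmod] by simp
  next
    case 3
    then show ?case using 7(1,4) iW
      by (auto simp: r' n tab_upd less_Suc_eq simp del: add_Suc mult_Suc)
  qed
next
  case (8 s')
  then show ?case using W by (intro post) (auto simp: InitRows_def)
next
  case 6
  show ?case by (simp add: V tab_def)
qed (use regs X in auto)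

definition Residues :: com where
  "Residues = For rs rN (Seq Dot (Store aV (Cell (Add (Reg rs) (Const 1)) rW (Reg rN))
     (Sub (Reg racc) (Mul (Div (Reg racc) (Reg rmod)) (Reg rmod)))))"

lemma Residues_simps [simp]:
  "wregs Residues = {rs, rj, racc}" "warrs Residues = {aV}" "\<not> reads Residues" "\<not> writes Residues"
  by (auto simp: Residues_def)

lemma (in run) wp_Residues:
  fixes s d k W
  defines "V \<equiv> tab W (mem s aV)" and "T \<equiv> tab d (mem s aT)"
  assumes regs: "reg s rN = int N" "reg s rW = int W" "reg s rD = int d" "reg s rk = int k" "reg s rmod = D"
    and W: "W = Suc N" and D: "D > 0" and X: "N \<le> X"
    and bound: "\<And>r. r < N \<Longrightarrow> (\<Sum>j<N. \<bar>V (Suc r) j * T j k\<bar>) \<le> 2 ^ K"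
    and post: "\<And>s'. frame Residues s s' \<Longrightarrow>
      (\<And>r j. j < W \<Longrightarrow> tab W (mem s' aV) r j =
         (if j = N \<and> 0 < r \<and> r \<le> N then (\<Sum>j<N. V r j * T j k) mod D else V r j)) \<Longrightarrow> Q s'"
  shows "wp Residues Q s"
  unfolding Residues_def
proof (rule wp_For[where cnt = N and J = "\<lambda>i s'. \<forall>r. \<forall>j<W. tab W (mem s' aV) r j =
    (if j = N \<and> 0 < r \<and> r \<le> i then (\<Sum>j<N. V r j * T j k) mod D else V r j)"], goal_cases)
  case (7 i s')
  then have r': "reg s' rN = int N" "reg s' rW = int W" "reg s' rD = int d" "reg s' rk = int k" "reg s' rs = int i" "reg s' rmod = D" "mem s' aT = mem s aT"
    using regs by (simp_all add: frame_def)
  have eq: "(\<Sum>j<N. h (tab W (mem s' aV) (Suc i) j * T j k)) = (\<Sum>j<N. h (V (Suc i) j * T j k))" for h :: "int \<Rightarrow> int"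
    using 7(4) W by (intro sum.cong) auto
  show ?case
  proof (rule wp_Seq, rule wp_Dot[where N = N and W = W and d = d and r = i and k = k], goal_cases)
    case 7
    then show ?case using bound[OF \<open>i < N\<close>] eq[of abs] by (simp add: r' T_def)
  next
    case (8 s'')
    then have r'': "reg s'' rN = int N" "reg s'' rW = int W" "reg s'' rs = int i" "reg s'' rmod = D" "mem s'' aV = mem s' aV"
      "reg s'' racc = (\<Sum>j<N. V (Suc i) j * T j k)"
      using r' eq[of "\<lambda>x. x"] by (simp_all add: frame_def T_def)
    let ?v = "(\<Sum>j<N. V (Suc i) j * T j k) mod D"
    have v: "exp_val (Sub (Reg racc) (Mul (Div (Reg racc) (Reg rmod)) (Reg rmod))) s'' = ?v"
      by (simp add: r'' minus_div_mult_eq_mod)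
    have a: "nat (exp_val (Cell (Add (Reg rs) (Const 1)) rW (Reg rN)) s'') = Suc i * W + N"
      by (simp add: r'')
    show ?case
    proof (rule wp_Store, unfold v a, goal_cases)
      case 1
      have "0 \<le> ?v" "?v < D" using D by simp_all
      then show ?case using reg_bound[OF 1, of rmod] r''(4) by linarith
    next
      case 2
      have "N < W" using W by simp
      then show ?case using 7(4) by (auto simp: r'' tab_upd le_Suc_eq simp del: mult_Suc)
    qed
  qed (use r' X in auto)
next
  case (8 s')
  then show ?case by (intro post) (auto simp: Residues_def)
next
  case 6 show ?case by (simp add: V_def)
qed (use regs X in auto)

definition ResetRow :: com where
  "ResetRow = Seq (For rj rN (Store aV (Reg rj) (Const 0))) (Store aV (Reg rN) (Reg rmod))"

lemma ResetRow_simps [simp]: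
  "wregs ResetRow = {rj}" "warrs ResetRow = {aV}" "\<not> reads ResetRow" "\<not> writes ResetRow"
  by (auto simp: ResetRow_def)

lemma tab_upd0: "k < w \<Longrightarrow> k' < w \<Longrightarrow> tab w (M(k' := v)) j k = (if j = 0 \<and> k = k' then v else tab w M j k)"
  using tab_upd[of k w k' M 0 v j] by simp

lemma (in run) wp_ResetRow:
  assumes regs: "reg s rN = int N" "reg s rmod = D"
    and W: "W = Suc N" and X: "N \<le> X"
    and post: "\<And>s'. frame ResetRow s s' \<Longrightarrow>
      (\<And>r j. j < W \<Longrightarrow> tab W (mem s' aV) r j =
         (if r = 0 then (if j = N then D else 0) else tab W (mem s aV) r j)) \<Longrightarrow> Q s'"
  shows "wp ResetRow Q s"
proof (rule wp_mono[where Q = "\<lambda>s'. \<forall>r. \<forall>j<W. tab W (mem s' aV) r j =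
         (if r = 0 then (if j = N then D else 0) else tab W (mem s aV) r j)"])
  show "wp ResetRow (\<lambda>s'. \<forall>r. \<forall>j<W. tab W (mem s' aV) r j =
         (if r = 0 then (if j = N then D else 0) else tab W (mem s aV) r j)) s"
  unfolding ResetRow_def
  proof (rule wp_Seq, rule wp_For[where cnt = N and J = "\<lambda>i s'. \<forall>r. \<forall>j<W. tab W (mem s' aV) r j =
    (if r = 0 \<and> j < i then 0 else tab W (mem s aV) r j)"], goal_cases)
    case (7 i s')
    then show ?case using W by (intro wp_Store) (auto simp: tab_upd0)
  next
    case (8 s')
    then have "reg s' rN = int N" "reg s' rmod = D" using regs by (simp_all add: frame_def)
    then show ?case using 8(3) W by (intro wp_Store) (auto simp: tab_upd0 reg_bound dest: reg_bound[where x = rmod])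
  qed (use regs X in auto)
qed (use post in auto)

text \<open>
  All \<open>N + 1\<close> columns are treated alike. Reducing the last one modulo \<open>D\<close> is harmless, since the
  remainder it holds is below the divisor, which is at most \<open>D\<close>, and so is left unchanged.
\<close>

definition EuclidStep :: com where
  "EuclidStep = Seq (Assign rq (Div (Load aV (Reg rN)) (Load aV (Cell (Add (Reg rs) (Const 1)) rW (Reg rN)))))
     (For rj rW (Seq (Assign rtmp (Sub (Load aV (Reg rj))
          (Mul (Reg rq) (Load aV (Cell (Add (Reg rs) (Const 1)) rW (Reg rj))))))
       (Seq (Store aV (Reg rj) (Load aV (Cell (Add (Reg rs) (Const 1)) rW (Reg rj))))
         (Store aV (Cell (Add (Reg rs) (Const 1)) rW (Reg rj))
           (Sub (Reg rtmp) (Mul (Div (Reg rtmp) (Reg rmod)) (Reg rmod)))))))"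

lemma EuclidStep_simps [simp]:
  "wregs EuclidStep = {rq, rj, rtmp}" "warrs EuclidStep = {aV}" "\<not> reads EuclidStep" "\<not> writes EuclidStep"
  by (auto simp: EuclidStep_def)

lemma (in run) wp_EuclidStep:
  fixes s W N r
  defines "V \<equiv> tab W (mem s aV)"
  defines "q \<equiv> V 0 N div V (Suc r) N"
  assumes regs: "reg s rN = int N" "reg s rW = int W" "reg s rs = int r" "reg s rmod = D"
    and W: "W = Suc N" and X: "W \<le> X" and D: "D > 0" "D + D * D \<le> 2 ^ K"
    and V: "\<And>j. j < W \<Longrightarrow> 0 \<le> V 0 j \<and> V 0 j \<le> D" "\<And>j. j < W \<Longrightarrow> 0 \<le> V (Suc r) j \<and> V (Suc r) j \<le> D"
    and post: "\<And>s'. frame EuclidStep s s' \<Longrightarrow>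
      (\<And>r' j. j < W \<Longrightarrow> tab W (mem s' aV) r' j =
         (if r' = 0 then V (Suc r) j else if r' = Suc r then (V 0 j - q * V (Suc r) j) mod D else V r' j)) \<Longrightarrow> Q s'"
  shows "wp EuclidStep Q s"
proof -
  have qb: "0 \<le> q" "q \<le> D"
  proof -
    have *: "0 \<le> V 0 N" "V 0 N \<le> D" "0 \<le> V (Suc r) N" using V W by simp_all
    then show "0 \<le> q" by (cases "V (Suc r) N = 0") (auto simp: q_def pos_imp_zdiv_nonneg_iff)
    have "q \<le> \<bar>V 0 N div V (Suc r) N\<bar>" by (simp add: q_def)
    also have "\<dots> \<le> \<bar>V 0 N\<bar>" by (rule abs_div_le)
    finally show "q \<le> D" using * by simp
  qed
  have tb: "\<bar>V 0 j - q * V (Suc r) j\<bar> \<le> 2 ^ K" if j: "j < W" for j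
  proof -
    have "0 \<le> q * V (Suc r) j" "q * V (Suc r) j \<le> D * D" using V(2)[OF j] qb D by (auto intro!: mult_mono)
    then show ?thesis using V(1)[OF j] D by linarith
  qed
  show ?thesis
    unfolding EuclidStep_def
  proof (rule wp_bounded, intro wp_Seq wp_Assign, goal_cases)
    case 1
    have "\<bar>q\<bar> \<le> 2 ^ K" using qb D mult_nonneg_nonneg[of D D] by linarith
    then show ?case using regs by (simp add: q_def V_def tab_def)
  next
    case 2
    show ?case
    proof (rule wp_For[where cnt = W and J = "\<lambda>i s'. \<forall>r'. \<forall>j<W. tab W (mem s' aV) r' j =
         (if j < i \<and> r' = 0 then V (Suc r) j else if j < i \<and> r' = Suc r then (V 0 j - q * V (Suc r) j) mod D else V r' j)"], goal_cases)
      case (7 j s')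
      then have r': "reg s' rW = int W" "reg s' rs = int r" "reg s' rmod = D" "reg s' rj = int j" "reg s' rq = q"
        using regs by (simp_all add: frame_def q_def V_def tab_def)
      have m0: "mem s' aV j = V 0 j" using 7(1) 7(4)[THEN spec, of 0, THEN spec, of j] by (simp add: tab_def)
      have mr: "mem s' aV (Suc r * W + j) = V (Suc r) j" using 7(1,4) by (simp add: tab_def del: mult_Suc)
      have ne: "Suc r * W + j \<noteq> j" using W by simp
      show ?case
      proof (intro wp_Seq wp_Assign wp_Store, goal_cases)
        case 1
        then show ?case using tb[OF 7(1)] by (simp add: r' m0 mr del: mult_Suc)
      next
        case 2
        then show ?case using mem_bound[OF 2, of aV "Suc r * W + j"] by (simp add: r' del: mult_Suc)
      next
        case 3
        let ?v = "(V 0 j - q * V (Suc r) j) mod D"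
        have "0 \<le> ?v" "?v < D" using D by simp_all
        moreover have "\<bar>D\<bar> \<le> 2 ^ K" using reg_bound[OF 3, of rmod] r' by simp
        ultimately have "\<bar>?v\<bar> \<le> 2 ^ K" by linarith
        then show ?case by (simp add: r' m0 mr minus_div_mult_eq_mod del: mult_Suc)
      next
        case 4
        show ?case using 7(1,4)
          by (auto simp: r' m0 mr minus_div_mult_eq_mod tab_upd tab_upd0 less_Suc_eq simp del: mult_Suc)
      qed
    next
      case (8 s')
      then show ?case using regs by (intro post) (auto simp: frame_def)
    next
      case 6 show ?case by (simp add: V_def)
    qed (use regs X in auto)
  qed
qed

definition EuclidRow :: com where
  "EuclidRow = While (Load aV (Cell (Add (Reg rs) (Const 1)) rW (Reg rN))) EuclidStep"

lemma EuclidRow_simps [simp]: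
  "wregs EuclidRow = {rq, rj, rtmp}" "warrs EuclidRow = {aV}" "\<not> reads EuclidRow" "\<not> writes EuclidRow"
  by (auto simp: EuclidRow_def)

text \<open>
  As long as \<open>b \<le> a\<close>, a division step at least halves the product \<open>a * b\<close>. If the first step starts
  with \<open>a < b\<close>, it only exchanges the two, and this costs one additional iteration.
\<close>

definition euclid_budget :: "int \<Rightarrow> int \<Rightarrow> nat \<Rightarrow> bool" where
  "euclid_budget a b i \<longleftrightarrow> (b \<le> a \<and> a * b < 2 ^ i) \<or> (\<exists>i'. i = Suc i' \<and> a * b < 2 ^ i')"

lemma euclid_budget_step:
  assumes "euclid_budget a b i" "a > 0" "b > 0"
  obtains i' where "i = Suc i'" "euclid_budget b (a mod b) i'"
proof -
  have m: "0 \<le> a mod b" "a mod b < b" "a mod b \<le> a" using assms by (simp_all add: zmod_le_nonneg_dividend)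
  from assms(1) consider "b \<le> a" "a * b < 2 ^ i" | i' where "\<not> b \<le> a" "i = Suc i'" "a * b < 2 ^ i'"
    unfolding euclid_budget_def
    by (smt (verit) lessI power_strict_increasing_iff)
  then show thesis
  proof cases
    case 1
    have "1 \<le> a div b" using 1 assms by (simp add: pos_imp_zdiv_pos_iff int_one_le_iff_zero_less)
    then have "b * 1 \<le> b * (a div b)" using assms by (intro mult_left_mono) auto
    then have "b + a mod b \<le> a" using mult_div_mod_eq[of b a] by linarith
    then have "2 * (a mod b) \<le> a" using m by linarith
    then have "2 * (a mod b) * b \<le> a * b" using assms by (intro mult_right_mono) auto
    then have *: "2 * (b * (a mod b)) < 2 ^ i" using 1 by (simp add: mult.commute mult.left_commute)
    have "a * b \<ge> 1" using assms by (simp add: int_one_le_iff_zero_less)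
    then obtain i' where i': "i = Suc i'" using 1 by (cases i) auto
    show thesis by (rule that[OF i']) (use * i' m in \<open>simp add: euclid_budget_def\<close>)
  next
    case (2 i')
    then have "a mod b = a" using assms by simp
    with 2 show thesis by (intro that[of i']) (simp_all add: euclid_budget_def mult.commute)
  qed
qed

text \<open>
  The number of iterations is logarithmic in \<open>D\<close>, because all entries stay between 0 and \<open>D\<close>. Row 0
  keeps a positive last coordinate, as it always receives the divisor.
\<close>

lemma (in run) wp_EuclidRow:
  fixes s W N r
  defines "V \<equiv> tab W (mem s aV)"
  assumes regs: "reg s rN = int N" "reg s rW = int W" "reg s rs = int r" "reg s rmod = D"
    and r: "r < N" and W: "W = Suc N" and D: "D > 0" "D + D * D \<le> 2 ^ K" "D * D < 2 ^ L" and X: "W \<le> X" "Suc L \<le> X"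
    and V: "\<And>r j. r < W \<Longrightarrow> j < W \<Longrightarrow> 0 \<le> V r j \<and> V r j \<le> D" "V 0 N > 0"
    and post: "\<And>s'. frame EuclidRow s s' \<Longrightarrow>
      (\<And>r j. r < W \<Longrightarrow> j < W \<Longrightarrow> 0 \<le> tab W (mem s' aV) r j \<and> tab W (mem s' aV) r j \<le> D) \<Longrightarrow>
      tab W (mem s' aV) 0 N > 0 \<Longrightarrow> tab W (mem s' aV) (Suc r) N = 0 \<Longrightarrow>
      (\<And>r' j. j < W \<Longrightarrow> r' \<noteq> 0 \<Longrightarrow> r' \<noteq> Suc r \<Longrightarrow> tab W (mem s' aV) r' j = V r' j) \<Longrightarrow>
      (\<And>y. pair_lattice N D (tab W (mem s' aV)) y = pair_lattice N D V y) \<Longrightarrow> Q s'"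
  shows "wp EuclidRow Q s"
proof -
  define Inv where "Inv U \<longleftrightarrow> (\<forall>r<W. \<forall>j<W. 0 \<le> U r j \<and> U r j \<le> D) \<and> U 0 N > 0
    \<and> (\<forall>r' j. j < W \<longrightarrow> r' \<noteq> 0 \<longrightarrow> r' \<noteq> Suc r \<longrightarrow> U r' j = V r' j)
    \<and> (\<forall>y. pair_lattice N D U y = pair_lattice N D V y)" for U
  show ?thesis
    unfolding EuclidRow_def
  proof (rule wp_While[where i = "Suc L" and J = "\<lambda>i s'. Inv (tab W (mem s' aV)) \<and>
      euclid_budget (tab W (mem s' aV) 0 N) (tab W (mem s' aV) (Suc r) N) i"], goal_cases)
    case 1 show ?case by (rule X)
  next
    case 2
    have "V 0 N * V (Suc r) N \<le> D * D" using V(1) W r D by (intro mult_mono) auto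
    then have "euclid_budget (V 0 N) (V (Suc r) N) (Suc L)" using D by (auto simp: euclid_budget_def)
    then show ?case using V unfolding Inv_def V_def by blast
  next
    case (3 i s')
    let ?U = "tab W (mem s' aV)"
    have r': "reg s' rN = int N" "reg s' rW = int W" "reg s' rs = int r" "reg s' rmod = D"
      using 3(1) regs by (simp_all add: frame_def)
    have pos: "?U (Suc r) N > 0" using 3(3) by (simp add: r' tab_def del: mult_Suc)
    have U: "0 \<le> ?U r j" "?U r j \<le> D" if "r < W" "j < W" for r j
      using 3(2) that unfolding Inv_def by blast+
    have U0: "?U 0 N > 0" using 3(2) unfolding Inv_def by blast
    from 3(2) obtain i' where i': "i = Suc i'" "euclid_budget (?U (Suc r) N) (?U 0 N mod ?U (Suc r) N) i'"
      using euclid_budget_step[OF _ U0 pos] by blast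
    let ?q = "?U 0 N div ?U (Suc r) N"
    have "wp EuclidStep (\<lambda>s'. Inv (tab W (mem s' aV)) \<and>
      euclid_budget (tab W (mem s' aV) 0 N) (tab W (mem s' aV) (Suc r) N) i') s'"
    proof (rule wp_EuclidStep[OF r' W X(1) D(1,2)], goal_cases)
      case (1 j) then show ?case using U W by simp
    next
      case (2 j) then show ?case using U r W by simp
    next
      case (3 s'')
      let ?U' = "tab W (mem s'' aV)"
      have NW: "N < W" using W by simp
      have v: "?U 0 N - ?q * ?U (Suc r) N = ?U 0 N mod ?U (Suc r) N" by (simp add: minus_div_mult_eq_mod)
      have "0 \<le> ?U 0 N mod ?U (Suc r) N" "?U 0 N mod ?U (Suc r) N < ?U (Suc r) N" using pos by simp_all
      moreover have "?U (Suc r) N \<le> D" using U(2)[of "Suc r" N] r W by simp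
      ultimately have md: "(?U 0 N mod ?U (Suc r) N) mod D = ?U 0 N mod ?U (Suc r) N" by simp
      have U'0: "?U' 0 j = ?U (Suc r) j" if "j < W" for j using 3(2)[OF that, of 0] by simp
      have U'r: "?U' (Suc r) j = (?U 0 j - ?q * ?U (Suc r) j) mod D" if "j < W" for j using 3(2)[OF that, of "Suc r"] by simp
      have U'rest: "?U' r' j = ?U r' j" if "j < W" "r' \<noteq> 0" "r' \<noteq> Suc r" for r' j using 3(2)[OF that(1), of r'] that by simp
      have N0: "?U' 0 N = ?U (Suc r) N" "?U' (Suc r) N = ?U 0 N mod ?U (Suc r) N"
        using U'0[OF NW] U'r[OF NW] by (simp_all only: v md)
      have lat: "pair_lattice N D ?U' y = pair_lattice N D ?U y" for y
      proof (rule pair_lattice_euclid[OF r, where q = ?q and f = "\<lambda>j. (?U 0 j - ?q * ?U (Suc r) j) div D"], goal_cases)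
        case (2 j)
        show ?case
        proof (cases "j = N")
          case True
          then show ?thesis using v N0 by simp
        next
          case False
          then have "j < N" "j < W" using 2 W by simp_all
          then show ?thesis by (simp add: U'r minus_mult_div_eq_mod)
        qed
      qed (use W U'0 U'rest in auto)
      have "0 \<le> ?U' r' j \<and> ?U' r' j \<le> D" if "r' < W" "j < W" for r' j
      proof -
        have "(?U 0 j - ?q * ?U (Suc r) j) mod D < D" "0 \<le> (?U 0 j - ?q * ?U (Suc r) j) mod D" using D by simp_all
        moreover have "Suc r < W" using r W by simp
        ultimately show ?thesis using that U by (cases "r' = 0"; cases "r' = Suc r") (auto simp: U'0 U'r U'rest)
      qed
      then have "Inv ?U'" using \<open>Inv ?U \<and> _\<close> lat pos N0 U'rest unfolding Inv_def by auto
      then show ?case using i'(2) N0 by simp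
    qed
    then show ?case using i'(1) by blast
  next
    case (4 i s')
    let ?U = "tab W (mem s' aV)"
    have r': "reg s' rN = int N" "reg s' rW = int W" "reg s' rs = int r" "reg s' rmod = D"
      using 4(1) regs by (simp_all add: frame_def)
    have "?U (Suc r) N \<le> 0" using 4(3) by (simp add: r' tab_def del: mult_Suc)
    moreover have "0 \<le> ?U (Suc r) N" using 4(2) r W unfolding Inv_def by simp
    moreover have "frame EuclidRow s s'" using 4(1) by (simp add: frame_def)
    ultimately show ?case using 4(2) unfolding Inv_def by (intro post) auto
  qed
qed

definition Column :: com where
  "Column = Seq Residues (Seq ResetRow (For rs rN EuclidRow))"

lemma Column_simps [simp]:
  "wregs Column = {rs, rj, racc, rq, rtmp}" "warrs Column = {aV}" "\<not> reads Column" "\<not> writes Column"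
  by (auto simp: Column_def)

text \<open>
  The group generated modulo \<open>D\<close> shrinks to those members that satisfy the congruence given by column
  \<open>k\<close>; the rows after row \<open>N\<close>, which hold the multiples of the unit vectors by \<open>D\<close>, are left alone.
\<close>

lemma (in run) wp_Column:
  fixes s d k W N
  defines "V \<equiv> tab W (mem s aV)" and "T \<equiv> tab d (mem s aT)"
  assumes regs: "reg s rN = int N" "reg s rW = int W" "reg s rD = int d" "reg s rk = int k" "reg s rmod = D"
    and W: "W = Suc N" and D: "D > 0" "D + D * D \<le> 2 ^ K" "D * D < 2 ^ L" and X: "W \<le> X" "Suc L \<le> X"
    and bound: "\<And>r. r < N \<Longrightarrow> (\<Sum>j<N. \<bar>V (Suc r) j * T j k\<bar>) \<le> 2 ^ K"
    and V: "\<And>r j. r < N \<Longrightarrow> j < N \<Longrightarrow> 0 \<le> V (Suc r) j \<and> V (Suc r) j \<le> D"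
    and post: "\<And>s'. frame Column s s' \<Longrightarrow>
      (\<And>r j. r < N \<Longrightarrow> j < N \<Longrightarrow> 0 \<le> tab W (mem s' aV) (Suc r) j \<and> tab W (mem s' aV) (Suc r) j \<le> D) \<Longrightarrow>
      (\<And>r j. r > N \<Longrightarrow> j < N \<Longrightarrow> tab W (mem s' aV) r j = V r j) \<Longrightarrow>
      (\<And>x. row_span_mod N D (tab W (mem s' aV)) x \<longleftrightarrow> row_span_mod N D V x \<and> D dvd (\<Sum>j<N. x j * T j k)) \<Longrightarrow> Q s'"
  shows "wp Column Q s"
  unfolding Column_def
proof (rule wp_Seq, rule wp_Residues[OF regs W D(1)], goal_cases)
  case 1 then show ?case using X W by simp
next
  case (2 r) then show ?case using bound by (simp add: V_def T_def)
next
  case (3 s1)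
  have NW: "N < W" using W by simp
  have r1: "reg s1 rN = int N" "reg s1 rW = int W" "reg s1 rD = int d" "reg s1 rk = int k" "reg s1 rmod = D"
    using regs 3(1) by (simp_all add: frame_def)
  show ?case
  proof (rule wp_Seq, rule wp_ResetRow[OF r1(1,5) W], goal_cases)
    case 1 then show ?case using X W by simp
  next
    case (2 s2)
    let ?V = "tab W (mem s2 aV)"
    have r2: "reg s2 rN = int N" "reg s2 rW = int W" "reg s2 rD = int d" "reg s2 rk = int k" "reg s2 rmod = D"
      using r1 2(1) by (simp_all add: frame_def)
    have V2: "?V r j = (if r = 0 then if j = N then D else 0
        else if j = N \<and> r \<le> N then (\<Sum>j<N. V r j * T j k) mod D else V r j)" if "j < W" for r j
      using 2(2)[OF that, of r] 3(2)[OF that, of r] by (simp add: V_def T_def)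
    have V2': "?V (Suc r) j = V (Suc r) j" if "j < N" for r j using V2[of j "Suc r"] that NW by simp
    have md: "0 \<le> z mod D" "z mod D \<le> D" for z using D by (simp_all add: less_imp_le)
    have start: "pair_lattice N D ?V (\<lambda>j. if j < N then x j else 0) \<longleftrightarrow> row_span_mod N D V x \<and> D dvd (\<Sum>j<N. x j * T j k)" for x
    proof -
      have "row_span_mod N D ?V x \<longleftrightarrow> row_span_mod N D V x"
        unfolding row_span_mod_def by (simp add: V2')
      then show ?thesis
        using pair_lattice_start[of D N ?V "\<lambda>j. T j k" x] D(1) V2 NW V2' by simp
    qed
    let ?J = "\<lambda>i s'. (\<forall>r<W. \<forall>j<W. 0 \<le> tab W (mem s' aV) r j \<and> tab W (mem s' aV) r j \<le> D)
      \<and> tab W (mem s' aV) 0 N > 0 \<and> (\<forall>r<i. tab W (mem s' aV) (Suc r) N = 0)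
      \<and> (\<forall>r j. r > N \<longrightarrow> j < N \<longrightarrow> tab W (mem s' aV) r j = V r j)
      \<and> (\<forall>y. pair_lattice N D (tab W (mem s' aV)) y = pair_lattice N D ?V y)"
    show ?case
    proof (rule wp_For[where cnt = N and J = ?J], goal_cases)
      case 6
      have "0 \<le> ?V r j \<and> ?V r j \<le> D" if "r < W" "j < W" for r j
      proof (cases r)
        case (Suc r')
        then show ?thesis using that V[of r' j] md W V2[OF that(2), of r] by (cases "j = N") simp_all
      qed (use V2 that D in auto)
      moreover have "?V r j = V r j" if "r > N" "j < N" for r j using V2[of j r] that NW by simp
      ultimately show ?case using V2[OF NW] D by simp
    next
      case (7 i s')
      then have r': "reg s' rN = int N" "reg s' rW = int W" "reg s' rs = int i" "reg s' rmod = D"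
        using r2 by (simp_all add: frame_def)
      show ?case
      proof (rule wp_EuclidRow[OF r' 7(1) W D X], goal_cases)
        case (3 s'')
        have "tab W (mem s'' aV) (Suc r) N = 0" if "r < Suc i" for r
          using 3(4) 3(5)[OF NW, of "Suc r"] 7(4) that by (cases "r = i") auto
        moreover have "tab W (mem s'' aV) r j = V r j" if "r > N" "j < N" for r j
          using 3(5)[of j r] 7(1,4) that NW by simp
        ultimately show ?case using 3(2,3,6) 7(4) by simp
      qed (use 7(4) in auto)
    next
      case (8 s')
      let ?U = "tab W (mem s' aV)"
      show ?case
      proof (rule post, goal_cases)
        case 1 then show ?case using 3(1) 2(1) 8(1) by (auto simp: frame_def)
      next
        case (2 r j) then show ?case using 8(3) W by simp
      next
        case (3 r j) then show ?case using 8(3) by simp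
      next
        case (4 x)
        have "row_span_mod N D ?U x \<longleftrightarrow> pair_lattice N D ?U (\<lambda>j. if j < N then x j else 0)"
          using 8(3) by (intro pair_lattice_end[symmetric]) auto
        also have "\<dots> \<longleftrightarrow> pair_lattice N D ?V (\<lambda>j. if j < N then x j else 0)" using 8(3) by blast
        finally show ?case using start by simp
      qed
    qed (use r2 X W in auto)
  qed
qed

text \<open>
  Initially the unit vectors generate everything; each column then imposes its congruence.
\<close>

definition Reduce :: com where
  "Reduce = Seq SetModulus (Seq InitRows (For rk rD Column))"

lemma Reduce_simps [simp]:
  "wregs Reduce = {rmod, rk, rs, rj, racc, rq, rtmp}" "warrs Reduce = {aV}" "\<not> reads Reduce" "\<not> writes Reduce"
  by (auto simp: Reduce_def)

lemma (in run) wp_Reduce: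
  fixes s d W N
  defines "T \<equiv> tab d (mem s aT)" and "D \<equiv> \<bar>reg s rdelta\<bar>"
  assumes regs: "reg s rN = int N" "reg s rW = int W" "reg s rD = int d" and V0: "\<And>i. mem s aV i = 0"
    and W: "W = Suc N" and D: "D > 0" "D + D * D \<le> 2 ^ K" "D * D < 2 ^ L" and X: "W \<le> X" "Suc L \<le> X" "d \<le> X"
    and bound: "\<And>k. k < d \<Longrightarrow> (\<Sum>j<N. D * \<bar>T j k\<bar>) \<le> 2 ^ K"
    and post: "\<And>s'. frame Reduce s s' \<Longrightarrow>
      (\<And>r j. r < 2 * N \<Longrightarrow> j < N \<Longrightarrow> \<bar>tab W (mem s' aV) (Suc r) j\<bar> \<le> D) \<Longrightarrow>
      (\<And>r j. r < N \<Longrightarrow> j < N \<Longrightarrow> tab W (mem s' aV) (Suc (N + r)) j = (if r = j then D else 0)) \<Longrightarrow>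
      (\<And>x. row_span_mod N D (tab W (mem s' aV)) x \<longleftrightarrow> (\<forall>k<d. D dvd (\<Sum>j<N. x j * T j k))) \<Longrightarrow> Q s'"
  shows "wp Reduce Q s"
  unfolding Reduce_def
proof (rule wp_Seq, rule wp_SetModulus, goal_cases)
  case (1 s1)
  have NW: "N < W" using W by simp
  have r1: "reg s1 rN = int N" "reg s1 rW = int W" "reg s1 rmod = D" "reg s1 rD = int d"
    and V1: "mem s1 aV i = 0" for i
    using regs 1 V0 by (simp_all add: frame_def D_def)
  show ?case
  proof (rule wp_Seq, rule wp_InitRows[OF r1(1-3) W _ V1], goal_cases)
    case 1 then show ?case using X W by simp
  next
    case (2 s2)
    have r2: "reg s2 rN = int N" "reg s2 rW = int W" "reg s2 rD = int d" "reg s2 rmod = D" "mem s2 aT = mem s aT"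
      using r1 2(1) \<open>frame SetModulus s s1\<close> by (simp_all add: frame_def)
    let ?J = "\<lambda>k s'. (\<forall>r<N. \<forall>j<N. 0 \<le> tab W (mem s' aV) (Suc r) j \<and> tab W (mem s' aV) (Suc r) j \<le> D)
      \<and> (\<forall>r<N. \<forall>j<N. tab W (mem s' aV) (Suc (N + r)) j = (if r = j then D else 0))
      \<and> (\<forall>x. row_span_mod N D (tab W (mem s' aV)) x \<longleftrightarrow> (\<forall>k'<k. D dvd (\<Sum>j<N. x j * T j k')))"
    show ?case
    proof (rule wp_For[where cnt = d and J = ?J], goal_cases)
      case 6
      have "row_span_mod N D (tab W (mem s2 aV)) x" for x
        by (rule row_span_mod_id) (use 2(2) NW in simp)
      then show ?case using 2(2,3) D NW by simp
    next
      case (7 k s')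
      let ?V = "tab W (mem s' aV)"
      have r': "reg s' rN = int N" "reg s' rW = int W" "reg s' rD = int d" "reg s' rk = int k" "reg s' rmod = D"
        and T': "mem s' aT = mem s aT"
        using 7(2,3) r2 by (simp_all add: frame_def)
      have V: "0 \<le> ?V (Suc r) j \<and> ?V (Suc r) j \<le> D" if "r < N" "j < N" for r j using 7(4) that by blast
      show ?case
      proof (rule wp_Column[OF r' W D X(1,2)], goal_cases)
        case (1 r)
        have "(\<Sum>j<N. \<bar>?V (Suc r) j * T j k\<bar>) \<le> (\<Sum>j<N. D * \<bar>T j k\<bar>)"
          unfolding abs_mult using V[OF 1] by (intro sum_mono mult_right_mono) auto
        then show ?case using bound[OF 7(1)] by (simp add: T' T_def)
      next
        case (2 r j) then show ?case by (rule V)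
      next
        case (3 s'')
        have "row_span_mod N D (tab W (mem s'' aV)) x \<longleftrightarrow> (\<forall>k'<Suc k. D dvd (\<Sum>j<N. x j * T j k'))" for x
        proof -
          have "row_span_mod N D ?V x \<longleftrightarrow> (\<forall>k'<k. D dvd (\<Sum>j<N. x j * T j k'))" using 7(4) by blast
          then show ?thesis unfolding 3(4) T' T_def[symmetric] All_less_Suc by (simp only: conj_commute)
        qed
        moreover have "tab W (mem s'' aV) (Suc (N + r)) j = (if r = j then D else 0)" if "r < N" "j < N" for r j
          using 3(3)[of "Suc (N + r)" j] 7(4) that by simp
        ultimately show ?case using 3(2) by simp
      qed
    next
      case (8 s')
      let ?V = "tab W (mem s' aV)"
      show ?case
      proof (rule post, goal_cases)
        case 1 then show ?case using \<open>frame SetModulus s s1\<close> 2(1) 8(1) by (auto simp: frame_def)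
      next
        case (2 r j)
        show ?case
        proof (cases "r < N")
          case True then show ?thesis using 8(3) 2 by simp
        next
          case False
          then have "r - N < N" using 2 by simp
          then have "?V (Suc (N + (r - N))) j = (if r - N = j then D else 0)" using 8(3) 2(2) by blast
          then show ?thesis using False D by simp
        qed
      next
        case (3 r j) then show ?case using 8(3) by blast
      next
        case (4 x) then show ?case using 8(3) by blast
      qed
    qed (use r2 X in auto)
  qed
qed

definition CopyRow :: com where
  "CopyRow = For rj rN (Store aU (Reg rj) (Load aV (Cell (Add (Reg rs) (Const 1)) rW (Reg rj))))"

lemma CopyRow_simps [simp]:
  "wregs CopyRow = {rj}" "warrs CopyRow = {aU}" "\<not> reads CopyRow" "\<not> writes CopyRow"
  by (auto simp: CopyRow_def)

lemma (in run) wp_CopyRow: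
  assumes regs: "reg s rN = int N" "reg s rW = int W" "reg s rs = int r" and X: "N \<le> X"
    and post: "\<And>s'. frame CopyRow s s' \<Longrightarrow> (\<And>j. j < N \<Longrightarrow> mem s' aU j = tab W (mem s aV) (Suc r) j) \<Longrightarrow> Q s'"
  shows "wp CopyRow Q s"
  unfolding CopyRow_def
proof (rule wp_For[where cnt = N and J = "\<lambda>i s'. \<forall>j<i. mem s' aU j = tab W (mem s aV) (Suc r) j"], goal_cases)
  case (7 i s')
  then have r': "reg s' rW = int W" "reg s' rs = int r" "reg s' rj = int i" "mem s' aV = mem s aV"
    using regs by (simp_all add: frame_def)
  show ?case
  proof (rule wp_Store, goal_cases)
    case 1 then show ?case using mem_bound[OF 1, of aV] by simp
  next
    case 2 show ?case using 7(4) by (auto simp: r' tab_def less_Suc_eq simp del: mult_Suc)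
  qed
next
  case (8 s')
  then show ?case by (intro post) (auto simp: CopyRow_def)
qed (use regs X in auto)

definition CorrectRow :: com where
  "CorrectRow = For rk rD (Cond (Load aP (Reg rk))
     (Seq Dot (Store aU (Sub (Load aP (Reg rk)) (Const 1))
       (Sub (Load aU (Sub (Load aP (Reg rk)) (Const 1))) (Div (Reg racc) (Reg rdelta))))) Skip)"

lemma CorrectRow_simps [simp]:
  "wregs CorrectRow = {rk, rj, racc}" "warrs CorrectRow = {aU}" "\<not> reads CorrectRow" "\<not> writes CorrectRow"
  by (auto simp: CorrectRow_def)

lemma (in run) wp_CorrectRow:
  fixes s d W N r
  defines "V \<equiv> tab W (mem s aV)" and "T \<equiv> tab d (mem s aT)"
  assumes regs: "reg s rN = int N" "reg s rW = int W" "reg s rD = int d" "reg s rs = int r" and X: "N \<le> X" "d \<le> X"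
    and dot: "\<And>k. k < d \<Longrightarrow> (\<Sum>j<N. \<bar>V (Suc r) j * T j k\<bar>) \<le> S"
    and V: "\<And>j. j < N \<Longrightarrow> \<bar>V (Suc r) j\<bar> \<le> D" and S: "D + int d * S \<le> 2 ^ K" "S \<ge> 0" "D \<ge> 0" "d > 0"
    and U: "\<And>j. j < N \<Longrightarrow> mem s aU j = V (Suc r) j" and piv: "\<And>k. k < d \<Longrightarrow> nat (mem s aP k) \<le> N"
    and post: "\<And>s'. frame CorrectRow s s' \<Longrightarrow>
      (\<And>i. i < N \<Longrightarrow> mem s' aU i = correct N d T (reg s rdelta) (\<lambda>k. nat (mem s aP k)) (V (Suc r)) i) \<Longrightarrow> Q s'"
  shows "wp CorrectRow Q s"
proof -
  let ?w = "\<lambda>k. \<Sum>j<N. V (Suc r) j * T j k"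
  \<comment> \<open>the output row when the first \<open>l\<close> columns have been treated\<close>
  define p where "p l i = V (Suc r) i - (\<Sum>k<l. if nat (mem s aP k) = Suc i then ?w k div reg s rdelta else 0)" for l i
  have w: "\<bar>?w k\<bar> \<le> S" if "k < d" for k
    using sum_abs[of "\<lambda>j. V (Suc r) j * T j k" "{..<N}"] dot[OF that] by linarith
  have dS: "S \<le> 2 ^ K"
  proof -
    have "1 * S \<le> int d * S" using S by (intro mult_right_mono) auto
    then show ?thesis using S by linarith
  qed
  have p: "\<bar>p l i\<bar> \<le> 2 ^ K" if "l \<le> d" "i < N" for l i
  proof -
    have "\<bar>\<Sum>k<l. if nat (mem s aP k) = Suc i then ?w k div reg s rdelta else 0\<bar> \<le> (\<Sum>k<l. S)"
      using that S by (intro order_trans[OF sum_abs] sum_mono) (auto intro: order_trans[OF abs_div_le w])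
    also have "\<dots> \<le> int d * S" using that S by (simp add: mult_right_mono)
    finally show ?thesis using V[OF that(2)] S by (simp add: p_def)
  qed
  show ?thesis unfolding CorrectRow_def
  proof (rule wp_For[where cnt = d and J = "\<lambda>l s'. \<forall>i<N. mem s' aU i = p l i"], goal_cases)
    case (7 k s')
    then have r': "reg s' rN = int N" "reg s' rW = int W" "reg s' rD = int d" "reg s' rs = int r" "reg s' rk = int k"
      and m': "mem s' aV = mem s aV" "mem s' aT = mem s aT" "mem s' aP = mem s aP" "reg s' rdelta = reg s rdelta"
      using regs by (simp_all add: frame_def)
    show ?case
    proof (rule wp_Cond, goal_cases)
      case 1
      then have pos: "mem s aP k > 0" by (simp add: r' m')
      then obtain i where i: "nat (mem s aP k) = Suc i" by (cases "nat (mem s aP k)") auto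
      then have Pk: "mem s aP k = int (Suc i)" using pos by linarith
      have iN: "i < N" using piv[OF 7(1)] i by simp
      show ?case
      proof (rule wp_Seq, rule wp_Dot[OF r' X(1)], goal_cases)
        case 1
        show ?case using order_trans[OF dot[OF 7(1)] dS] by (simp add: m' V_def T_def)
      next
        case (2 s'')
        then have r'': "reg s'' racc = ?w k" "reg s'' rdelta = reg s rdelta" "reg s'' rk = int k" "mem s'' aP = mem s aP"
          "mem s'' aU = mem s' aU"
          using r' m' by (simp_all add: frame_def V_def T_def)
        have pS: "p (Suc k) i' = p k i' - (if i' = i then ?w k div reg s rdelta else 0)" for i'
          using i by (auto simp: p_def)
        show ?case
          using p[of "Suc k" i] 7(1,4) iN
          by (intro wp_Store) (auto simp: r'' Pk pS)
      qed
    next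
      case 2
      then have "nat (mem s aP k) = 0" by (simp add: r' m')
      then have "p (Suc k) i = p k i" for i by (simp add: p_def)
      then show ?case using 7(4) by (intro wp_Skip) simp
    qed
  next
    case 6 show ?case using U by (simp add: p_def)
  next
    case (8 s')
    then show ?case by (intro post) (auto simp: CorrectRow_def p_def correct_def)
  qed (use regs X in auto)
qed

definition WriteRow :: com where
  "WriteRow = For rj rPD (Write (Load aU (Add (Reg rM) (Reg rj))))"

lemma WriteRow_simps [simp]:
  "wregs WriteRow = {rj}" "warrs WriteRow = {}" "\<not> reads WriteRow" "writes WriteRow"
  by (auto simp: WriteRow_def)

lemma (in run) wp_WriteRow:
  assumes regs: "reg s rPD = int pd" "reg s rM = int m" and X: "pd \<le> X"
    and post: "\<And>s'. frame WriteRow s s' \<Longrightarrow> outp s' = outp s @ map (\<lambda>j. mem s aU (m + j)) [0..<pd] \<Longrightarrow> Q s'"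
  shows "wp WriteRow Q s"
  unfolding WriteRow_def
proof (rule wp_For[where cnt = pd and J = "\<lambda>i s'. outp s' = outp s @ map (\<lambda>j. mem s aU (m + j)) [0..<i]"], goal_cases)
  case (7 i s')
  then have r': "reg s' rM = int m" "reg s' rj = int i" "mem s' aU = mem s aU"
    using regs by (simp_all add: frame_def)
  have n: "nat (int m + int i) = m + i" by simp
  show ?case by (intro wp_Write) (simp add: r' n 7(4))
next
  case (8 s')
  then show ?case by (intro post) (auto simp: WriteRow_def)
qed (use regs X in auto)

definition Output :: com where
  "Output = Seq (Write (Reg rNN)) (For rs rNN (Seq CopyRow (Seq CorrectRow WriteRow)))"

lemma Output_simps [simp]:
  "wregs Output = {rs, rk, rj, racc}" "warrs Output = {aU}" "\<not> reads Output" "writes Output"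
  by (auto simp: Output_def)

lemma (in run) wp_Output:
  fixes s d W N
  defines "V \<equiv> tab W (mem s aV)" and "T \<equiv> tab d (mem s aT)"
  assumes regs: "reg s rN = int N" "reg s rW = int W" "reg s rD = int d" "reg s rNN = int NN" "reg s rM = int m" "reg s rPD = int pd"
    and X: "N \<le> X" "d \<le> X" "NN \<le> X" "pd \<le> X" and N: "N = m + pd" and NN: "NN = 2 * N"
    and dot: "\<And>r k. r < NN \<Longrightarrow> k < d \<Longrightarrow> (\<Sum>j<N. \<bar>V (Suc r) j * T j k\<bar>) \<le> S"
    and V: "\<And>r j. r < NN \<Longrightarrow> j < N \<Longrightarrow> \<bar>V (Suc r) j\<bar> \<le> D" and S: "D + int d * S \<le> 2 ^ K" "S \<ge> 0" "D \<ge> 0" "d > 0"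
    and piv: "\<And>k. k < d \<Longrightarrow> nat (mem s aP k) \<le> N"
    and post: "\<And>s'. outp s' = outp s @ int NN # concat (map (\<lambda>r. map (\<lambda>j.
        correct N d T (reg s rdelta) (\<lambda>k. nat (mem s aP k)) (V (Suc r)) (m + j)) [0..<pd]) [0..<NN]) \<Longrightarrow> Q s'"
  shows "wp Output Q s"
  unfolding Output_def
proof (intro wp_Seq wp_Write, goal_cases)
  case 1
  let ?row = "\<lambda>r. map (\<lambda>j. correct N d T (reg s rdelta) (\<lambda>k. nat (mem s aP k)) (V (Suc r)) (m + j)) [0..<pd]"
  show ?case
  proof (rule wp_For[where cnt = NN and J = "\<lambda>i s'. outp s' = outp s @ int NN # concat (map ?row [0..<i])"], goal_cases)
    case (7 r s')
    then have r': "reg s' rN = int N" "reg s' rW = int W" "reg s' rD = int d" "reg s' rs = int r" "reg s' rM = int m" "reg s' rPD = int pd"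
      and m': "mem s' aV = mem s aV" "mem s' aT = mem s aT" "mem s' aP = mem s aP" "reg s' rdelta = reg s rdelta"
      using regs by (simp_all add: frame_def)
    show ?case
    proof (rule wp_Seq, rule wp_CopyRow[OF r'(1,2,4) X(1)], goal_cases)
      case (1 s1)
      then have r1: "reg s1 rN = int N" "reg s1 rW = int W" "reg s1 rD = int d" "reg s1 rs = int r" "reg s1 rM = int m" "reg s1 rPD = int pd"
        and m1: "mem s1 aV = mem s aV" "mem s1 aT = mem s aT" "mem s1 aP = mem s aP" "reg s1 rdelta = reg s rdelta" "outp s1 = outp s'"
        using r' m' by (simp_all add: frame_def)
      show ?case
      proof (rule wp_Seq, rule wp_CorrectRow[OF r1(1-4) X(1,2) _ _ S], goal_cases)
        case (1 k) then show ?case using dot[OF 7(1)] by (simp add: m1 V_def T_def)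
      next
        case (2 j) then show ?case using V[OF 7(1)] by (simp add: m1 V_def)
      next
        case (3 j) then show ?case using \<open>\<And>j. j < N \<Longrightarrow> mem s1 aU j = _ j\<close> by (simp add: m1 m')
      next
        case (4 k) then show ?case using piv by (simp add: m1)
      next
        case (5 s2)
        then have r2: "reg s2 rPD = int pd" "reg s2 rM = int m" "outp s2 = outp s'"
          using r1 m1 by (simp_all add: frame_def)
        have row: "map (\<lambda>j. mem s2 aU (m + j)) [0..<pd] = ?row r"
          using 5(2) N by (simp add: m1 V_def T_def)
        show ?case
        proof (rule wp_WriteRow[OF r2(1,2) X(4)], unfold row, goal_cases)
          case (1 s3)
          then show ?case using 7(4) r2 by simp
        qed
      qed
    qed
  next
    case (8 s')
    then show ?case by (intro post) auto
  qed (use regs X in auto)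
qed

section \<open>The whole program\<close>

definition Setup :: com where
  "Setup = Seq (Read rD) (Seq (Read rM) (Seq (Read rP)
     (Seq (Assign rD (Add (Reg rD) (Const 1)))
     (Seq (Assign rMD (Mul (Reg rM) (Reg rD)))
     (Seq (Assign rDDD (Mul (Reg rD) (Mul (Reg rD) (Reg rD))))
     (Seq (Assign rPD (Mul (Reg rP) (Reg rD)))
     (Seq (Assign rN (Add (Reg rM) (Reg rPD)))
     (Seq (Assign rW (Add (Reg rN) (Const 1)))
          (Assign rNN (Add (Reg rN) (Reg rN)))))))))))"

lemma Setup_simps [simp]:
  "wregs Setup = {rD, rM, rP, rMD, rDDD, rPD, rN, rW, rNN}" "warrs Setup = {}" "reads Setup" "\<not> writes Setup"
  by (auto simp: Setup_def)

definition program :: com where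
  "program = Seq Setup (Seq (ReadArray aT rMD) (Seq (ReadArray aC rDDD) (Seq (ReadArray aB rPD)
     (Seq MakeRows (Seq Gauss (Seq Reduce Output))))))"

lemma (in run) wp_Setup:
  assumes inp: "inp s = int n # int m # int p # rest" and d: "d = Suc n" and N: "N = m + p * d"
    and b: "int d \<le> 2 ^ K" "int (m * d) \<le> 2 ^ K" "int (d * (d * d)) \<le> 2 ^ K" "int (p * d) \<le> 2 ^ K" "int (Suc N) \<le> 2 ^ K" "int (2 * N) \<le> 2 ^ K"
    and post: "\<And>s'. frame Setup s s' \<Longrightarrow> inp s' = rest \<Longrightarrow> reg s' rD = int d \<Longrightarrow> reg s' rM = int m \<Longrightarrow> reg s' rMD = int (m * d) \<Longrightarrow>
      reg s' rDDD = int (d * (d * d)) \<Longrightarrow> reg s' rPD = int (p * d) \<Longrightarrow> reg s' rN = int N \<Longrightarrow> reg s' rW = int (Suc N) \<Longrightarrow> reg s' rNN = int (2 * N) \<Longrightarrow> Q s'"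
  shows "wp Setup Q s"
proof (rule wp_mono[where Q = "\<lambda>s'. inp s' = rest \<and> reg s' rD = int d \<and> reg s' rM = int m \<and> reg s' rMD = int (m * d) \<and>
      reg s' rDDD = int (d * (d * d)) \<and> reg s' rPD = int (p * d) \<and> reg s' rN = int N \<and> reg s' rW = int (Suc N) \<and> reg s' rNN = int (2 * N)"])
  have dn: "int n + 1 = int d" by (simp add: d)
  have Nn: "int m + int p * int d = int N" by (simp add: N)
  have W: "\<bar>int N + 1\<bar> \<le> 2 ^ K" "\<bar>int N + int N\<bar> \<le> 2 ^ K" "\<bar>int N\<bar> \<le> 2 ^ K" using b(5,6) by linarith+
  have b': "\<bar>int d\<bar> \<le> 2 ^ K" "\<bar>int m * int d\<bar> \<le> 2 ^ K" "\<bar>int d * (int d * int d)\<bar> \<le> 2 ^ K" "\<bar>int p * int d\<bar> \<le> 2 ^ K"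
    unfolding of_nat_mult[symmetric] abs_of_nat by (fact b)+
  show "wp Setup (\<lambda>s'. inp s' = rest \<and> reg s' rD = int d \<and> reg s' rM = int m \<and> reg s' rMD = int (m * d) \<and>
      reg s' rDDD = int (d * (d * d)) \<and> reg s' rPD = int (p * d) \<and> reg s' rN = int N \<and> reg s' rW = int (Suc N) \<and> reg s' rNN = int (2 * N)) s"
    unfolding Setup_def
    apply (rule wp_Seq, rule wp_Read[OF inp])
    apply (rule wp_Seq, rule wp_Read[where z = "int m" and zs = "int p # rest"], simp)
    apply (rule wp_Seq, rule wp_Read[where z = "int p" and zs = rest], simp)
    apply (rule wp_Seq, rule wp_Assign, use b' in \<open>simp add: dn\<close>, simp add: dn)
    apply (rule wp_Seq, rule wp_Assign, use b' in \<open>simp add: dn\<close>, simp)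
    apply (rule wp_Seq, rule wp_Assign, use b' in \<open>simp add: dn\<close>, simp)
    apply (rule wp_Seq, rule wp_Assign, use b' in \<open>simp add: dn\<close>, simp)
    apply (rule wp_Seq, rule wp_Assign, use W in \<open>simp add: Nn\<close>, simp add: Nn)
    apply (rule wp_Seq, rule wp_Assign, use W in \<open>simp\<close>, simp)
    apply (rule wp_Assign, use W in \<open>simp\<close>, simp)
    done
qed (use post in auto)

text \<open>
  Nested enumerations of input and output correspond to a single enumeration by addresses.
\<close>

lemma map_upt_flatten:
  "concat (map (\<lambda>i. map (f i) [0..<w]) [0..<h]) = map (\<lambda>u. f (u div w) (u mod w)) [0..<h * w]"
proof (induction h)
  case (Suc h)
  have "[0..<Suc h * w] = [0..<h * w] @ map (\<lambda>j. j + h * w) [0..<w]"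
    using upt_add_eq_append[of 0 "h * w" w] map_add_upt[of "h * w" w] by (simp add: add.commute)
  moreover have "map (f h) [0..<w] = map (\<lambda>u. f (u div w) (u mod w)) (map (\<lambda>j. j + h * w) [0..<w])"
    by simp
  ultimately show ?case using Suc by simp
qed simp

lemma encode_input_flat:
  assumes "d = Suc n"
  shows "encode_input n m A c p b = int n # int m # int p #
      map (\<lambda>u. A (u div d) (u mod d)) [0..<m * d]
    @ map (\<lambda>u. c (u div (d * d)) (u mod (d * d) div d) (u mod (d * d) mod d)) [0..<d * (d * d)]
    @ map (\<lambda>u. b (u div d) (u mod d)) [0..<p * d]"
proof -
  have n: "n + 1 = d" using assms by simp
  show ?thesis unfolding encode_input_def n
    by (simp only: map_upt_flatten append_Cons append_Nil)
qed

lemma encode_output_flat: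
  assumes "d = Suc n"
  shows "encode_output n p q (\<lambda>s k j. u s (m + (k * d + j))) = int q # concat (map (\<lambda>s. map (\<lambda>j. u s (m + j)) [0..<p * d]) [0..<q])"
proof -
  have n: "n + 1 = d" using assms by simp
  have "concat (map (\<lambda>k. map (\<lambda>j. u s (m + (k * d + j))) [0..<d]) [0..<p]) = map (\<lambda>j. u s (m + j)) [0..<p * d]" for s
    by (simp only: map_upt_flatten div_mult_mod_eq)
  then show ?thesis unfolding encode_output_def n by simp
qed

section \<open>Sizes of minors\<close>

lemma int_le_power2: "q \<le> r \<Longrightarrow> int q \<le> 2 ^ r"
proof -
  assume "q \<le> r"
  then have "(2 :: nat) ^ q \<le> 2 ^ r" by (intro power_increasing) auto
  then have "q \<le> 2 ^ r" using less_exp[of q] by linarith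
  then have "int q \<le> int (2 ^ r)" by (simp only: of_nat_le_iff)
  then show "int q \<le> 2 ^ r" by simp
qed

text \<open>
  The bound of the elimination for a matrix with entries below \<open>2 ^ (3 * Z)\<close>: such entries arise as sums
  of \<open>d\<close> products of two integers below \<open>2 ^ Z\<close>. The determinant dominates, with \<open>fact d \<le> d ^ d\<close>
  contributing \<open>Z\<^sup>2\<close> and the power of the entries \<open>3 * Z\<^sup>2\<close> to the exponent.
\<close>

lemma minor_size:
  fixes d Z :: nat
  assumes d: "d \<le> Z" and Z: "Z \<ge> 1"
  shows "(int (d * d) + 1) * 2 ^ (3 * Z) * 2 ^ (3 * Z) * (fact d * (2 ^ (3 * Z)) ^ d) \<le> 2 ^ (13 * Z\<^sup>2)"
proof -
  have dZ: "int d \<le> 2 ^ Z" using d by (rule int_le_power2)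
  have 1: "int (d * d) + 1 \<le> 2 ^ (2 * Z + 1)"
  proof -
    have "int d * int d \<le> 2 ^ Z * 2 ^ Z" using dZ by (intro mult_mono) auto
    then have "int (d * d) \<le> 2 ^ (2 * Z)" by (simp add: mult_2 power_add)
    moreover have "(1 :: int) \<le> 2 ^ (2 * Z)" by simp
    ultimately show ?thesis unfolding power_add power_one_right by linarith
  qed
  have "fact d \<le> int d ^ d" using fact_le_power[where n = d and ?'a = int] by simp
  also have "\<dots> \<le> (2 ^ Z) ^ d" using dZ by (intro power_mono) auto
  also have "\<dots> \<le> 2 ^ (Z * Z)" unfolding power_mult[symmetric] using d by (intro power_increasing) auto
  finally have 2: "(fact d :: int) \<le> 2 ^ (Z * Z)" .
  have 3: "((2 :: int) ^ (3 * Z)) ^ d \<le> 2 ^ (3 * Z * Z)"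
    unfolding power_mult[symmetric] using d by (intro power_increasing) auto
  have "(int (d * d) + 1) * 2 ^ (3 * Z) * 2 ^ (3 * Z) * (fact d * (2 ^ (3 * Z)) ^ d)
      \<le> 2 ^ (2 * Z + 1) * 2 ^ (3 * Z) * 2 ^ (3 * Z) * (2 ^ (Z * Z) * 2 ^ (3 * Z * Z))"
    using 1 2 3 by (intro mult_mono) auto
  also have "\<dots> = 2 ^ (8 * Z + 1 + 4 * (Z * Z))"
    unfolding power_add[symmetric] by (rule arg_cong[where f = "power 2"]) simp
  also have "\<dots> \<le> 2 ^ (13 * Z\<^sup>2)"
  proof (rule power_increasing)
    have "1 * Z \<le> Z * Z" by (rule mult_le_mono1[OF Z])
    moreover have "1 \<le> Z * Z" using Z by simp
    ultimately show "8 * Z + 1 + 4 * (Z * Z) \<le> 13 * Z\<^sup>2" unfolding power2_eq_square by linarith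
  qed simp
  finally show ?thesis .
qed

section \<open>Correctness and size bounds of the program\<close>

text \<open>
  The first \<open>m\<close> rows are the given relations between the generators. Row \<open>m + (k * d + j)\<close> is the
  coefficient vector of \<open>f\<^sub>k g\<^sub>j\<close>.
\<close>

definition relation_matrix :: "nat \<Rightarrow> nat \<Rightarrow> (nat \<Rightarrow> nat \<Rightarrow> int) \<Rightarrow> (nat \<Rightarrow> nat \<Rightarrow> nat \<Rightarrow> int) \<Rightarrow> (nat \<Rightarrow> nat \<Rightarrow> int) \<Rightarrow> nat \<Rightarrow> nat \<Rightarrow> int" where
  "relation_matrix d m A c b j l =
     (if j < m then A j l else (\<Sum>i<d. b ((j - m) div d) i * c i ((j - m) mod d) l))"

text \<open>
  All sizes are powers of 2 with exponents in units of \<open>Z\<^sup>2\<close>: the entries after the elimination need 13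
  units, products of two of them 26, sums of \<open>N \<le> 2 Z\<^sup>2\<close> such products 28, and the corrected
  coordinates, with \<open>d\<close> such sums, 29. Euclid's algorithm makes at most \<open>26 Z\<^sup>2 + 2\<close> iterations.
\<close>

lemma program_correct:
  fixes n m p Z :: nat
  defines "d \<equiv> Suc n"
  defines "N \<equiv> m + p * d"
  defines "X \<equiv> 60 * Z\<^sup>2" and "K \<equiv> 30 * Z\<^sup>2"
  assumes Z: "d * (d * d) \<le> Z" "m * d \<le> Z" "p * d \<le> Z"
    and A: "\<And>l k. l < m \<Longrightarrow> k < d \<Longrightarrow> \<bar>A l k\<bar> \<le> 2 ^ Z"
    and c: "\<And>i j k. i < d \<Longrightarrow> j < d \<Longrightarrow> k < d \<Longrightarrow> \<bar>c i j k\<bar> \<le> 2 ^ Z"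
    and b: "\<And>k j. k < p \<Longrightarrow> j < d \<Longrightarrow> \<bar>b k j\<bar> \<le> 2 ^ Z"
  shows "\<exists>t u. computes_in program (encode_input n m A c p b) t
        (encode_output n p (2 * N) (\<lambda>s k j. u s (m + (k * d + j))))
      \<and> t \<le> time_bound X program * K\<^sup>2
      \<and> (\<forall>x. (\<forall>l<d. (\<Sum>j<N. x j * relation_matrix d m A c b j l) = 0) \<longleftrightarrow>
              (\<exists>a. \<forall>i<N. x i = (\<Sum>s<2 * N. a s * u s i)))"
proof -
  define E :: int where "E = 2 ^ (3 * Z)"
  define G :: int where "G = (int (d * d) + 1) * E * E * (fact d * E ^ d)"
  let ?L = "26 * Z\<^sup>2 + 1"
  let ?B = "relation_matrix d m A c b"
  have d1: "d \<ge> 1" by (simp add: d_def)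
  have dd: "d * d \<ge> 1" using d1 by simp
  have dZ: "d \<le> Z" using mult_le_mono2[OF dd, of d] Z(1) by linarith
  have pZ: "p \<le> Z" using mult_le_mono2[OF d1, of p] Z(3) by linarith
  have Z1: "Z \<ge> 1" using d1 dZ by simp
  have mZ: "m \<le> Z" using mult_le_mono2[OF d1, of m] Z(2) by linarith
  have Z2: "Z \<le> Z\<^sup>2" "1 \<le> Z\<^sup>2" using Z1 by (simp_all add: power2_eq_square)
  have NZ: "N \<le> 2 * Z\<^sup>2" using mZ Z(3) Z2 by (simp add: N_def)
  note pw = int_le_power2
  have mono: "(2 :: int) ^ q \<le> 2 ^ r" if "q \<le> r" for q r :: nat
    using that by (intro power_increasing) auto
  have X: "d \<le> X" "p * d \<le> X" "m * d \<le> X" "d * (d * d) \<le> X" "N \<le> X" "Suc N \<le> X" "2 * N \<le> X" "Suc ?L \<le> X"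
    using dZ Z Z2 NZ by (simp_all add: X_def)
  have K1: "K \<ge> 1" using Z2 by (simp add: K_def)
  have bK: "int d \<le> 2 ^ K" "int (m * d) \<le> 2 ^ K" "int (d * (d * d)) \<le> 2 ^ K" "int (p * d) \<le> 2 ^ K" "int (Suc N) \<le> 2 ^ K" "int (2 * N) \<le> 2 ^ K"
    "int N \<le> 2 ^ K"
    by (rule pw; use dZ Z Z2 NZ in \<open>simp add: K_def\<close>)+
  have GZ: "G \<le> 2 ^ (13 * Z\<^sup>2)" unfolding G_def E_def by (rule minor_size[OF dZ Z1])
  have EZ: "E \<ge> 1" by (simp add: E_def)
  have sum_bc: "(\<Sum>i<d. \<bar>b (j div d) i * c i (j mod d) l\<bar>) \<le> E" if "j < p * d" "l < d" for j l
  proof -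
    have jd: "j div d < p" "j mod d < d" using that d1 by (auto simp: less_mult_imp_div_less)
    have "(\<Sum>i<d. \<bar>b (j div d) i * c i (j mod d) l\<bar>) \<le> (\<Sum>i<d. 2 ^ Z * 2 ^ Z)"
      using that jd b c by (intro sum_mono) (auto simp: abs_mult intro!: mult_mono)
    also have "\<dots> \<le> 2 ^ Z * (2 ^ Z * 2 ^ Z)" using pw[OF dZ] by simp
    also have "\<dots> = E" by (simp add: E_def power_add[symmetric])
    finally show ?thesis .
  qed
  have EK: "E \<le> 2 ^ K" unfolding E_def by (rule mono) (use Z2 in \<open>simp add: K_def\<close>)
  have BE: "\<bar>?B j l\<bar> \<le> E" if "j < N" "l < d" for j l
  proof (cases "j < m")
    case True
    have "(2 :: int) ^ Z \<le> E" unfolding E_def by (rule mono) simp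
    then show ?thesis using A[OF True that(2)] True by (simp add: relation_matrix_def)
  next
    case False
    then have "j - m < p * d" using that by (simp add: N_def)
    from order_trans[OF sum_abs sum_bc[OF this that(2)]] show ?thesis
      using False by (simp add: relation_matrix_def)
  qed
  interpret run X K by unfold_locales (rule K1)
  let ?inp = "encode_input n m A c p b"
  let ?fA = "\<lambda>u. A (u div d) (u mod d)"
  let ?fC = "\<lambda>u. c (u div (d * d)) (u mod (d * d) div d) (u mod (d * d) mod d)"
  let ?fB = "\<lambda>u. b (u div d) (u mod d)"
  have flat: "?inp = int n # int m # int p # map ?fA [0..<m * d] @ map ?fC [0..<d * (d * d)] @ map ?fB [0..<p * d]"
    by (rule encode_input_flat) (simp add: d_def)
  have ZK: "(2 :: int) ^ Z \<le> 2 ^ K" by (rule mono) (use Z2 in \<open>simp add: K_def\<close>)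
  have "\<bar>z\<bar> \<le> 2 ^ K" if "z \<in> set ?inp" for z
  proof -
    have "\<bar>A (u div d) (u mod d)\<bar> \<le> 2 ^ Z" if "u < m * d" for u
      using A that d1 by (simp add: less_mult_imp_div_less)
    moreover have "\<bar>b (u div d) (u mod d)\<bar> \<le> 2 ^ Z" if "u < p * d" for u
      using b that d1 by (simp add: less_mult_imp_div_less)
    moreover have "\<bar>?fC u\<bar> \<le> 2 ^ Z" if "u < d * (d * d)" for u
    proof (rule c)
      show "u div (d * d) < d" using that by (simp add: less_mult_imp_div_less)
      have "u mod (d * d) < d * d" using dd by simp
      then show "u mod (d * d) div d < d" by (simp add: less_mult_imp_div_less)
    qed (use d1 in simp)
    moreover have "\<bar>int n\<bar> \<le> 2 ^ Z" "\<bar>int m\<bar> \<le> 2 ^ Z" "\<bar>int p\<bar> \<le> 2 ^ Z"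
      using pw[of n Z] pw[of m Z] pw[of p Z] dZ mZ pZ by (simp_all add: d_def)
    ultimately have "\<bar>z\<bar> \<le> 2 ^ Z" using that unfolding flat by (auto simp del: of_nat_le_iff abs_of_nat)
    then show ?thesis using ZK by linarith
  qed
  then have bnd0: "bounded_by K (initial ?inp)" by (simp add: bounded_by_def initial_def)
  define good where "good ys \<longleftrightarrow> (\<exists>u. ys = encode_output n p (2 * N) (\<lambda>s k j. u s (m + (k * d + j)))
      \<and> (\<forall>x. (\<forall>l<d. (\<Sum>j<N. x j * ?B j l) = 0) \<longleftrightarrow> (\<exists>a. \<forall>i<N. x i = (\<Sum>s<2 * N. a s * u s i))))" for ys
  have "wp program (\<lambda>s'. good (outp s')) (initial ?inp)"
    unfolding program_def
  proof (rule wp_Seq, rule wp_Setup[where n = n and m = m and p = p and d = d and N = N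
      and rest = "map ?fA [0..<m * d] @ map ?fC [0..<d * (d * d)] @ map ?fB [0..<p * d]"], goal_cases)
    case 1 show ?case by (simp add: initial_def flat)
  next
    case (10 s1)
    have m1: "mem s1 a i = 0" "outp s1 = []" for a i using 10(1) by (simp_all add: frame_def initial_def)
    note r1 = 10(3-10)
    show ?case
    proof (rule wp_Seq, rule wp_ReadArray[OF 10(5) X(3) _ 10(2)], simp, goal_cases)
      case (1 s2)
      have r2: "reg s2 rD = int d" "reg s2 rM = int m" "reg s2 rDDD = int (d * (d * d))" "reg s2 rPD = int (p * d)" "reg s2 rN = int N"
          "reg s2 rW = int (Suc N)" "reg s2 rNN = int (2 * N)" and m2: "mem s2 aV i = 0" "outp s2 = []" for i
        using 1(1) r1 m1 by (simp_all add: frame_def)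
      show ?case
      proof (rule wp_Seq, rule wp_ReadArray[OF r2(3) X(4) _ 1(2)], simp, goal_cases)
        case (1 s3)
        have r3: "reg s3 rD = int d" "reg s3 rM = int m" "reg s3 rPD = int (p * d)" "reg s3 rN = int N"
            "reg s3 rW = int (Suc N)" "reg s3 rNN = int (2 * N)" and m3: "mem s3 aV i = 0" "outp s3 = []" "mem s3 aT = mem s2 aT" for i
          using 1(1) r2 m2 by (simp_all add: frame_def)
        have inp3: "inp s3 = map ?fB [0..<p * d] @ []" using 1(2) by simp
        show ?case
        proof (rule wp_Seq, rule wp_ReadArray[OF r3(3) X(2) _ inp3], simp, goal_cases)
          case (1 s4)
          have r4: "reg s4 rD = int d" "reg s4 rPD = int (p * d)" "reg s4 rM = int m" "reg s4 rN = int N"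
              "reg s4 rW = int (Suc N)" "reg s4 rNN = int (2 * N)" and m4: "mem s4 aV i = 0" "outp s4 = []" "mem s4 aT = mem s2 aT" "mem s4 aC = mem s3 aC" for i
            using 1(1) r3 m3 by (simp_all add: frame_def)
          have T4: "tab d (mem s4 aT) j l = A j l" if "j < m" "l < d" for j l
          proof -
            have "j * d + l < Suc j * d" using that by simp
            also have "\<dots> \<le> m * d" using that by (intro mult_le_mono) auto
            finally show ?thesis using \<open>\<And>i. i < m * d \<Longrightarrow> mem s2 aT i = _ i\<close> that by (simp add: tab_def m4)
          qed
          have B4: "mem s4 aB (u div d * d + i) = b (u div d) i" if "u < p * d" "i < d" for u i
          proof -
            have "u div d < p" using that by (simp add: less_mult_imp_div_less)
            have "u div d * d + i < Suc (u div d) * d" using that by simp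
            also have "\<dots> \<le> p * d" using \<open>u div d < p\<close> by (intro mult_le_mono) auto
            finally show ?thesis using 1(3) that by simp
          qed
          have C4: "mem s4 aC ((i * d + j) * d + l) = c i j l" if "i < d" "j < d" "l < d" for i j l
          proof -
            have jl: "j * d + l < d * d"
            proof -
              have "j * d + l < Suc j * d" using that by simp
              also have "\<dots> \<le> d * d" using that by (intro mult_le_mono) auto
              finally show ?thesis .
            qed
            have eq: "(i * d + j) * d + l = i * (d * d) + (j * d + l)" by (simp add: algebra_simps)
            have "i * (d * d) + (j * d + l) < Suc i * (d * d)" using jl by simp
            also have "\<dots> \<le> d * (d * d)" using that by (intro mult_le_mono) auto
            finally show ?thesis
              using \<open>\<And>i. i < d * (d * d) \<Longrightarrow> mem s3 aC i = _ i\<close>[of "i * (d * d) + (j * d + l)"] jl that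
              unfolding eq by (simp add: m4 div_mult_self3 del: mult_Suc)
          qed
          have prod: "mem s4 aB (u div d * d + i) * mem s4 aC ((i * d + u mod d) * d + l) = b (u div d) i * c i (u mod d) l"
            if "u < p * d" "l < d" "i < d" for u l i
            using that d1 by (simp add: B4 C4)
          show ?case
          proof (rule wp_Seq, rule wp_MakeRows[OF r4(1-3) X(1,2)], goal_cases)
            case (1 u l)
            then show ?case using sum_bc[OF 1] EK by (simp add: prod)
          next
            case (2 s5)
            have r5: "reg s5 rD = int d" "reg s5 rPD = int (p * d)" "reg s5 rM = int m" "reg s5 rN = int N"
                "reg s5 rW = int (Suc N)" "reg s5 rNN = int (2 * N)" and m5: "mem s5 aV i = 0" "outp s5 = []" for i
              using 2(1) r4 m4 by (simp_all add: frame_def)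
            have T5: "tab d (mem s5 aT) j l = ?B j l" if "j < N" "l < d" for j l
            proof (cases "j < m")
              case True
              moreover have "j < m + p * d" using that by (simp add: N_def)
              ultimately show ?thesis using 2(2)[of j l] that(2) T4 by (simp add: relation_matrix_def)
            next
              case False
              then have "j - m < p * d" using that by (simp add: N_def)
              note jm = this
              have "j < m + p * d" using that by (simp add: N_def)
              then have "tab d (mem s5 aT) j l = (\<Sum>i<d. mem s4 aB ((j - m) div d * d + i) * mem s4 aC ((i * d + (j - m) mod d) * d + l))"
                using False 2(2)[of j l] that(2) by simp
              also have "\<dots> = ?B j l"
                unfolding relation_matrix_def using False jm that(2) by (simp add: prod)
              finally show ?thesis .
            qed
            have BE5: "\<bar>tab d (mem s5 aT) j l\<bar> \<le> E" if "j < N" "l < d" for j l using BE that T5 by simp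
            have GK: "G \<le> 2 ^ K" by (rule order_trans[OF GZ mono]) (simp add: K_def)
            show ?case
            proof (rule wp_Seq, rule wp_Gauss[OF r5(1,4) X(5,1) bK(7) EZ BE5], simp, simp, fold G_def, rule GK, goal_cases)
              case (1 s6)
              let ?T = "tab d (mem s6 aT)" and ?\<delta> = "reg s6 rdelta" and ?piv = "\<lambda>k. nat (mem s6 aP k)"
              note ech = 1(2)
              have r6: "reg s6 rD = int d" "reg s6 rPD = int (p * d)" "reg s6 rM = int m" "reg s6 rN = int N"
                  "reg s6 rW = int (Suc N)" "reg s6 rNN = int (2 * N)" and m6: "mem s6 aV i = 0" "outp s6 = []" for i
                using 1(1) r5 m5 by (simp_all add: frame_def)
              have \<delta>: "\<bar>?\<delta>\<bar> > 0" using ech by (simp add: echelon_def)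
              define D where "D = \<bar>?\<delta>\<bar>"
              define S where "S = int N * (2 ^ (13 * Z\<^sup>2) * 2 ^ (13 * Z\<^sup>2))"
              have DG: "D \<le> 2 ^ (13 * Z\<^sup>2)" using 1(3) GZ by (simp add: D_def)
              have TG: "\<bar>?T j k\<bar> \<le> 2 ^ (13 * Z\<^sup>2)" if "j < N" "k < d" for j k using 1(4)[OF that] GZ by simp
              have pp: "(2 :: int) ^ (13 * Z\<^sup>2) * 2 ^ (13 * Z\<^sup>2) = 2 ^ (26 * Z\<^sup>2)" by (simp add: power_add[symmetric])
              have DD: "D * D \<le> 2 ^ (26 * Z\<^sup>2)"
                unfolding pp[symmetric] using DG by (intro mult_mono) (auto simp: D_def)
              have DDL: "D * D < 2 ^ ?L"
                using DD by (rule order_le_less_trans) simp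
              have DDK: "D + D * D \<le> 2 ^ K"
              proof -
                have "D \<le> 2 ^ (26 * Z\<^sup>2)" by (rule order_trans[OF DG mono]) simp
                then have "D + D * D \<le> 2 ^ ?L" using DD by simp
                also have "\<dots> \<le> 2 ^ K" by (rule mono) (use Z2 in \<open>simp add: K_def\<close>)
                finally show ?thesis .
              qed
              have S0: "S \<ge> 0" by (simp add: S_def)
              have Spow: "S \<le> 2 ^ (28 * Z\<^sup>2)"
              proof -
                have "S \<le> 2 ^ (2 * Z\<^sup>2) * 2 ^ (26 * Z\<^sup>2)" unfolding S_def pp using pw[OF NZ] by (intro mult_right_mono) auto
                then show ?thesis by (simp add: power_add[symmetric])
              qed
              have SK: "S \<le> 2 ^ K" by (rule order_trans[OF Spow mono]) (simp add: K_def)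
              have DSK: "D + int d * S \<le> 2 ^ K"
              proof -
                have "int d * S \<le> 2 ^ (Z\<^sup>2) * 2 ^ (28 * Z\<^sup>2)"
                  using pw[of d "Z\<^sup>2"] dZ Z2 Spow S0 by (intro mult_mono) auto
                also have "\<dots> = 2 ^ (29 * Z\<^sup>2)" by (simp add: power_add[symmetric])
                finally have "int d * S \<le> 2 ^ (29 * Z\<^sup>2)" .
                moreover have "D \<le> 2 ^ (29 * Z\<^sup>2)" by (rule order_trans[OF DG mono]) simp
                ultimately have "D + int d * S \<le> 2 ^ (29 * Z\<^sup>2 + 1)" by simp
                also have "\<dots> \<le> 2 ^ K" by (rule mono) (use Z2 in \<open>simp add: K_def\<close>)
                finally show ?thesis .
              qed
              have DT: "(\<Sum>j<N. D * \<bar>?T j k\<bar>) \<le> S" if "k < d" for k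
              proof -
                have "(\<Sum>j<N. D * \<bar>?T j k\<bar>) \<le> (\<Sum>j<N. 2 ^ (13 * Z\<^sup>2) * 2 ^ (13 * Z\<^sup>2))"
                  using DG TG that by (intro sum_mono mult_mono) (auto simp: D_def)
                then show ?thesis by (simp add: S_def)
              qed
              show ?case
              proof (rule wp_Seq, rule wp_Reduce[where L = ?L, OF r6(4,5,1) m6(1) refl, folded D_def], goal_cases)
                case 1 show ?case using \<delta> by (simp add: D_def)
              next
                case 2 show ?case by (rule DDK)
              next
                case 3 show ?case by (rule DDL)
              next
                case 4 show ?case by (rule X(6))
              next
                case 5 show ?case by (rule X(8))
              next
                case 6 show ?case by (rule X(1))
              next
                case (7 k) then show ?case using DT SK by fastforce
              next
                case (8 s7)
                let ?V = "tab (Suc N) (mem s7 aV)"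
                have r7: "reg s7 rN = int N" "reg s7 rW = int (Suc N)" "reg s7 rD = int d" "reg s7 rNN = int (2 * N)" "reg s7 rM = int m" "reg s7 rPD = int (p * d)"
                  and m7: "mem s7 aT = mem s6 aT" "reg s7 rdelta = ?\<delta>" "mem s7 aP = mem s6 aP" "outp s7 = []"
                  using 8(1) r6 m6 by (simp_all add: frame_def)
                show ?case
                proof (rule wp_Output[OF r7 X(5,1,7,2) N_def[THEN meta_eq_to_obj_eq] refl, where S = S and D = D, unfolded m7], goal_cases)
                  case (1 r k)
                  have "(\<Sum>j<N. \<bar>?V (Suc r) j * ?T j k\<bar>) \<le> (\<Sum>j<N. D * \<bar>?T j k\<bar>)"
                    unfolding abs_mult using 8(2)[OF 1(1)] by (intro sum_mono mult_right_mono) auto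
                  then show ?case using DT[OF 1(2)] by simp
                next
                  case (2 r j) then show ?case using 8(2) by simp
                next
                  case 3 show ?case by (rule DSK)
                next
                  case 4 show ?case by (rule S0)
                next
                  case 5 show ?case by (simp add: D_def)
                next
                  case 6 show ?case using d1 by simp
                next
                  case (7 k)
                  then have "case ?piv k of 0 \<Rightarrow> \<forall>j<N. ?T j k = 0
                      | Suc i \<Rightarrow> i < N \<and> (\<forall>l<d. ?T i l = (if l = k then ?\<delta> else 0))"
                    using ech unfolding echelon_def by blast
                  then show ?case by (cases "?piv k") simp_all
                next
                  case (8 s8)
                  let ?u = "\<lambda>r. correct N d ?T ?\<delta> ?piv (?V (Suc r))"
                  have gen: "(\<forall>l<d. (\<Sum>j<N. x j * tab d (mem s5 aT) j l) = 0) \<longleftrightarrow> (\<exists>a. \<forall>i<N. x i = (\<Sum>s<2 * N. a s * ?u s i))" for x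
                    by (rule kernel_generators[OF ech])
                      (use \<open>\<And>x. row_span_mod N D ?V x \<longleftrightarrow> _ x\<close> \<open>\<And>r j. r < N \<Longrightarrow> j < N \<Longrightarrow> ?V (Suc (N + r)) j = _ r j\<close> in \<open>auto simp: D_def\<close>)
                  have 1: "(\<forall>l<d. (\<Sum>j<N. x j * ?B j l) = 0) \<longleftrightarrow> (\<exists>a. \<forall>i<N. x i = (\<Sum>s<2 * N. a s * ?u s i))" for x
                    unfolding gen[symmetric] by (simp add: T5)
                  have 2: "outp s8 = encode_output n p (2 * N) (\<lambda>s k j. ?u s (m + (k * d + j)))"
                    using 8 by (subst encode_output_flat) (simp_all add: d_def)
                  show ?case unfolding good_def by (rule exI[of _ ?u], intro conjI allI) (rule 2, rule 1)
                qed
              qed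
            qed
          qed
        qed
      qed
    qed
  qed (use d_def N_def bK in auto)
  then obtain t s' where *: "exec program (initial ?inp) t s'" "t \<le> time_bound X program * K\<^sup>2" "good (outp s')"
    using bnd0 unfolding wp_def by blast
  from *(3) obtain u where u: "outp s' = encode_output n p (2 * N) (\<lambda>s k j. u s (m + (k * d + j)))"
      "\<forall>x. (\<forall>l<d. (\<Sum>j<N. x j * ?B j l) = 0) \<longleftrightarrow> (\<exists>a. \<forall>i<N. x i = (\<Sum>s<2 * N. a s * u s i))"
    unfolding good_def by blast
  show ?thesis
    by (rule exI[of _ t], rule exI[of _ u]) (use * u in \<open>auto simp: computes_in_def\<close>)
qed

section \<open>Linear equations over the algebra\<close>

context cring
begin

lemma int_pow_add_distrib: "x \<in> carrier R \<Longrightarrow> y \<in> carrier R \<Longrightarrow> [(k :: int)] \<cdot> (x \<oplus> y) = [k] \<cdot> x \<oplus> [k] \<cdot> y"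
  using comm_group.int_pow_distrib[OF a_comm_group, of x y k] by (simp add: add_pow_def)

lemma int_pow_add: "x \<in> carrier R \<Longrightarrow> [(i + j :: int)] \<cdot> x = [i] \<cdot> x \<oplus> [j] \<cdot> x"
  using group.int_pow_mult[OF a_group, of x i j] by (simp add: add_pow_def)

lemma int_pow_times: "x \<in> carrier R \<Longrightarrow> [(i * j :: int)] \<cdot> x = [i] \<cdot> ([j] \<cdot> x)"
  using group.int_pow_pow[OF a_group, of x j i] by (simp add: add_pow_def mult.commute)

lemma int_pow_zero: "x \<in> carrier R \<Longrightarrow> [(0 :: int)] \<cdot> x = \<zero>"
  by (simp add: add_pow_def)

lemma finsum_int_pow:
  "finite S \<Longrightarrow> f \<in> S \<rightarrow> carrier R \<Longrightarrow> [(k :: int)] \<cdot> (\<Oplus>s\<in>S. f s) = (\<Oplus>s\<in>S. [k] \<cdot> f s)"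
  by (induction S rule: finite_induct) (simp_all add: int_pow_add_distrib Pi_iff)

lemma finsum_swap:
  assumes "finite S" "finite T" "\<And>s t. s \<in> S \<Longrightarrow> t \<in> T \<Longrightarrow> f s t \<in> carrier R"
  shows "(\<Oplus>s\<in>S. \<Oplus>t\<in>T. f s t) = (\<Oplus>t\<in>T. \<Oplus>s\<in>S. f s t)"
  using assms(1,3)
proof (induction S rule: finite_induct)
  case empty
  then show ?case by simp
next
  case (insert s S)
  have c: "(\<lambda>s. \<Oplus>t\<in>T. f s t) \<in> S \<rightarrow> carrier R" "(\<Oplus>t\<in>T. f s t) \<in> carrier R"
    using insert.prems by (auto intro!: finsum_closed)
  have "(\<Oplus>s\<in>insert s S. \<Oplus>t\<in>T. f s t) = (\<Oplus>t\<in>T. f s t) \<oplus> (\<Oplus>s\<in>S. \<Oplus>t\<in>T. f s t)"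
    using insert.hyps c by simp
  also have "(\<Oplus>s\<in>S. \<Oplus>t\<in>T. f s t) = (\<Oplus>t\<in>T. \<Oplus>s\<in>S. f s t)"
    using insert by simp
  also have "(\<Oplus>t\<in>T. f s t) \<oplus> (\<Oplus>t\<in>T. \<Oplus>s\<in>S. f s t) = (\<Oplus>t\<in>T. f s t \<oplus> (\<Oplus>s\<in>S. f s t))"
    using insert.prems by (intro finsum_addf[symmetric]) (auto intro!: finsum_closed)
  also have "\<dots> = (\<Oplus>t\<in>T. \<Oplus>s\<in>insert s S. f s t)"
  proof (rule finsum_cong')
    fix t assume t: "t \<in> T"
    show "f s t \<oplus> (\<Oplus>s\<in>S. f s t) = (\<Oplus>s\<in>insert s S. f s t)"
      using insert.hyps insert.prems t by (subst finsum_insert) auto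
  qed (use insert.prems in \<open>auto intro!: finsum_closed\<close>)
  finally show ?case .
qed

end

context explicitly_given_algebra
begin

abbreviation comb :: "(nat \<Rightarrow> int) \<Rightarrow> 'a" where
  "comb \<equiv> int_comb R n g"

lemma gen_closed [simp]: "k \<le> n \<Longrightarrow> g k \<in> carrier R"
  using gens_closed by auto

lemma comb_closed [simp]: "comb v \<in> carrier R"
  unfolding int_comb_def by (rule finsum_closed) auto

lemma comb_cong: "(\<And>k. k \<le> n \<Longrightarrow> v k = w k) \<Longrightarrow> comb v = comb w"
  unfolding int_comb_def by (rule finsum_cong') auto

lemma comb_add: "comb (\<lambda>k. v k + w k) = comb v \<oplus> comb w"
proof -
  have "comb (\<lambda>k. v k + w k) = (\<Oplus>k\<in>{..n}. [v k] \<cdot> g k \<oplus> [w k] \<cdot> g k)"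
    unfolding int_comb_def by (rule finsum_cong') (auto simp: int_pow_add)
  also have "\<dots> = comb v \<oplus> comb w"
    unfolding int_comb_def by (rule finsum_addf) auto
  finally show ?thesis .
qed

lemma comb_zero: "comb (\<lambda>k. 0) = \<zero>"
proof -
  have "comb (\<lambda>k. 0) = (\<Oplus>k\<in>{..n}. \<zero>)"
    unfolding int_comb_def by (rule finsum_cong') (auto simp: int_pow_zero)
  then show ?thesis by simp
qed

lemma comb_scale: "comb (\<lambda>k. z * v k) = [z] \<cdot> comb v"
proof -
  have "comb (\<lambda>k. z * v k) = (\<Oplus>k\<in>{..n}. [z] \<cdot> ([v k] \<cdot> g k))"
    unfolding int_comb_def by (rule finsum_cong') (auto simp: int_pow_times)
  also have "\<dots> = [z] \<cdot> comb v"
    unfolding int_comb_def by (rule finsum_int_pow[symmetric]) auto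
  finally show ?thesis .
qed

lemma comb_sum: "finite S \<Longrightarrow> comb (\<lambda>k. \<Sum>s\<in>S. w s k) = (\<Oplus>s\<in>S. comb (w s))"
  by (induction S rule: finite_induct) (simp_all add: comb_zero comb_add)

text \<open>
  Multiplication is bilinear, and the structure constants give the products of generators.
\<close>

lemma comb_mult: "comb v \<otimes> comb w = comb (\<lambda>l. \<Sum>i\<le>n. \<Sum>j\<le>n. v i * w j * c i j l)"
proof -
  have "comb v \<otimes> comb w = (\<Oplus>i\<in>{..n}. ([v i] \<cdot> g i) \<otimes> comb w)"
    unfolding int_comb_def[of R n g v] by (rule finsum_ldistr) auto
  also have "\<dots> = (\<Oplus>i\<in>{..n}. \<Oplus>j\<in>{..n}. comb (\<lambda>l. v i * w j * c i j l))"
  proof (rule finsum_cong')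
    fix i assume "i \<in> {..n}"
    then have i: "i \<le> n" by simp
    have "([v i] \<cdot> g i) \<otimes> comb w = (\<Oplus>j\<in>{..n}. ([v i] \<cdot> g i) \<otimes> ([w j] \<cdot> g j))"
      unfolding int_comb_def[of R n g w] using i by (intro finsum_rdistr) auto
    also have "\<dots> = (\<Oplus>j\<in>{..n}. comb (\<lambda>l. v i * w j * c i j l))"
    proof (rule finsum_cong')
      fix j assume "j \<in> {..n}"
      then have j: "j \<le> n" by simp
      have "([v i] \<cdot> g i) \<otimes> ([w j] \<cdot> g j) = [(v i * w j)] \<cdot> (g i \<otimes> g j)"
        using i j by (simp add: add_pow_ldistr_int add_pow_rdistr_int int_pow_times[symmetric] mult.commute)
      then show "([v i] \<cdot> g i) \<otimes> ([w j] \<cdot> g j) = comb (\<lambda>l. v i * w j * c i j l)"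
        using i j by (simp add: structure_constants comb_scale)
    qed auto
    finally show "([v i] \<cdot> g i) \<otimes> comb w = (\<Oplus>j\<in>{..n}. comb (\<lambda>l. v i * w j * c i j l))" .
  qed (auto intro!: finsum_closed)
  also have "\<dots> = comb (\<lambda>l. \<Sum>i\<le>n. \<Sum>j\<le>n. v i * w j * c i j l)"
    by (simp add: comb_sum)
  finally show ?thesis .
qed

lemma comb_eq_zero_iff: "comb v = \<zero> \<longleftrightarrow> (\<exists>x. \<forall>k\<le>n. v k = (\<Sum>l<m. x l * A l k))"
proof -
  let ?v = "restrict v {..n}"
  have "comb v = \<zero> \<longleftrightarrow> ?v \<in> syzygies R n g"
    using comb_cong[of v ?v] by (simp add: syzygies_def)
  also have "\<dots> \<longleftrightarrow> (\<exists>x. ?v = (\<lambda>k\<in>{..n}. \<Sum>l<m. x l * A l k))"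
    by (auto simp: syzygies_eq row_lattice_def)
  also have "\<dots> \<longleftrightarrow> (\<exists>x. \<forall>k\<le>n. v k = (\<Sum>l<m. x l * A l k))"
    by (auto simp: fun_eq_iff restrict_def)
  finally show ?thesis .
qed

lemma sum_div_mod:
  fixes F :: "nat \<Rightarrow> nat \<Rightarrow> int"
  assumes "w > 0"
  shows "(\<Sum>u<h * w. F (u div w) (u mod w)) = (\<Sum>k<h. \<Sum>j<w. F k j)"
proof -
  have "(\<Sum>u<h * w. F (u div w) (u mod w)) = (\<Sum>k<h. \<Sum>u\<in>{k * w..<k * w + w}. F (u div w) (u mod w))"
    by (rule sum.nat_group[symmetric])
  also have "\<dots> = (\<Sum>k<h. \<Sum>j<w. F k j)"
  proof (rule sum.cong[OF refl])
    fix k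
    have "(\<Sum>u\<in>{k * w..<k * w + w}. F (u div w) (u mod w)) = (\<Sum>j\<in>{0..<w}. F ((j + k * w) div w) ((j + k * w) mod w))"
      using sum.shift_bounds_nat_ivl[of "\<lambda>u. F (u div w) (u mod w)" 0 "k * w" w] by (simp add: add.commute)
    also have "\<dots> = (\<Sum>j<w. F k j)"
      using assms by (intro sum.cong) auto
    finally show "(\<Sum>u\<in>{k * w..<k * w + w}. F (u div w) (u mod w)) = (\<Sum>j<w. F k j)" .
  qed
  finally show ?thesis .
qed

text \<open>The left-hand side is the combination of generators with the coefficients \<open>?v\<close>. It is zero iff
  \<open>?v\<close> is a combination of the rows of \<open>A\<close>, and the negatives of the coefficients of such a combination
  are the first \<open>m\<close> coordinates of the kernel vector.\<close>

lemma equation_iff: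
  fixes p :: nat
  defines "d \<equiv> Suc n"
  assumes f: "\<forall>k<p. f k = comb (b k)"
  shows "(\<Oplus>k\<in>{..<p}. f k \<otimes> comb (x k)) = \<zero> \<longleftrightarrow>
    (\<exists>w. (\<forall>k<p. \<forall>j<d. w (m + (k * d + j)) = x k j)
       \<and> (\<forall>l<d. (\<Sum>r<m + p * d. w r * relation_matrix d m A c b r l) = 0))"
proof -
  let ?v = "\<lambda>l. \<Sum>k<p. \<Sum>j<d. x k j * (\<Sum>i<d. b k i * c i j l)"
  have le: "{..n} = {..<d}" by (auto simp: d_def)
  have "(\<Oplus>k\<in>{..<p}. f k \<otimes> comb (x k)) = (\<Oplus>k\<in>{..<p}. comb (\<lambda>l. \<Sum>j<d. x k j * (\<Sum>i<d. b k i * c i j l)))"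
  proof (rule finsum_cong')
    fix k assume "k \<in> {..<p}"
    then have "f k \<otimes> comb (x k) = comb (\<lambda>l. \<Sum>i<d. \<Sum>j<d. b k i * x k j * c i j l)"
      using f by (simp add: comb_mult le)
    also have "\<dots> = comb (\<lambda>l. \<Sum>j<d. x k j * (\<Sum>i<d. b k i * c i j l))"
      by (subst sum.swap) (simp add: sum_distrib_left mult_ac)
    finally show "f k \<otimes> comb (x k) = comb (\<lambda>l. \<Sum>j<d. x k j * (\<Sum>i<d. b k i * c i j l))" .
  qed auto
  also have "\<dots> = comb ?v" by (rule comb_sum[symmetric]) simp
  finally have eq: "(\<Oplus>k\<in>{..<p}. f k \<otimes> comb (x k)) = comb ?v" .
  have rel: "(\<Sum>r<m + p * d. w r * relation_matrix d m A c b r l)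
      = (\<Sum>r<m. w r * A r l) + ?v l"
    if w: "\<forall>k<p. \<forall>j<d. w (m + (k * d + j)) = x k j" for w l
  proof -
    have "{..<m + p * d} = {..<m} \<union> {m..<m + p * d}" by auto
    then have "(\<Sum>r<m + p * d. w r * relation_matrix d m A c b r l)
      = (\<Sum>r<m. w r * relation_matrix d m A c b r l) + (\<Sum>r\<in>{m..<m + p * d}. w r * relation_matrix d m A c b r l)"
      by (simp add: sum.union_disjoint ivl_disj_int)
    also have "(\<Sum>r<m. w r * relation_matrix d m A c b r l) = (\<Sum>r<m. w r * A r l)"
      by (simp add: relation_matrix_def)
    also have "(\<Sum>r\<in>{m..<m + p * d}. w r * relation_matrix d m A c b r l)
      = (\<Sum>u<p * d. w (m + u) * (\<Sum>i<d. b (u div d) i * c i (u mod d) l))"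
      using sum.shift_bounds_nat_ivl[of "\<lambda>r. w r * relation_matrix d m A c b r l" 0 m "p * d"]
      by (simp add: relation_matrix_def add.commute lessThan_atLeast0)
    also have "\<dots> = (\<Sum>u<p * d. (\<lambda>k j. w (m + (k * d + j)) * (\<Sum>i<d. b k i * c i j l)) (u div d) (u mod d))"
      by (simp add: div_mult_mod_eq)
    also have "\<dots> = (\<Sum>k<p. \<Sum>j<d. w (m + (k * d + j)) * (\<Sum>i<d. b k i * c i j l))"
      by (rule sum_div_mod) (simp add: d_def)
    also have "\<dots> = ?v l" using w by simp
    finally show ?thesis .
  qed
  show ?thesis unfolding eq comb_eq_zero_iff
  proof
    assume "\<exists>x. \<forall>k\<le>n. ?v k = (\<Sum>l<m. x l * A l k)"
    then obtain z where z: "\<And>k. k < d \<Longrightarrow> ?v k = (\<Sum>l<m. z l * A l k)" by (auto simp: d_def less_Suc_eq_le)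
    \<comment> \<open>a division by \<open>d\<close> recovers \<open>k\<close> and \<open>j\<close> from the row number \<open>m + (k * d + j)\<close>\<close>
    define w where "w r = (if r < m then - z r else x ((r - m) div d) ((r - m) mod d))" for r
    have w: "\<forall>k<p. \<forall>j<d. w (m + (k * d + j)) = x k j" by (simp add: w_def)
    have "(\<Sum>r<m + p * d. w r * relation_matrix d m A c b r l) = 0" if "l < d" for l
      unfolding rel[OF w] z[OF that] by (simp add: w_def sum_negf)
    with w show "\<exists>w. (\<forall>k<p. \<forall>j<d. w (m + (k * d + j)) = x k j)
       \<and> (\<forall>l<d. (\<Sum>r<m + p * d. w r * relation_matrix d m A c b r l) = 0)" by blast
  next
    assume "\<exists>w. (\<forall>k<p. \<forall>j<d. w (m + (k * d + j)) = x k j)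
       \<and> (\<forall>l<d. (\<Sum>r<m + p * d. w r * relation_matrix d m A c b r l) = 0)"
    then obtain w where w: "\<forall>k<p. \<forall>j<d. w (m + (k * d + j)) = x k j"
      and 0: "\<forall>l<d. (\<Sum>r<m + p * d. w r * relation_matrix d m A c b r l) = 0" by blast
    have "?v l = (\<Sum>r<m. - w r * A r l)" if "l \<le> n" for l
    proof -
      have "(\<Sum>r<m. w r * A r l) + ?v l = 0" using 0 that unfolding rel[OF w, symmetric] by (simp add: d_def)
      then show ?thesis by (simp add: sum_negf)
    qed
    then show "\<exists>x. \<forall>k\<le>n. ?v k = (\<Sum>l<m. x l * A l k)" by (intro exI[of _ "\<lambda>r. - w r"]) blast
  qed
qed

text \<open>
  Solutions are even integer combinations of the generators, and an integer \<open>a\<close> acts on \<open>R\<close> as the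
  element \<open>a * 1\<close>. In the other direction, the solution space is closed under combinations over \<open>R\<close>.
\<close>

lemma span_eq_solution_space:
  fixes p q :: nat and u :: "nat \<Rightarrow> nat \<Rightarrow> int"
  defines "d \<equiv> Suc n"
  assumes f: "\<forall>k<p. f k = comb (b k)"
    and u: "\<And>x. (\<forall>l<d. (\<Sum>r<m + p * d. x r * relation_matrix d m A c b r l) = 0) \<longleftrightarrow>
              (\<exists>a. \<forall>r<m + p * d. x r = (\<Sum>s<q. a s * u s r))"
  shows "module_span R p q (\<lambda>s k. comb (\<lambda>j. u s (m + (k * d + j)))) = solution_space R p f"
proof -
  let ?Y = "\<lambda>s k. comb (\<lambda>j. u s (m + (k * d + j)))"
  have fc: "f k \<in> carrier R" if "k < p" for k using f that by simp
  have gen: "(\<Oplus>k\<in>{..<p}. f k \<otimes> ?Y s k) = \<zero>" if s: "s < q" for s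
  proof -
    have "\<forall>r<m + p * d. u s r = (\<Sum>s'<q. (if s' = s then 1 else 0) * u s' r)"
      using s by (simp add: if_distrib[of "\<lambda>y. y * _"] sum.delta cong: if_cong)
    then have "\<exists>a. \<forall>r<m + p * d. u s r = (\<Sum>s'<q. a s' * u s' r)"
      by (rule exI[of _ "\<lambda>s'. if s' = s then 1 else 0"])
    then have "\<forall>l<d. (\<Sum>r<m + p * d. u s r * relation_matrix d m A c b r l) = 0"
      by (simp only: u)
    then show ?thesis unfolding equation_iff[OF f, of "\<lambda>k j. u s (m + (k * d + j))", folded d_def] by blast
  qed
  show ?thesis
  proof
    show "module_span R p q ?Y \<subseteq> solution_space R p f"
    proof
      fix y assume "y \<in> module_span R p q ?Y"
      then obtain r where r: "r \<in> {..<q} \<rightarrow> carrier R" and y: "y = (\<lambda>k\<in>{..<p}. \<Oplus>s\<in>{..<q}. r s \<otimes> ?Y s k)"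
        unfolding module_span_def by blast
      have yc: "y \<in> {..<p} \<rightarrow>\<^sub>E carrier R" using r unfolding y by (auto intro!: finsum_closed)
      have "(\<Oplus>k\<in>{..<p}. f k \<otimes> y k) = (\<Oplus>k\<in>{..<p}. \<Oplus>s\<in>{..<q}. r s \<otimes> (f k \<otimes> ?Y s k))"
      proof (rule finsum_cong')
        fix k assume k: "k \<in> {..<p}"
        then have "f k \<otimes> y k = (\<Oplus>s\<in>{..<q}. f k \<otimes> (r s \<otimes> ?Y s k))"
          unfolding y using r fc by (simp, intro finsum_rdistr) auto
        also have "\<dots> = (\<Oplus>s\<in>{..<q}. r s \<otimes> (f k \<otimes> ?Y s k))"
          using r fc k by (intro finsum_cong') (auto simp: Pi_iff m_lcomm)
        finally show "f k \<otimes> y k = (\<Oplus>s\<in>{..<q}. r s \<otimes> (f k \<otimes> ?Y s k))" .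
      qed (use r fc in \<open>auto intro!: finsum_closed\<close>)
      also have "\<dots> = (\<Oplus>s\<in>{..<q}. \<Oplus>k\<in>{..<p}. r s \<otimes> (f k \<otimes> ?Y s k))"
        using r fc by (intro finsum_swap) (auto simp: Pi_iff)
      also have "\<dots> = (\<Oplus>s\<in>{..<q}. \<zero>)"
      proof (rule finsum_cong')
        fix s assume s: "s \<in> {..<q}"
        have "(\<Oplus>k\<in>{..<p}. r s \<otimes> (f k \<otimes> ?Y s k)) = r s \<otimes> (\<Oplus>k\<in>{..<p}. f k \<otimes> ?Y s k)"
          using r s fc by (intro finsum_rdistr[symmetric]) auto
        also have "\<dots> = \<zero>" using gen s r by (auto simp: Pi_iff)
        finally show "(\<Oplus>k\<in>{..<p}. r s \<otimes> (f k \<otimes> ?Y s k)) = \<zero>" .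
      qed auto
      also have "\<dots> = \<zero>" by simp
      finally show "y \<in> solution_space R p f" using yc by (simp add: solution_space_def)
    qed
    show "solution_space R p f \<subseteq> module_span R p q ?Y"
    proof
      fix y assume y: "y \<in> solution_space R p f"
      then have yc: "y \<in> {..<p} \<rightarrow>\<^sub>E carrier R" and y0: "(\<Oplus>k\<in>{..<p}. f k \<otimes> y k) = \<zero>"
        by (auto simp: solution_space_def)
      have "\<forall>k. \<exists>x. k < p \<longrightarrow> y k = comb x"
        using yc gens_generate by (auto simp: PiE_iff image_iff)
      then obtain x where x: "\<And>k. k < p \<Longrightarrow> y k = comb (x k)" by metis
      have "(\<Oplus>k\<in>{..<p}. f k \<otimes> comb (x k)) = (\<Oplus>k\<in>{..<p}. f k \<otimes> y k)"
        using fc by (intro finsum_cong') (auto simp: x)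
      with y0 obtain w where w: "\<forall>k<p. \<forall>j<d. w (m + (k * d + j)) = x k j"
        and ker: "\<forall>l<d. (\<Sum>r<m + p * d. w r * relation_matrix d m A c b r l) = 0"
        using equation_iff[OF f, of x, folded d_def] by auto
      from ker obtain a where a: "\<forall>r<m + p * d. w r = (\<Sum>s<q. a s * u s r)" unfolding u by blast
      define r where "r s = [a s] \<cdot> \<one>" for s
      have r: "r \<in> {..<q} \<rightarrow> carrier R" by (auto simp: r_def)
      have yk: "y k = (\<Oplus>s\<in>{..<q}. r s \<otimes> ?Y s k)" if k: "k < p" for k
      proof -
        have "y k = comb (\<lambda>j. \<Sum>s<q. a s * u s (m + (k * d + j)))"
          unfolding x[OF k]
        proof (rule comb_cong)
          fix j assume "j \<le> n"
          then have j: "j < d" by (simp add: d_def)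
          have "k * d + j < Suc k * d" using j by simp
          also have "\<dots> \<le> p * d" using k by (intro mult_le_mono) auto
          finally have "m + (k * d + j) < m + p * d" by simp
          from a[rule_format, OF this] show "x k j = (\<Sum>s<q. a s * u s (m + (k * d + j)))"
            unfolding w[rule_format, OF k j] .
        qed
        also have "\<dots> = (\<Oplus>s\<in>{..<q}. [a s] \<cdot> ?Y s k)"
          by (simp add: comb_sum comb_scale)
        also have "\<dots> = (\<Oplus>s\<in>{..<q}. r s \<otimes> ?Y s k)"
          by (rule finsum_cong') (auto simp: r_def add_pow_ldistr_int)
        finally show ?thesis .
      qed
      have "y = (\<lambda>k\<in>{..<p}. \<Oplus>s\<in>{..<q}. r s \<otimes> ?Y s k)"
        using yc by (auto simp: fun_eq_iff yk PiE_iff extensional_def)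
      then show "y \<in> module_span R p q ?Y" using r unfolding module_span_def by blast
    qed
  qed
qed

end

section \<open>Polynomial running time\<close>

lemma le_power2_of_log:
  fixes M :: int and Z :: nat
  assumes "M \<ge> 2" "log 2 (real_of_int M) \<le> real Z"
  shows "M \<le> 2 ^ Z"
proof -
  have "real_of_int M = 2 powr (log 2 (real_of_int M))" using assms(1) by simp
  also have "\<dots> \<le> 2 powr real Z" using assms(2) by (intro powr_mono) auto
  also have "\<dots> = real_of_int (2 ^ Z)" by (simp add: powr_realpow)
  finally show ?thesis by (simp only: of_int_le_iff)
qed

text \<open>
  The maxima in the two bit complexities are at least 2, so their logarithms are at least 1 and each
  complexity bounds its first factor; if that is positive, it bounds the logarithm as well. There are
  entries \<open>b k j\<close> to be bounded only for \<open>p > 0\<close>.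
\<close>

lemma bits_bound:
  fixes Z :: nat
  assumes Z: "algebra_bits n m A c + elements_bits n p b \<le> real Z" and d: "d = Suc n"
  shows "d * (d * d) \<le> Z" "m * d \<le> Z" "p * d \<le> Z"
    "\<And>l k. l < m \<Longrightarrow> k < d \<Longrightarrow> \<bar>A l k\<bar> \<le> 2 ^ Z"
    "\<And>i j k. i < d \<Longrightarrow> j < d \<Longrightarrow> k < d \<Longrightarrow> \<bar>c i j k\<bar> \<le> 2 ^ Z"
    "\<And>k j. k < p \<Longrightarrow> j < d \<Longrightarrow> \<bar>b k j\<bar> \<le> 2 ^ Z"
proof -
  define SA where "SA = {2} \<union> {\<bar>A l k\<bar> | l k. l < m \<and> k \<le> n} \<union> {\<bar>c i j k\<bar> | i j k. i \<le> n \<and> j \<le> n \<and> k \<le> n}"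
  define SB where "SB = {2} \<union> {\<bar>b k j\<bar> | k j. k < p \<and> j \<le> n}"
  have "finite {\<bar>c i j k\<bar> | i j k. i \<le> n \<and> j \<le> n \<and> k \<le> n}"
    by (rule finite_subset[of _ "(\<lambda>(i, j, k). \<bar>c i j k\<bar>) ` ({..n} \<times> {..n} \<times> {..n})"]) force+
  moreover have "finite {\<bar>A l k\<bar> | l k. l < m \<and> k \<le> n}" "finite {\<bar>b k j\<bar> | k j. k < p \<and> j \<le> n}"
    by (rule finite_image_set2; simp)+
  ultimately have finA: "finite SA" and finB: "finite SB" unfolding SA_def SB_def by simp_all
  have MA: "z \<le> Max SA" if "z \<in> SA" for z using finA that by (rule Max_ge)
  have MB: "z \<le> Max SB" if "z \<in> SB" for z using finB that by (rule Max_ge)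
  have A2: "2 \<le> Max SA" by (rule MA) (simp add: SA_def)
  have B2: "2 \<le> Max SB" by (rule MB) (simp add: SB_def)
  have lA: "1 \<le> log 2 (real_of_int (Max SA))" using A2 by simp
  have lB: "1 \<le> log 2 (real_of_int (Max SB))" using B2 by simp
  have eA: "algebra_bits n m A c = real (d * (d * d) + m * d) * log 2 (real_of_int (Max SA))"
    unfolding algebra_bits_def Let_def SA_def[symmetric] by (simp add: d power3_eq_cube algebra_simps)
  have eB: "elements_bits n p b = real (p * d) * log 2 (real_of_int (Max SB))"
    unfolding elements_bits_def Let_def SB_def[symmetric] by (simp add: d)
  have gA: "real (d * (d * d) + m * d) * 1 \<le> algebra_bits n m A c"
    unfolding eA using lA by (intro mult_left_mono) auto
  have gB: "real (p * d) * 1 \<le> elements_bits n p b"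
    unfolding eB using lB by (intro mult_left_mono) auto
  have nA: "0 \<le> algebra_bits n m A c" unfolding eA using lA by (intro mult_nonneg_nonneg) auto
  have nB: "0 \<le> elements_bits n p b" unfolding eB using lB by (intro mult_nonneg_nonneg) auto
  have "real (d * (d * d) + m * d) \<le> real Z"
    by (rule order_trans[OF gA[unfolded mult_1_right]]) (use Z nB in linarith)
  moreover have "real (p * d) \<le> real Z"
    by (rule order_trans[OF gB[unfolded mult_1_right]]) (use Z nA in linarith)
  ultimately
  have sz: "d * (d * d) + m * d \<le> Z" "p * d \<le> Z" by (simp_all only: of_nat_le_iff)
  then show "d * (d * d) \<le> Z" "m * d \<le> Z" "p * d \<le> Z" by linarith+
  have "1 * log 2 (real_of_int (Max SA)) \<le> algebra_bits n m A c"
    unfolding eA using lA by (intro mult_right_mono) (auto simp: d)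
  then have "log 2 (real_of_int (Max SA)) \<le> real Z"
    using Z nB by linarith
  then have MAZ: "Max SA \<le> 2 ^ Z" by (rule le_power2_of_log[OF A2])
  show "\<bar>A l k\<bar> \<le> 2 ^ Z" if "l < m" "k < d" for l k
    by (rule order_trans[OF MA MAZ]) (use that in \<open>unfold SA_def d less_Suc_eq_le, blast\<close>)
  show "\<bar>c i j k\<bar> \<le> 2 ^ Z" if "i < d" "j < d" "k < d" for i j k
    by (rule order_trans[OF MA MAZ]) (use that in \<open>unfold SA_def d less_Suc_eq_le, blast\<close>)
  show "\<bar>b k j\<bar> \<le> 2 ^ Z" if kj: "k < p" "j < d" for k j
  proof -
    have "1 \<le> p * d" using kj by (simp add: Suc_le_eq d)
    then have "real 1 \<le> real (p * d)" by (simp only: of_nat_le_iff)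
    then have "1 * log 2 (real_of_int (Max SB)) \<le> elements_bits n p b"
      unfolding eB of_nat_1 by (rule mult_right_mono) (use lB in linarith)
    then have "log 2 (real_of_int (Max SB)) \<le> real Z"
      using Z nA by linarith
    then have MBZ: "Max SB \<le> 2 ^ Z" by (rule le_power2_of_log[OF B2])
    show ?thesis by (rule order_trans[OF MB MBZ]) (use kj in \<open>unfold SB_def d less_Suc_eq_le, blast\<close>)
  qed
qed

theorem corollary2p8:
  "\<exists>(prog :: com) (P :: real poly).
     \<forall>(R :: 'a ring) n g m A c p b f.
       explicitly_given_algebra R n g m A c \<longrightarrow>
       (\<forall>k<p. f k = int_comb R n g (b k)) \<longrightarrow>
       (\<exists>t q h.
          computes_in prog (encode_input n m A c p b) t (encode_output n p q h) \<and>
          real t \<le> poly P (algebra_bits n m A c + elements_bits n p b) \<and>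
          module_span R p q (\<lambda>s k. int_comb R n g (h s k)) = solution_space R p f)"
proof -
  obtain C e where time_bound: "\<And>X. time_bound X program \<le> C * (X + 1) ^ e" using time_bound_poly by blast
  define T where "T Z = C * (60 * Z\<^sup>2 + 1) ^ e * (30 * Z\<^sup>2)\<^sup>2" for Z :: nat
  \<comment> \<open>the time bound with \<open>Z\<close> replaced by the polynomial \<open>x + 1\<close>, as \<open>Z\<close> is a complexity \<open>x\<close> rounded up\<close>
  define P :: "real poly" where
    "P = [:real C:] * (60 * [:1, 1:]\<^sup>2 + 1) ^ e * (30 * [:1, 1:]\<^sup>2)\<^sup>2"
  have mono: "real C * (60 * y + 1) ^ e * (30 * y)\<^sup>2 \<le> real C * (60 * z + 1) ^ e * (30 * z)\<^sup>2"
    if "0 \<le> y" "y \<le> z" for y z :: real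
    using that by (intro mult_mono power_mono add_mono) auto
  have P: "real (T Z) \<le> poly P x" if "real Z \<le> x + 1" for Z x
  proof -
    have sq: "(real Z)\<^sup>2 \<le> (1 + x)\<^sup>2" using that by (intro power_mono) auto
    have "real (T Z) = real C * (60 * (real Z)\<^sup>2 + 1) ^ e * (30 * (real Z)\<^sup>2)\<^sup>2" by (simp add: T_def add.commute)
    also have "\<dots> \<le> real C * (60 * (1 + x)\<^sup>2 + 1) ^ e * (30 * (1 + x)\<^sup>2)\<^sup>2"
      by (rule mono[OF _ sq]) simp
    also have "\<dots> = poly P x" by (simp add: P_def)
    finally show ?thesis .
  qed
  show ?thesis
  proof (rule exI[of _ program], rule exI[of _ P], intro allI impI)
    fix R :: "'a ring" and n m p :: nat and g f :: "nat \<Rightarrow> 'a" and A b :: "nat \<Rightarrow> nat \<Rightarrow> int"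
      and c :: "nat \<Rightarrow> nat \<Rightarrow> nat \<Rightarrow> int"
    assume alg: "explicitly_given_algebra R n g m A c" and f: "\<forall>k<p. f k = int_comb R n g (b k)"
    let ?\<beta> = "algebra_bits n m A c + elements_bits n p b"
    let ?d = "Suc n"
    define Z where "Z = nat \<lceil>?\<beta>\<rceil>"
    have Z1: "?\<beta> \<le> real Z" unfolding Z_def by (rule real_nat_ceiling_ge)
    note bd = bits_bound[OF Z1 refl]
    have Zb: "real Z \<le> ?\<beta> + 1"
    proof (cases "Z = 0")
      case True
      then show ?thesis using bd(1) by simp
    next
      case False
      then show ?thesis unfolding Z_def by linarith
    qed
    have "\<exists>t u. computes_in program (encode_input n m A c p b) t
        (encode_output n p (2 * (m + p * ?d)) (\<lambda>s k j. u s (m + (k * ?d + j))))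
      \<and> t \<le> time_bound (60 * Z\<^sup>2) program * (30 * Z\<^sup>2)\<^sup>2
      \<and> (\<forall>x. (\<forall>l<?d. (\<Sum>j<m + p * ?d. x j * relation_matrix ?d m A c b j l) = 0) \<longleftrightarrow>
              (\<exists>a. \<forall>i<m + p * ?d. x i = (\<Sum>s<2 * (m + p * ?d). a s * u s i)))"
      by (rule program_correct) (rule bd; assumption)+
    then obtain t u where
      tu: "computes_in program (encode_input n m A c p b) t
        (encode_output n p (2 * (m + p * ?d)) (\<lambda>s k j. u s (m + (k * ?d + j))))"
      "t \<le> time_bound (60 * Z\<^sup>2) program * (30 * Z\<^sup>2)\<^sup>2"
      and u: "\<forall>x. (\<forall>l<?d. (\<Sum>j<m + p * ?d. x j * relation_matrix ?d m A c b j l) = 0) \<longleftrightarrow>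
              (\<exists>a. \<forall>i<m + p * ?d. x i = (\<Sum>s<2 * (m + p * ?d). a s * u s i))"
      by (elim exE conjE) (rule that)
    have "t \<le> T Z" using tu(2) mult_le_mono1[OF time_bound[of "60 * Z\<^sup>2"], of "(30 * Z\<^sup>2)\<^sup>2"] unfolding T_def by linarith
    then have "real t \<le> real (T Z)" by simp
    then have time: "real t \<le> poly P ?\<beta>" using P[OF Zb] by linarith
    have span: "module_span R p (2 * (m + p * ?d)) (\<lambda>s k. int_comb R n g (\<lambda>j. u s (m + (k * ?d + j)))) = solution_space R p f"
      by (rule explicitly_given_algebra.span_eq_solution_space[OF alg f]) (rule u[rule_format])
    show "\<exists>t q h. computes_in program (encode_input n m A c p b) t (encode_output n p q h) \<and>
          real t \<le> poly P ?\<beta> \<and>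
          module_span R p q (\<lambda>s k. int_comb R n g (h s k)) = solution_space R p f"
      by (rule exI[of _ t], rule exI[of _ "2 * (m + p * ?d)"], rule exI[of _ "\<lambda>s k j. u s (m + (k * ?d + j))"],
          intro conjI) (rule tu(1), rule time, rule span)
  qed
qed

end
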